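(* Let $\mathbb D$ be a cartesian equipment. Then its loose bicategory $\mathcal L(\mathbb D)$ is a cartesian bicategory.
   Context: **Equipments.** A (pseudo) double category $\mathbb D$ has a tight category $\mathbb D_0$ and a category $\mathbb D_1$ of loose arrows $\alpha\colon I\nrightarrow J$ and cells, with $\mathrm{src},\mathrm{tgt}\colon\mathbb D_1\to\mathbb D_0$, units $\delta_I\colon I\nrightarrow I$ and loose composition. It is an *equipment* if $\langle\mathrm{src},\mathrm{tgt}\rangle\colon\mathbb D_1\to\mathbb D_0\times\mathbb D_0$ is a fibration. It is a *cartesian equipment* if the double functors $\mathbb D\to\mathbb 1$ and $\Delta\colon\mathbb D\to\mathbb D\times\mathbb D$ have right adjoints in the 2-category of equipments, (pseudo) double functors and tightwise (vertical) transformations. The *loose bicategory* $\mathcal L(\mathbb D)$ has as 0-cells the objects of $\mathbb D$, as 1-cells the loose arrows, and as 2-cells the globular cells (those whose source and target tight arrows are identities). **Cartesian bicategories (Carboni–Kelly–Walters–Wood).** For a bicategory $\mathcal B$, $\mathrm{Map}(\mathcal B)$ is the locally full sub-bicategory on the left adjoint 1-cells (maps); $f^*$ denotes the right adjoint of a map $f$. Composition is written in diagrammatic order. $\mathcal B$ is *cartesian* if: (i) every hom-category $\mathcal B(I,J)$ has finite products $\top,\wedge$; (ii) $\mathrm{Map}(\mathcal B)$ has finite products in the bicategorical sense: there is an object $1$ with $\mathrm{Map}(\mathcal B)(K,1)$ equivalent to the terminal category for all $K$, and for all $I,J$ an object $I\times J$ with $\mathrm{Map}(\mathcal B)(K,I\times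 J)\simeq\mathrm{Map}(\mathcal B)(K,I)\times\mathrm{Map}(\mathcal B)(K,J)$ for all $K$ (induced by projections $p\colon I\times J\to I$, $r\colon I\times J\to J$); (iii) the lax functors $\mathbf 1\to\mathcal B$ (picking $1$ and the 1-cell $\top\colon 1\to 1$) and $\mathcal B\times\mathcal B\to\mathcal B$ (sending $(\alpha\colon I\to J,\beta\colon K\to L)$ to $(p\,\alpha\,p^* )\wedge(r\,\beta\,r^* )\colon I\times K\to J\times L$), with the canonical laxity cells induced by the universal properties, are pseudofunctors. *)

theory Defs
  imports Main
begin

(* Conventions.  Every composition (in a category, along loose arrows, of 1-cells and
   of 2-cells) is written in diagrammatic order.  All structures are carrier based:
   operations are unconstrained outside the indicated carriers. *)

section \<open>Categories\<close>

record ('o, 'a) cat =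
  Obj :: "'o set"
  Arr :: "'a set"
  Dom :: "'a \<Rightarrow> 'o"
  Cod :: "'a \<Rightarrow> 'o"
  Ident :: "'o \<Rightarrow> 'a"
  Comp :: "'a \<Rightarrow> 'a \<Rightarrow> 'a"  (infixl "\<cdot>\<index>" 70)

definition hom :: "('o, 'a) cat \<Rightarrow> 'o \<Rightarrow> 'o \<Rightarrow> 'a set" where
  "hom C x y = {f \<in> Arr C. Dom C f = x \<and> Cod C f = y}"

locale category =
  fixes C :: "('o, 'a) cat"  (structure)
  assumes Dom_Obj: "f \<in> Arr C \<Longrightarrow> Dom C f \<in> Obj C"
    and Cod_Obj: "f \<in> Arr C \<Longrightarrow> Cod C f \<in> Obj C"
    and Ident_hom: "x \<in> Obj C \<Longrightarrow> Ident C x \<in> hom C x x"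
    and Comp_hom: "f \<in> hom C x y \<Longrightarrow> g \<in> hom C y z \<Longrightarrow> f \<cdot> g \<in> hom C x z"
    and Ident_left: "f \<in> hom C x y \<Longrightarrow> Ident C x \<cdot> f = f"
    and Ident_right: "f \<in> hom C x y \<Longrightarrow> f \<cdot> Ident C y = f"
    and Comp_assoc: "f \<in> hom C x y \<Longrightarrow> g \<in> hom C y z \<Longrightarrow> h \<in> hom C z w \<Longrightarrow>
      (f \<cdot> g) \<cdot> h = f \<cdot> (g \<cdot> h)"

definition inverse_arrows :: "('o, 'a) cat \<Rightarrow> 'a \<Rightarrow> 'a \<Rightarrow> bool" where
  "inverse_arrows C f g \<longleftrightarrow>
    f \<in> Arr C \<and> g \<in> hom C (Cod C f) (Dom C f) \<and>
    f \<cdot>\<^bsub>C\<^esub> g = Ident C (Dom C f) \<and> g \<cdot>\<^bsub>C\<^esub> f = Ident C (Cod C f)"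

definition invertible :: "('o, 'a) cat \<Rightarrow> 'a \<Rightarrow> bool" where
  "invertible C f \<longleftrightarrow> (\<exists>g. inverse_arrows C f g)"

definition Inv :: "('o, 'a) cat \<Rightarrow> 'a \<Rightarrow> 'a" where
  "Inv C f = (THE g. inverse_arrows C f g)"

definition full_subcat :: "('o, 'a) cat \<Rightarrow> 'o set \<Rightarrow> ('o, 'a) cat" where
  "full_subcat C S = C\<lparr>Obj := Obj C \<inter> S, Arr := {f \<in> Arr C. Dom C f \<in> S \<and> Cod C f \<in> S}\<rparr>"

definition cat_one :: "(unit, unit) cat" where
  "cat_one = \<lparr>Obj = UNIV, Arr = UNIV, Dom = (\<lambda>_. ()), Cod = (\<lambda>_. ()),
    Ident = (\<lambda>_. ()), Comp = (\<lambda>_ _. ())\<rparr>"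

definition cat_prod :: "('o, 'a) cat \<Rightarrow> ('p, 'b) cat \<Rightarrow> ('o \<times> 'p, 'a \<times> 'b) cat" where
  "cat_prod C D = \<lparr>Obj = Obj C \<times> Obj D, Arr = Arr C \<times> Arr D,
    Dom = map_prod (Dom C) (Dom D), Cod = map_prod (Cod C) (Cod D),
    Ident = map_prod (Ident C) (Ident D),
    Comp = (\<lambda>(f, f') (g, g'). (f \<cdot>\<^bsub>C\<^esub> g, f' \<cdot>\<^bsub>D\<^esub> g'))\<rparr>"

subsection \<open>Functors, natural isomorphisms, equivalences, fibrations\<close>

record ('o, 'a, 'p, 'b) func =
  fobj :: "'o \<Rightarrow> 'p"
  farr :: "'a \<Rightarrow> 'b"

locale is_functor =
  A: category A + B: category B
  for A :: "('o, 'a) cat" and B :: "('p, 'b) cat" +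
  fixes F :: "('o, 'a, 'p, 'b) func"
  assumes fobj_Obj: "x \<in> Obj A \<Longrightarrow> fobj F x \<in> Obj B"
    and farr_hom: "f \<in> hom A x y \<Longrightarrow> farr F f \<in> hom B (fobj F x) (fobj F y)"
    and farr_Ident: "x \<in> Obj A \<Longrightarrow> farr F (Ident A x) = Ident B (fobj F x)"
    and farr_Comp: "f \<in> hom A x y \<Longrightarrow> g \<in> hom A y z \<Longrightarrow>
      farr F (f \<cdot>\<^bsub>A\<^esub> g) = farr F f \<cdot>\<^bsub>B\<^esub> farr F g"

definition func_id :: "('o, 'a, 'o, 'a) func" where
  "func_id = \<lparr>fobj = (\<lambda>x. x), farr = (\<lambda>f. f)\<rparr>"

definition func_comp ::
    "('o, 'a, 'p, 'b) func \<Rightarrow> ('p, 'b, 'q, 'c) func \<Rightarrow> ('o, 'a, 'q, 'c) func" where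
  "func_comp F G = \<lparr>fobj = (\<lambda>x. fobj G (fobj F x)), farr = (\<lambda>f. farr G (farr F f))\<rparr>"

definition func_prod ::
    "('o, 'a, 'p, 'b) func \<Rightarrow> ('o', 'a', 'p', 'b') func \<Rightarrow>
      ('o \<times> 'o', 'a \<times> 'a', 'p \<times> 'p', 'b \<times> 'b') func" where
  "func_prod F G = \<lparr>fobj = map_prod (fobj F) (fobj G), farr = map_prod (farr F) (farr G)\<rparr>"

definition func_pair ::
    "('o, 'a, 'p, 'b) func \<Rightarrow> ('o, 'a, 'q, 'c) func \<Rightarrow> ('o, 'a, 'p \<times> 'q, 'b \<times> 'c) func" where
  "func_pair F G = \<lparr>fobj = (\<lambda>x. (fobj F x, fobj G x)), farr = (\<lambda>f. (farr F f, farr G f))\<rparr>"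

definition natural_iso ::
    "('o, 'a) cat \<Rightarrow> ('p, 'b) cat \<Rightarrow> ('o, 'a, 'p, 'b) func \<Rightarrow> ('o, 'a, 'p, 'b) func \<Rightarrow>
      ('o \<Rightarrow> 'b) \<Rightarrow> bool" where
  "natural_iso A B F G \<tau> \<longleftrightarrow>
    is_functor A B F \<and> is_functor A B G \<and>
    (\<forall>x \<in> Obj A. \<tau> x \<in> hom B (fobj F x) (fobj G x) \<and> invertible B (\<tau> x)) \<and>
    (\<forall>f \<in> Arr A. farr F f \<cdot>\<^bsub>B\<^esub> \<tau> (Cod A f) = \<tau> (Dom A f) \<cdot>\<^bsub>B\<^esub> farr G f)"

definition is_equivalence ::
    "('o, 'a) cat \<Rightarrow> ('p, 'b) cat \<Rightarrow> ('o, 'a, 'p, 'b) func \<Rightarrow> bool" where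
  "is_equivalence A B F \<longleftrightarrow>
    (\<exists>G \<sigma> \<tau>. is_functor A B F \<and> is_functor B A G \<and>
      natural_iso A A func_id (func_comp F G) \<sigma> \<and>
      natural_iso B B (func_comp G F) func_id \<tau>)"

definition equivalent_cats :: "('o, 'a) cat \<Rightarrow> ('p, 'b) cat \<Rightarrow> bool" where
  "equivalent_cats A B \<longleftrightarrow> (\<exists>F. is_equivalence A B F)"

definition cartesian_arrow ::
    "('o, 'a) cat \<Rightarrow> ('p, 'b) cat \<Rightarrow> ('o, 'a, 'p, 'b) func \<Rightarrow> 'a \<Rightarrow> bool" where
  "cartesian_arrow E B P \<phi> \<longleftrightarrow>
    \<phi> \<in> Arr E \<and>
    (\<forall>g \<in> Arr E. \<forall>h \<in> hom B (fobj P (Dom E g)) (fobj P (Dom E \<phi>)).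
      Cod E g = Cod E \<phi> \<and> h \<cdot>\<^bsub>B\<^esub> farr P \<phi> = farr P g \<longrightarrow>
      (\<exists>!k. k \<in> hom E (Dom E g) (Dom E \<phi>) \<and> farr P k = h \<and> k \<cdot>\<^bsub>E\<^esub> \<phi> = g))"

definition is_fibration ::
    "('o, 'a) cat \<Rightarrow> ('p, 'b) cat \<Rightarrow> ('o, 'a, 'p, 'b) func \<Rightarrow> bool" where
  "is_fibration E B P \<longleftrightarrow>
    is_functor E B P \<and>
    (\<forall>e \<in> Obj E. \<forall>f \<in> Arr B. Cod B f = fobj P e \<longrightarrow>
      (\<exists>\<phi>. cartesian_arrow E B P \<phi> \<and> Cod E \<phi> = e \<and> farr P \<phi> = f))"

subsection \<open>Finite products in a category\<close>

definition is_terminal :: "('o, 'a) cat \<Rightarrow> 'o \<Rightarrow> bool" where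
  "is_terminal C t \<longleftrightarrow> t \<in> Obj C \<and> (\<forall>x \<in> Obj C. \<exists>!f. f \<in> hom C x t)"

definition is_product :: "('o, 'a) cat \<Rightarrow> 'o \<Rightarrow> 'o \<Rightarrow> 'o \<Rightarrow> 'a \<Rightarrow> 'a \<Rightarrow> bool" where
  "is_product C a b c \<pi> \<rho> \<longleftrightarrow>
    c \<in> Obj C \<and> \<pi> \<in> hom C c a \<and> \<rho> \<in> hom C c b \<and>
    (\<forall>x \<in> Obj C. \<forall>f \<in> hom C x a. \<forall>g \<in> hom C x b.
      \<exists>!h. h \<in> hom C x c \<and> h \<cdot>\<^bsub>C\<^esub> \<pi> = f \<and> h \<cdot>\<^bsub>C\<^esub> \<rho> = g)"

definition has_finite_products :: "('o, 'a) cat \<Rightarrow> bool" where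
  "has_finite_products C \<longleftrightarrow>
    (\<exists>t. is_terminal C t) \<and>
    (\<forall>a \<in> Obj C. \<forall>b \<in> Obj C. \<exists>c \<pi> \<rho>. is_product C a b c \<pi> \<rho>)"

section \<open>Pseudo double categories\<close>

(* The cells are the arrows of the category of loose arrows; a cell with domain \<alpha> and
   codomain \<beta> has the tight arrows farr (src D) a and farr (tgt D) a as its sides. *)

record ('o, 't, 'l, 'c) dblcat =
  tight :: "('o, 't) cat"
  loose :: "('l, 'c) cat"
  src :: "('l, 'c, 'o, 't) func"
  tgt :: "('l, 'c, 'o, 't) func"
  units :: "('o, 't, 'l, 'c) func"
  lcomp :: "'l \<Rightarrow> 'l \<Rightarrow> 'l"  (infixl "\<odot>\<index>" 75)
  ccomp :: "'c \<Rightarrow> 'c \<Rightarrow> 'c"  (infixl "\<star>\<index>" 75)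
  lassoc :: "'l \<Rightarrow> 'l \<Rightarrow> 'l \<Rightarrow> 'c"
  lunit :: "'l \<Rightarrow> 'c"
  runit :: "'l \<Rightarrow> 'c"

abbreviation lid :: "('o, 't, 'l, 'c) dblcat \<Rightarrow> 'o \<Rightarrow> 'l" where
  "lid D \<equiv> fobj (units D)"

definition composable_pairs ::
    "('o, 't, 'l, 'c) dblcat \<Rightarrow> ('l \<times> 'l, 'c \<times> 'c) cat" where
  "composable_pairs D = (cat_prod (loose D) (loose D))
    \<lparr>Obj := {(\<alpha>, \<beta>). \<alpha> \<in> Obj (loose D) \<and> \<beta> \<in> Obj (loose D) \<and>
        fobj (tgt D) \<alpha> = fobj (src D) \<beta>},
     Arr := {(a, b). a \<in> Arr (loose D) \<and> b \<in> Arr (loose D) \<and>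
        farr (tgt D) a = farr (src D) b}\<rparr>"

definition composition_functor ::
    "('o, 't, 'l, 'c) dblcat \<Rightarrow> ('l \<times> 'l, 'c \<times> 'c, 'l, 'c) func" where
  "composition_functor D = \<lparr>fobj = (\<lambda>(\<alpha>, \<beta>). \<alpha> \<odot>\<^bsub>D\<^esub> \<beta>), farr = (\<lambda>(a, b). a \<star>\<^bsub>D\<^esub> b)\<rparr>"

definition composable2 :: "('o, 't, 'l, 'c) dblcat \<Rightarrow> 'l \<Rightarrow> 'l \<Rightarrow> bool" where
  "composable2 D \<alpha> \<beta> \<longleftrightarrow> (\<alpha>, \<beta>) \<in> Obj (composable_pairs D)"

definition composable2_cells :: "('o, 't, 'l, 'c) dblcat \<Rightarrow> 'c \<Rightarrow> 'c \<Rightarrow> bool" where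
  "composable2_cells D a b \<longleftrightarrow> (a, b) \<in> Arr (composable_pairs D)"

definition globular :: "('o, 't, 'l, 'c) dblcat \<Rightarrow> 'c \<Rightarrow> bool" where
  "globular D a \<longleftrightarrow> a \<in> Arr (loose D) \<and>
    farr (src D) a = Ident (tight D) (fobj (src D) (Dom (loose D) a)) \<and>
    farr (tgt D) a = Ident (tight D) (fobj (tgt D) (Dom (loose D) a))"

definition globular_iso :: "('o, 't, 'l, 'c) dblcat \<Rightarrow> 'c \<Rightarrow> 'l \<Rightarrow> 'l \<Rightarrow> bool" where
  "globular_iso D a \<alpha> \<beta> \<longleftrightarrow> a \<in> hom (loose D) \<alpha> \<beta> \<and> invertible (loose D) a \<and> globular D a"

locale double_category =
  fixes D :: "('o, 't, 'l, 'c) dblcat"  (structure)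
  assumes src_functor: "is_functor (loose D) (tight D) (src D)"
    and tgt_functor: "is_functor (loose D) (tight D) (tgt D)"
    and units_functor: "is_functor (tight D) (loose D) (units D)"
    and composition_functor: "is_functor (composable_pairs D) (loose D) (composition_functor D)"
    and src_lid: "I \<in> Obj (tight D) \<Longrightarrow> fobj (src D) (lid D I) = I"
    and tgt_lid: "I \<in> Obj (tight D) \<Longrightarrow> fobj (tgt D) (lid D I) = I"
    and src_units: "f \<in> Arr (tight D) \<Longrightarrow> farr (src D) (farr (units D) f) = f"
    and tgt_units: "f \<in> Arr (tight D) \<Longrightarrow> farr (tgt D) (farr (units D) f) = f"
    and src_lcomp: "composable2 D \<alpha> \<beta> \<Longrightarrow> fobj (src D) (\<alpha> \<odot> \<beta>) = fobj (src D) \<alpha>"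
    and tgt_lcomp: "composable2 D \<alpha> \<beta> \<Longrightarrow> fobj (tgt D) (\<alpha> \<odot> \<beta>) = fobj (tgt D) \<beta>"
    and src_ccomp: "composable2_cells D a b \<Longrightarrow> farr (src D) (a \<star> b) = farr (src D) a"
    and tgt_ccomp: "composable2_cells D a b \<Longrightarrow> farr (tgt D) (a \<star> b) = farr (tgt D) b"
    and lassoc_iso: "composable2 D \<alpha> \<beta> \<Longrightarrow> composable2 D \<beta> \<gamma> \<Longrightarrow>
      globular_iso D (lassoc D \<alpha> \<beta> \<gamma>) ((\<alpha> \<odot> \<beta>) \<odot> \<gamma>) (\<alpha> \<odot> (\<beta> \<odot> \<gamma>))"
    and lunit_iso: "\<alpha> \<in> Obj (loose D) \<Longrightarrow>
      globular_iso D (lunit D \<alpha>) (lid D (fobj (src D) \<alpha>) \<odot> \<alpha>) \<alpha>"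
    and runit_iso: "\<alpha> \<in> Obj (loose D) \<Longrightarrow>
      globular_iso D (runit D \<alpha>) (\<alpha> \<odot> lid D (fobj (tgt D) \<alpha>)) \<alpha>"
    and lassoc_natural:
      "a \<in> hom (loose D) \<alpha> \<alpha>' \<Longrightarrow> b \<in> hom (loose D) \<beta> \<beta>' \<Longrightarrow> c \<in> hom (loose D) \<gamma> \<gamma>' \<Longrightarrow>
       composable2_cells D a b \<Longrightarrow> composable2_cells D b c \<Longrightarrow>
       ((a \<star> b) \<star> c) \<cdot>\<^bsub>loose D\<^esub> lassoc D \<alpha>' \<beta>' \<gamma>' = lassoc D \<alpha> \<beta> \<gamma> \<cdot>\<^bsub>loose D\<^esub> (a \<star> (b \<star> c))"
    and lunit_natural: "a \<in> hom (loose D) \<alpha> \<beta> \<Longrightarrow>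
      (farr (units D) (farr (src D) a) \<star> a) \<cdot>\<^bsub>loose D\<^esub> lunit D \<beta> = lunit D \<alpha> \<cdot>\<^bsub>loose D\<^esub> a"
    and runit_natural: "a \<in> hom (loose D) \<alpha> \<beta> \<Longrightarrow>
      (a \<star> farr (units D) (farr (tgt D) a)) \<cdot>\<^bsub>loose D\<^esub> runit D \<beta> = runit D \<alpha> \<cdot>\<^bsub>loose D\<^esub> a"
    and pentagon: "composable2 D \<alpha> \<beta> \<Longrightarrow> composable2 D \<beta> \<gamma> \<Longrightarrow> composable2 D \<gamma> \<delta> \<Longrightarrow>
      lassoc D (\<alpha> \<odot> \<beta>) \<gamma> \<delta> \<cdot>\<^bsub>loose D\<^esub> lassoc D \<alpha> \<beta> (\<gamma> \<odot> \<delta>) =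
      (lassoc D \<alpha> \<beta> \<gamma> \<star> Ident (loose D) \<delta>) \<cdot>\<^bsub>loose D\<^esub> lassoc D \<alpha> (\<beta> \<odot> \<gamma>) \<delta>
        \<cdot>\<^bsub>loose D\<^esub> (Ident (loose D) \<alpha> \<star> lassoc D \<beta> \<gamma> \<delta>)"
    and triangle: "composable2 D \<alpha> \<beta> \<Longrightarrow>
      lassoc D \<alpha> (lid D (fobj (src D) \<beta>)) \<beta> \<cdot>\<^bsub>loose D\<^esub> (Ident (loose D) \<alpha> \<star> lunit D \<beta>) =
      runit D \<alpha> \<star> Ident (loose D) \<beta>"

definition dbl_one :: "(unit, unit, unit, unit) dblcat" where
  "dbl_one = \<lparr>tight = cat_one, loose = cat_one, src = func_id, tgt = func_id, units = func_id,
    lcomp = (\<lambda>_ _. ()), ccomp = (\<lambda>_ _. ()), lassoc = (\<lambda>_ _ _. ()),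
    lunit = (\<lambda>_. ()), runit = (\<lambda>_. ())\<rparr>"

definition dbl_prod ::
    "('o, 't, 'l, 'c) dblcat \<Rightarrow> ('o', 't', 'l', 'c') dblcat \<Rightarrow>
      ('o \<times> 'o', 't \<times> 't', 'l \<times> 'l', 'c \<times> 'c') dblcat" where
  "dbl_prod D E = \<lparr>tight = cat_prod (tight D) (tight E), loose = cat_prod (loose D) (loose E),
    src = func_prod (src D) (src E), tgt = func_prod (tgt D) (tgt E),
    units = func_prod (units D) (units E),
    lcomp = (\<lambda>(\<alpha>, \<alpha>') (\<beta>, \<beta>'). (\<alpha> \<odot>\<^bsub>D\<^esub> \<beta>, \<alpha>' \<odot>\<^bsub>E\<^esub> \<beta>')),
    ccomp = (\<lambda>(a, a') (b, b'). (a \<star>\<^bsub>D\<^esub> b, a' \<star>\<^bsub>E\<^esub> b')),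
    lassoc = (\<lambda>(\<alpha>, \<alpha>') (\<beta>, \<beta>') (\<gamma>, \<gamma>'). (lassoc D \<alpha> \<beta> \<gamma>, lassoc E \<alpha>' \<beta>' \<gamma>')),
    lunit = map_prod (lunit D) (lunit E), runit = map_prod (runit D) (runit E)\<rparr>"

definition equipment :: "('o, 't, 'l, 'c) dblcat \<Rightarrow> bool" where
  "equipment D \<longleftrightarrow> double_category D \<and>
    is_fibration (loose D) (cat_prod (tight D) (tight D)) (func_pair (src D) (tgt D))"

subsection \<open>Pseudo double functors and tight transformations\<close>

(* The comparison cells point in the lax direction:
   dfcomp F \<alpha> \<beta> : F \<alpha> \<odot> F \<beta> \<rightarrow> F (\<alpha> \<odot> \<beta>)  and  dfunit F I : \<delta>_(F I) \<rightarrow> F (\<delta>_I). *)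

record ('o, 't, 'l, 'c, 'o', 't', 'l', 'c') dfunc =
  dftight :: "('o, 't, 'o', 't') func"
  dfloose :: "('l, 'c, 'l', 'c') func"
  dfcomp :: "'l \<Rightarrow> 'l \<Rightarrow> 'c'"
  dfunit :: "'o \<Rightarrow> 'c'"

locale double_functor =
  D: double_category D + E: double_category E
  for D :: "('o, 't, 'l, 'c) dblcat" and E :: "('o', 't', 'l', 'c') dblcat" +
  fixes F :: "('o, 't, 'l, 'c, 'o', 't', 'l', 'c') dfunc"
  assumes tight_functor: "is_functor (tight D) (tight E) (dftight F)"
    and loose_functor: "is_functor (loose D) (loose E) (dfloose F)"
    and src_loose: "\<alpha> \<in> Obj (loose D) \<Longrightarrow>
      fobj (src E) (fobj (dfloose F) \<alpha>) = fobj (dftight F) (fobj (src D) \<alpha>)"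
    and tgt_loose: "\<alpha> \<in> Obj (loose D) \<Longrightarrow>
      fobj (tgt E) (fobj (dfloose F) \<alpha>) = fobj (dftight F) (fobj (tgt D) \<alpha>)"
    and src_cell: "a \<in> Arr (loose D) \<Longrightarrow>
      farr (src E) (farr (dfloose F) a) = farr (dftight F) (farr (src D) a)"
    and tgt_cell: "a \<in> Arr (loose D) \<Longrightarrow>
      farr (tgt E) (farr (dfloose F) a) = farr (dftight F) (farr (tgt D) a)"
    and dfcomp_iso: "composable2 D \<alpha> \<beta> \<Longrightarrow>
      globular_iso E (dfcomp F \<alpha> \<beta>)
        (fobj (dfloose F) \<alpha> \<odot>\<^bsub>E\<^esub> fobj (dfloose F) \<beta>) (fobj (dfloose F) (\<alpha> \<odot>\<^bsub>D\<^esub> \<beta>))"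
    and dfunit_iso: "I \<in> Obj (tight D) \<Longrightarrow>
      globular_iso E (dfunit F I) (lid E (fobj (dftight F) I)) (fobj (dfloose F) (lid D I))"
    and dfcomp_natural:
      "a \<in> hom (loose D) \<alpha> \<alpha>' \<Longrightarrow> b \<in> hom (loose D) \<beta> \<beta>' \<Longrightarrow> composable2_cells D a b \<Longrightarrow>
       (farr (dfloose F) a \<star>\<^bsub>E\<^esub> farr (dfloose F) b) \<cdot>\<^bsub>loose E\<^esub> dfcomp F \<alpha>' \<beta>' =
       dfcomp F \<alpha> \<beta> \<cdot>\<^bsub>loose E\<^esub> farr (dfloose F) (a \<star>\<^bsub>D\<^esub> b)"
    and dfunit_natural: "f \<in> hom (tight D) I J \<Longrightarrow>
      farr (units E) (farr (dftight F) f) \<cdot>\<^bsub>loose E\<^esub> dfunit F J =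
      dfunit F I \<cdot>\<^bsub>loose E\<^esub> farr (dfloose F) (farr (units D) f)"
    and dfcomp_assoc: "composable2 D \<alpha> \<beta> \<Longrightarrow> composable2 D \<beta> \<gamma> \<Longrightarrow>
      (dfcomp F \<alpha> \<beta> \<star>\<^bsub>E\<^esub> Ident (loose E) (fobj (dfloose F) \<gamma>))
        \<cdot>\<^bsub>loose E\<^esub> dfcomp F (\<alpha> \<odot>\<^bsub>D\<^esub> \<beta>) \<gamma> \<cdot>\<^bsub>loose E\<^esub> farr (dfloose F) (lassoc D \<alpha> \<beta> \<gamma>) =
      lassoc E (fobj (dfloose F) \<alpha>) (fobj (dfloose F) \<beta>) (fobj (dfloose F) \<gamma>)
        \<cdot>\<^bsub>loose E\<^esub> (Ident (loose E) (fobj (dfloose F) \<alpha>) \<star>\<^bsub>E\<^esub> dfcomp F \<beta> \<gamma>)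
        \<cdot>\<^bsub>loose E\<^esub> dfcomp F \<alpha> (\<beta> \<odot>\<^bsub>D\<^esub> \<gamma>)"
    and dfunit_left: "\<alpha> \<in> Obj (loose D) \<Longrightarrow>
      (dfunit F (fobj (src D) \<alpha>) \<star>\<^bsub>E\<^esub> Ident (loose E) (fobj (dfloose F) \<alpha>))
        \<cdot>\<^bsub>loose E\<^esub> dfcomp F (lid D (fobj (src D) \<alpha>)) \<alpha>
        \<cdot>\<^bsub>loose E\<^esub> farr (dfloose F) (lunit D \<alpha>) = lunit E (fobj (dfloose F) \<alpha>)"
    and dfunit_right: "\<alpha> \<in> Obj (loose D) \<Longrightarrow>
      (Ident (loose E) (fobj (dfloose F) \<alpha>) \<star>\<^bsub>E\<^esub> dfunit F (fobj (tgt D) \<alpha>))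
        \<cdot>\<^bsub>loose E\<^esub> dfcomp F \<alpha> (lid D (fobj (tgt D) \<alpha>))
        \<cdot>\<^bsub>loose E\<^esub> farr (dfloose F) (runit D \<alpha>) = runit E (fobj (dfloose F) \<alpha>)"

definition dfunc_id ::
    "('o, 't, 'l, 'c) dblcat \<Rightarrow> ('o, 't, 'l, 'c, 'o, 't, 'l, 'c) dfunc" where
  "dfunc_id D = \<lparr>dftight = func_id, dfloose = func_id,
    dfcomp = (\<lambda>\<alpha> \<beta>. Ident (loose D) (\<alpha> \<odot>\<^bsub>D\<^esub> \<beta>)),
    dfunit = (\<lambda>I. Ident (loose D) (lid D I))\<rparr>"

(* The codomain E of the composite of F : C \<rightarrow> D and G : D \<rightarrow> E is needed to compose cells. *)
definition dfunc_comp ::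
    "('q, 's, 'm, 'd) dblcat \<Rightarrow> ('o, 't, 'l, 'c, 'o', 't', 'l', 'c') dfunc \<Rightarrow>
      ('o', 't', 'l', 'c', 'q, 's, 'm, 'd) dfunc \<Rightarrow> ('o, 't, 'l, 'c, 'q, 's, 'm, 'd) dfunc" where
  "dfunc_comp E F G = \<lparr>dftight = func_comp (dftight F) (dftight G),
    dfloose = func_comp (dfloose F) (dfloose G),
    dfcomp = (\<lambda>\<alpha> \<beta>. dfcomp G (fobj (dfloose F) \<alpha>) (fobj (dfloose F) \<beta>)
      \<cdot>\<^bsub>loose E\<^esub> farr (dfloose G) (dfcomp F \<alpha> \<beta>)),
    dfunit = (\<lambda>I. dfunit G (fobj (dftight F) I) \<cdot>\<^bsub>loose E\<^esub> farr (dfloose G) (dfunit F I))\<rparr>"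

definition dfunc_bang :: "('o, 't, 'l, 'c, unit, unit, unit, unit) dfunc" where
  "dfunc_bang = \<lparr>dftight = \<lparr>fobj = (\<lambda>_. ()), farr = (\<lambda>_. ())\<rparr>,
    dfloose = \<lparr>fobj = (\<lambda>_. ()), farr = (\<lambda>_. ())\<rparr>,
    dfcomp = (\<lambda>_ _. ()), dfunit = (\<lambda>_. ())\<rparr>"

definition dfunc_diag ::
    "('o, 't, 'l, 'c) dblcat \<Rightarrow>
      ('o, 't, 'l, 'c, 'o \<times> 'o, 't \<times> 't, 'l \<times> 'l, 'c \<times> 'c) dfunc" where
  "dfunc_diag D = \<lparr>dftight = func_pair func_id func_id, dfloose = func_pair func_id func_id,
    dfcomp = (\<lambda>\<alpha> \<beta>. (Ident (loose D) (\<alpha> \<odot>\<^bsub>D\<^esub> \<beta>), Ident (loose D) (\<alpha> \<odot>\<^bsub>D\<^esub> \<beta>))),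
    dfunit = (\<lambda>I. (Ident (loose D) (lid D I), Ident (loose D) (lid D I)))\<rparr>"

record ('o, 'l, 't', 'c') ttrans =
  tight_at :: "'o \<Rightarrow> 't'"
  loose_at :: "'l \<Rightarrow> 'c'"

locale tight_transformation =
  F: double_functor D E F + G: double_functor D E G
  for D :: "('o, 't, 'l, 'c) dblcat" and E :: "('o', 't', 'l', 'c') dblcat"
    and F :: "('o, 't, 'l, 'c, 'o', 't', 'l', 'c') dfunc"
    and G :: "('o, 't, 'l, 'c, 'o', 't', 'l', 'c') dfunc" +
  fixes \<sigma> :: "('o, 'l, 't', 'c') ttrans"
  assumes tight_at_hom: "I \<in> Obj (tight D) \<Longrightarrow>
      tight_at \<sigma> I \<in> hom (tight E) (fobj (dftight F) I) (fobj (dftight G) I)"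
    and loose_at_hom: "\<alpha> \<in> Obj (loose D) \<Longrightarrow>
      loose_at \<sigma> \<alpha> \<in> hom (loose E) (fobj (dfloose F) \<alpha>) (fobj (dfloose G) \<alpha>)"
    and src_loose_at: "\<alpha> \<in> Obj (loose D) \<Longrightarrow>
      farr (src E) (loose_at \<sigma> \<alpha>) = tight_at \<sigma> (fobj (src D) \<alpha>)"
    and tgt_loose_at: "\<alpha> \<in> Obj (loose D) \<Longrightarrow>
      farr (tgt E) (loose_at \<sigma> \<alpha>) = tight_at \<sigma> (fobj (tgt D) \<alpha>)"
    and tight_natural: "f \<in> hom (tight D) I J \<Longrightarrow>
      farr (dftight F) f \<cdot>\<^bsub>tight E\<^esub> tight_at \<sigma> J = tight_at \<sigma> I \<cdot>\<^bsub>tight E\<^esub> farr (dftight G) f"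
    and loose_natural: "a \<in> hom (loose D) \<alpha> \<beta> \<Longrightarrow>
      farr (dfloose F) a \<cdot>\<^bsub>loose E\<^esub> loose_at \<sigma> \<beta> = loose_at \<sigma> \<alpha> \<cdot>\<^bsub>loose E\<^esub> farr (dfloose G) a"
    and dfcomp_compat: "composable2 D \<alpha> \<beta> \<Longrightarrow>
      dfcomp F \<alpha> \<beta> \<cdot>\<^bsub>loose E\<^esub> loose_at \<sigma> (\<alpha> \<odot>\<^bsub>D\<^esub> \<beta>) =
      (loose_at \<sigma> \<alpha> \<star>\<^bsub>E\<^esub> loose_at \<sigma> \<beta>) \<cdot>\<^bsub>loose E\<^esub> dfcomp G \<alpha> \<beta>"
    and dfunit_compat: "I \<in> Obj (tight D) \<Longrightarrow>
      dfunit F I \<cdot>\<^bsub>loose E\<^esub> loose_at \<sigma> (lid D I) =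
      farr (units E) (tight_at \<sigma> I) \<cdot>\<^bsub>loose E\<^esub> dfunit G I"

(* Adjunction F \<stileturn> G in the 2-category of equipments, pseudo double functors and tight
   transformations; the triangle identities between whiskered transformations are
   written out on components. *)
definition double_adjunction ::
    "('o, 't, 'l, 'c) dblcat \<Rightarrow> ('o', 't', 'l', 'c') dblcat \<Rightarrow>
      ('o, 't, 'l, 'c, 'o', 't', 'l', 'c') dfunc \<Rightarrow> ('o', 't', 'l', 'c', 'o, 't, 'l, 'c) dfunc \<Rightarrow>
      ('o, 'l, 't, 'c) ttrans \<Rightarrow> ('o', 'l', 't', 'c') ttrans \<Rightarrow> bool" where
  "double_adjunction D E F G \<eta> \<epsilon> \<longleftrightarrow>
    equipment D \<and> equipment E \<and> double_functor D E F \<and> double_functor E D G \<and>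
    tight_transformation D D (dfunc_id D) (dfunc_comp D F G) \<eta> \<and>
    tight_transformation E E (dfunc_comp E G F) (dfunc_id E) \<epsilon> \<and>
    (\<forall>I \<in> Obj (tight D). farr (dftight F) (tight_at \<eta> I) \<cdot>\<^bsub>tight E\<^esub> tight_at \<epsilon> (fobj (dftight F) I) =
      Ident (tight E) (fobj (dftight F) I)) \<and>
    (\<forall>\<alpha> \<in> Obj (loose D). farr (dfloose F) (loose_at \<eta> \<alpha>) \<cdot>\<^bsub>loose E\<^esub> loose_at \<epsilon> (fobj (dfloose F) \<alpha>) =
      Ident (loose E) (fobj (dfloose F) \<alpha>)) \<and>
    (\<forall>I \<in> Obj (tight E). tight_at \<eta> (fobj (dftight G) I) \<cdot>\<^bsub>tight D\<^esub> farr (dftight G) (tight_at \<epsilon> I) =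
      Ident (tight D) (fobj (dftight G) I)) \<and>
    (\<forall>\<alpha> \<in> Obj (loose E). loose_at \<eta> (fobj (dfloose G) \<alpha>) \<cdot>\<^bsub>loose D\<^esub> farr (dfloose G) (loose_at \<epsilon> \<alpha>) =
      Ident (loose D) (fobj (dfloose G) \<alpha>))"

definition has_right_adjoint ::
    "('o, 't, 'l, 'c) dblcat \<Rightarrow> ('o', 't', 'l', 'c') dblcat \<Rightarrow>
      ('o, 't, 'l, 'c, 'o', 't', 'l', 'c') dfunc \<Rightarrow> bool" where
  "has_right_adjoint D E F \<longleftrightarrow> (\<exists>G \<eta> \<epsilon>. double_adjunction D E F G \<eta> \<epsilon>)"

definition cartesian_equipment :: "('o, 't, 'l, 'c) dblcat \<Rightarrow> bool" where
  "cartesian_equipment D \<longleftrightarrow> equipment D \<and>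
    has_right_adjoint D dbl_one dfunc_bang \<and>
    has_right_adjoint D (dbl_prod D D) (dfunc_diag D)"

section \<open>Bicategories\<close>

(* cells B is the disjoint union of all hom-categories: its objects are the 1-cells, its
   arrows the 2-cells and its composition is the vertical one. *)

record ('o, 'l, 'c) bicat =
  Ob :: "'o set"
  cells :: "('l, 'c) cat"
  bsrc :: "'l \<Rightarrow> 'o"
  btgt :: "'l \<Rightarrow> 'o"
  bid :: "'o \<Rightarrow> 'l"
  bcomp :: "'l \<Rightarrow> 'l \<Rightarrow> 'l"  (infixl "\<bullet>\<index>" 75)
  hcomp :: "'c \<Rightarrow> 'c \<Rightarrow> 'c"  (infixl "\<diamondop>\<index>" 75)
  bassoc :: "'l \<Rightarrow> 'l \<Rightarrow> 'l \<Rightarrow> 'c"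
  blunit :: "'l \<Rightarrow> 'c"
  brunit :: "'l \<Rightarrow> 'c"

definition one_cells :: "('o, 'l, 'c) bicat \<Rightarrow> 'o \<Rightarrow> 'o \<Rightarrow> 'l set" where
  "one_cells B I J = {f \<in> Obj (cells B). bsrc B f = I \<and> btgt B f = J}"

definition bhom :: "('o, 'l, 'c) bicat \<Rightarrow> 'o \<Rightarrow> 'o \<Rightarrow> ('l, 'c) cat" where
  "bhom B I J = full_subcat (cells B) (one_cells B I J)"

abbreviation cell_id :: "('o, 'l, 'c) bicat \<Rightarrow> 'l \<Rightarrow> 'c" where
  "cell_id B \<equiv> Ident (cells B)"

abbreviation cell_inv :: "('o, 'l, 'c) bicat \<Rightarrow> 'c \<Rightarrow> 'c" where
  "cell_inv B \<equiv> Inv (cells B)"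

abbreviation iso_cell :: "('o, 'l, 'c) bicat \<Rightarrow> 'c \<Rightarrow> 'l \<Rightarrow> 'l \<Rightarrow> bool" where
  "iso_cell B a f g \<equiv> a \<in> hom (cells B) f g \<and> invertible (cells B) a"

locale bicategory =
  fixes B :: "('o, 'l, 'c) bicat"  (structure)
  assumes cells_category: "category (cells B)"
    and bsrc_Ob: "f \<in> Obj (cells B) \<Longrightarrow> bsrc B f \<in> Ob B"
    and btgt_Ob: "f \<in> Obj (cells B) \<Longrightarrow> btgt B f \<in> Ob B"
    and bsrc_cell: "a \<in> hom (cells B) f g \<Longrightarrow> bsrc B f = bsrc B g"
    and btgt_cell: "a \<in> hom (cells B) f g \<Longrightarrow> btgt B f = btgt B g"
    and bid_one_cell: "I \<in> Ob B \<Longrightarrow> bid B I \<in> one_cells B I I"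
    and bcomp_one_cell: "f \<in> one_cells B I J \<Longrightarrow> g \<in> one_cells B J K \<Longrightarrow>
      f \<bullet> g \<in> one_cells B I K"
    and hcomp_hom: "f \<in> one_cells B I J \<Longrightarrow> g \<in> one_cells B J K \<Longrightarrow>
      a \<in> hom (cells B) f f' \<Longrightarrow> b \<in> hom (cells B) g g' \<Longrightarrow>
      a \<diamondop> b \<in> hom (cells B) (f \<bullet> g) (f' \<bullet> g')"
    and hcomp_id: "f \<in> one_cells B I J \<Longrightarrow> g \<in> one_cells B J K \<Longrightarrow>
      cell_id B f \<diamondop> cell_id B g = cell_id B (f \<bullet> g)"
    and interchange: "f \<in> one_cells B I J \<Longrightarrow> g \<in> one_cells B J K \<Longrightarrow>
      a \<in> hom (cells B) f f' \<Longrightarrow> a' \<in> hom (cells B) f' f'' \<Longrightarrow>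
      b \<in> hom (cells B) g g' \<Longrightarrow> b' \<in> hom (cells B) g' g'' \<Longrightarrow>
      (a \<cdot>\<^bsub>cells B\<^esub> a') \<diamondop> (b \<cdot>\<^bsub>cells B\<^esub> b') = (a \<diamondop> b) \<cdot>\<^bsub>cells B\<^esub> (a' \<diamondop> b')"
    and bassoc_iso: "f \<in> one_cells B I J \<Longrightarrow> g \<in> one_cells B J K \<Longrightarrow> h \<in> one_cells B K L \<Longrightarrow>
      iso_cell B (bassoc B f g h) ((f \<bullet> g) \<bullet> h) (f \<bullet> (g \<bullet> h))"
    and blunit_iso: "f \<in> one_cells B I J \<Longrightarrow> iso_cell B (blunit B f) (bid B I \<bullet> f) f"
    and brunit_iso: "f \<in> one_cells B I J \<Longrightarrow> iso_cell B (brunit B f) (f \<bullet> bid B J) f"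
    and bassoc_natural:
      "f \<in> one_cells B I J \<Longrightarrow> g \<in> one_cells B J K \<Longrightarrow> h \<in> one_cells B K L \<Longrightarrow>
       a \<in> hom (cells B) f f' \<Longrightarrow> b \<in> hom (cells B) g g' \<Longrightarrow> c \<in> hom (cells B) h h' \<Longrightarrow>
       ((a \<diamondop> b) \<diamondop> c) \<cdot>\<^bsub>cells B\<^esub> bassoc B f' g' h' = bassoc B f g h \<cdot>\<^bsub>cells B\<^esub> (a \<diamondop> (b \<diamondop> c))"
    and blunit_natural: "f \<in> one_cells B I J \<Longrightarrow> a \<in> hom (cells B) f g \<Longrightarrow>
      (cell_id B (bid B I) \<diamondop> a) \<cdot>\<^bsub>cells B\<^esub> blunit B g = blunit B f \<cdot>\<^bsub>cells B\<^esub> a"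
    and brunit_natural: "f \<in> one_cells B I J \<Longrightarrow> a \<in> hom (cells B) f g \<Longrightarrow>
      (a \<diamondop> cell_id B (bid B J)) \<cdot>\<^bsub>cells B\<^esub> brunit B g = brunit B f \<cdot>\<^bsub>cells B\<^esub> a"
    and bpentagon:
      "f \<in> one_cells B I J \<Longrightarrow> g \<in> one_cells B J K \<Longrightarrow> h \<in> one_cells B K L \<Longrightarrow>
       k \<in> one_cells B L M \<Longrightarrow>
       bassoc B (f \<bullet> g) h k \<cdot>\<^bsub>cells B\<^esub> bassoc B f g (h \<bullet> k) =
       (bassoc B f g h \<diamondop> cell_id B k) \<cdot>\<^bsub>cells B\<^esub> bassoc B f (g \<bullet> h) k
         \<cdot>\<^bsub>cells B\<^esub> (cell_id B f \<diamondop> bassoc B g h k)"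
    and btriangle: "f \<in> one_cells B I J \<Longrightarrow> g \<in> one_cells B J K \<Longrightarrow>
      bassoc B f (bid B J) g \<cdot>\<^bsub>cells B\<^esub> (cell_id B f \<diamondop> blunit B g) = brunit B f \<diamondop> cell_id B g"

definition bicat_one :: "(unit, unit, unit) bicat" where
  "bicat_one = \<lparr>Ob = UNIV, cells = cat_one, bsrc = (\<lambda>_. ()), btgt = (\<lambda>_. ()), bid = (\<lambda>_. ()),
    bcomp = (\<lambda>_ _. ()), hcomp = (\<lambda>_ _. ()), bassoc = (\<lambda>_ _ _. ()),
    blunit = (\<lambda>_. ()), brunit = (\<lambda>_. ())\<rparr>"

definition bicat_prod ::
    "('o, 'l, 'c) bicat \<Rightarrow> ('o', 'l', 'c') bicat \<Rightarrow> ('o \<times> 'o', 'l \<times> 'l', 'c \<times> 'c') bicat" where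
  "bicat_prod B C = \<lparr>Ob = Ob B \<times> Ob C, cells = cat_prod (cells B) (cells C),
    bsrc = map_prod (bsrc B) (bsrc C), btgt = map_prod (btgt B) (btgt C),
    bid = map_prod (bid B) (bid C),
    bcomp = (\<lambda>(f, f') (g, g'). (f \<bullet>\<^bsub>B\<^esub> g, f' \<bullet>\<^bsub>C\<^esub> g')),
    hcomp = (\<lambda>(a, a') (b, b'). (a \<diamondop>\<^bsub>B\<^esub> b, a' \<diamondop>\<^bsub>C\<^esub> b')),
    bassoc = (\<lambda>(f, f') (g, g') (h, h'). (bassoc B f g h, bassoc C f' g' h')),
    blunit = map_prod (blunit B) (blunit C), brunit = map_prod (brunit B) (brunit C)\<rparr>"

definition loose_bicategory :: "('o, 't, 'l, 'c) dblcat \<Rightarrow> ('o, 'l, 'c) bicat" where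
  "loose_bicategory D = \<lparr>Ob = Obj (tight D),
    cells = (loose D)\<lparr>Arr := {a. globular D a}\<rparr>,
    bsrc = fobj (src D), btgt = fobj (tgt D), bid = lid D,
    bcomp = lcomp D, hcomp = ccomp D, bassoc = lassoc D,
    blunit = lunit D, brunit = runit D\<rparr>"

subsection \<open>Lax functors and pseudofunctors\<close>

record ('o, 'l, 'c, 'o', 'l', 'c') lfunc =
  lfob :: "'o \<Rightarrow> 'o'"
  lfcells :: "('l, 'c, 'l', 'c') func"
  lfcomp :: "'l \<Rightarrow> 'l \<Rightarrow> 'c'"
  lfunit :: "'o \<Rightarrow> 'c'"

locale lax_functor =
  B: bicategory B + C: bicategory C
  for B :: "('o, 'l, 'c) bicat" and C :: "('o', 'l', 'c') bicat" +
  fixes F :: "('o, 'l, 'c, 'o', 'l', 'c') lfunc"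
  assumes lfob_Ob: "I \<in> Ob B \<Longrightarrow> lfob F I \<in> Ob C"
    and lfcells_functor: "is_functor (cells B) (cells C) (lfcells F)"
    and lfcells_one_cell: "f \<in> one_cells B I J \<Longrightarrow>
      fobj (lfcells F) f \<in> one_cells C (lfob F I) (lfob F J)"
    and lfcomp_hom: "f \<in> one_cells B I J \<Longrightarrow> g \<in> one_cells B J K \<Longrightarrow>
      lfcomp F f g \<in> hom (cells C)
        (fobj (lfcells F) f \<bullet>\<^bsub>C\<^esub> fobj (lfcells F) g) (fobj (lfcells F) (f \<bullet>\<^bsub>B\<^esub> g))"
    and lfunit_hom: "I \<in> Ob B \<Longrightarrow>
      lfunit F I \<in> hom (cells C) (bid C (lfob F I)) (fobj (lfcells F) (bid B I))"
    and lfcomp_natural: "f \<in> one_cells B I J \<Longrightarrow> g \<in> one_cells B J K \<Longrightarrow>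
      a \<in> hom (cells B) f f' \<Longrightarrow> b \<in> hom (cells B) g g' \<Longrightarrow>
      (farr (lfcells F) a \<diamondop>\<^bsub>C\<^esub> farr (lfcells F) b) \<cdot>\<^bsub>cells C\<^esub> lfcomp F f' g' =
      lfcomp F f g \<cdot>\<^bsub>cells C\<^esub> farr (lfcells F) (a \<diamondop>\<^bsub>B\<^esub> b)"
    and lfcomp_assoc:
      "f \<in> one_cells B I J \<Longrightarrow> g \<in> one_cells B J K \<Longrightarrow> h \<in> one_cells B K L \<Longrightarrow>
       (lfcomp F f g \<diamondop>\<^bsub>C\<^esub> cell_id C (fobj (lfcells F) h))
         \<cdot>\<^bsub>cells C\<^esub> lfcomp F (f \<bullet>\<^bsub>B\<^esub> g) h \<cdot>\<^bsub>cells C\<^esub> farr (lfcells F) (bassoc B f g h) =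
       bassoc C (fobj (lfcells F) f) (fobj (lfcells F) g) (fobj (lfcells F) h)
         \<cdot>\<^bsub>cells C\<^esub> (cell_id C (fobj (lfcells F) f) \<diamondop>\<^bsub>C\<^esub> lfcomp F g h)
         \<cdot>\<^bsub>cells C\<^esub> lfcomp F f (g \<bullet>\<^bsub>B\<^esub> h)"
    and lfunit_left: "f \<in> one_cells B I J \<Longrightarrow>
      (lfunit F I \<diamondop>\<^bsub>C\<^esub> cell_id C (fobj (lfcells F) f))
        \<cdot>\<^bsub>cells C\<^esub> lfcomp F (bid B I) f \<cdot>\<^bsub>cells C\<^esub> farr (lfcells F) (blunit B f) =
      blunit C (fobj (lfcells F) f)"
    and lfunit_right: "f \<in> one_cells B I J \<Longrightarrow>
      (cell_id C (fobj (lfcells F) f) \<diamondop>\<^bsub>C\<^esub> lfunit F J)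
        \<cdot>\<^bsub>cells C\<^esub> lfcomp F f (bid B J) \<cdot>\<^bsub>cells C\<^esub> farr (lfcells F) (brunit B f) =
      brunit C (fobj (lfcells F) f)"

locale pseudofunctor = lax_functor +
  assumes lfcomp_invertible: "f \<in> one_cells B I J \<Longrightarrow> g \<in> one_cells B J K \<Longrightarrow>
      invertible (cells C) (lfcomp F f g)"
    and lfunit_invertible: "I \<in> Ob B \<Longrightarrow> invertible (cells C) (lfunit F I)"

subsection \<open>Maps\<close>

definition adjunction :: "('o, 'l, 'c) bicat \<Rightarrow> 'l \<Rightarrow> 'l \<Rightarrow> 'c \<Rightarrow> 'c \<Rightarrow> bool" where
  "adjunction B f g \<eta> \<epsilon> \<longleftrightarrow>
    f \<in> Obj (cells B) \<and> g \<in> one_cells B (btgt B f) (bsrc B f) \<and>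
    \<eta> \<in> hom (cells B) (bid B (bsrc B f)) (f \<bullet>\<^bsub>B\<^esub> g) \<and>
    \<epsilon> \<in> hom (cells B) (g \<bullet>\<^bsub>B\<^esub> f) (bid B (btgt B f)) \<and>
    cell_inv B (blunit B f) \<cdot>\<^bsub>cells B\<^esub> (\<eta> \<diamondop>\<^bsub>B\<^esub> cell_id B f) \<cdot>\<^bsub>cells B\<^esub> bassoc B f g f
      \<cdot>\<^bsub>cells B\<^esub> (cell_id B f \<diamondop>\<^bsub>B\<^esub> \<epsilon>) \<cdot>\<^bsub>cells B\<^esub> brunit B f = cell_id B f \<and>
    cell_inv B (brunit B g) \<cdot>\<^bsub>cells B\<^esub> (cell_id B g \<diamondop>\<^bsub>B\<^esub> \<eta>) \<cdot>\<^bsub>cells B\<^esub> cell_inv B (bassoc B g f g)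
      \<cdot>\<^bsub>cells B\<^esub> (\<epsilon> \<diamondop>\<^bsub>B\<^esub> cell_id B g) \<cdot>\<^bsub>cells B\<^esub> blunit B g = cell_id B g"

definition is_map :: "('o, 'l, 'c) bicat \<Rightarrow> 'l \<Rightarrow> bool" where
  "is_map B f \<longleftrightarrow> (\<exists>g \<eta> \<epsilon>. adjunction B f g \<eta> \<epsilon>)"

definition map_bicat :: "('o, 'l, 'c) bicat \<Rightarrow> ('o, 'l, 'c) bicat" where
  "map_bicat B = B\<lparr>cells := full_subcat (cells B) {f. is_map B f}\<rparr>"

subsection \<open>Finite products in the bicategorical sense\<close>

definition bicat_terminal :: "('o, 'l, 'c) bicat \<Rightarrow> 'o \<Rightarrow> bool" where
  "bicat_terminal M t \<longleftrightarrow> t \<in> Ob M \<and> (\<forall>K \<in> Ob M. equivalent_cats (bhom M K t) cat_one)"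

definition post_pair ::
    "('o, 'l, 'c) bicat \<Rightarrow> 'l \<Rightarrow> 'l \<Rightarrow> ('l, 'c, 'l \<times> 'l, 'c \<times> 'c) func" where
  "post_pair M p r = \<lparr>fobj = (\<lambda>f. (f \<bullet>\<^bsub>M\<^esub> p, f \<bullet>\<^bsub>M\<^esub> r)),
    farr = (\<lambda>a. (a \<diamondop>\<^bsub>M\<^esub> cell_id M p, a \<diamondop>\<^bsub>M\<^esub> cell_id M r))\<rparr>"

definition bicat_product :: "('o, 'l, 'c) bicat \<Rightarrow> 'o \<Rightarrow> 'o \<Rightarrow> 'o \<Rightarrow> 'l \<Rightarrow> 'l \<Rightarrow> bool" where
  "bicat_product M I J P p r \<longleftrightarrow>
    P \<in> Ob M \<and> p \<in> one_cells M P I \<and> r \<in> one_cells M P J \<and>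
    (\<forall>K \<in> Ob M. is_equivalence (bhom M K P) (cat_prod (bhom M K I) (bhom M K J)) (post_pair M p r))"

definition has_bicat_finite_products :: "('o, 'l, 'c) bicat \<Rightarrow> bool" where
  "has_bicat_finite_products M \<longleftrightarrow>
    (\<exists>t. bicat_terminal M t) \<and>
    (\<forall>I \<in> Ob M. \<forall>J \<in> Ob M. \<exists>P p r. bicat_product M I J P p r)"

section \<open>Cartesian bicategories\<close>

(* A choice of the universal data from which the two canonical lax functors are built. *)
record ('o, 'l, 'c) product_data =
  one :: 'o
  prd :: "'o \<Rightarrow> 'o \<Rightarrow> 'o"
  pl :: "'o \<Rightarrow> 'o \<Rightarrow> 'l"
  pr :: "'o \<Rightarrow> 'o \<Rightarrow> 'l"
  pl_adj :: "'o \<Rightarrow> 'o \<Rightarrow> 'l"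
  pr_adj :: "'o \<Rightarrow> 'o \<Rightarrow> 'l"
  pl_unit :: "'o \<Rightarrow> 'o \<Rightarrow> 'c"
  pr_unit :: "'o \<Rightarrow> 'o \<Rightarrow> 'c"
  pl_counit :: "'o \<Rightarrow> 'o \<Rightarrow> 'c"
  pr_counit :: "'o \<Rightarrow> 'o \<Rightarrow> 'c"
  top_one :: 'l
  meet :: "'l \<Rightarrow> 'l \<Rightarrow> 'l"
  meet_l :: "'l \<Rightarrow> 'l \<Rightarrow> 'c"
  meet_r :: "'l \<Rightarrow> 'l \<Rightarrow> 'c"

definition is_product_data :: "('o, 'l, 'c) bicat \<Rightarrow> ('o, 'l, 'c) product_data \<Rightarrow> bool" where
  "is_product_data B S \<longleftrightarrow>
    bicat_terminal (map_bicat B) (one S) \<and>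
    (\<forall>I \<in> Ob B. \<forall>J \<in> Ob B.
      bicat_product (map_bicat B) I J (prd S I J) (pl S I J) (pr S I J) \<and>
      adjunction B (pl S I J) (pl_adj S I J) (pl_unit S I J) (pl_counit S I J) \<and>
      adjunction B (pr S I J) (pr_adj S I J) (pr_unit S I J) (pr_counit S I J)) \<and>
    is_terminal (bhom B (one S) (one S)) (top_one S) \<and>
    (\<forall>I \<in> Ob B. \<forall>J \<in> Ob B. \<forall>f \<in> one_cells B I J. \<forall>g \<in> one_cells B I J.
      is_product (bhom B I J) f g (meet S f g) (meet_l S f g) (meet_r S f g))"

definition meet_pair ::
    "('o, 'l, 'c) bicat \<Rightarrow> ('o, 'l, 'c) product_data \<Rightarrow> 'l \<Rightarrow> 'l \<Rightarrow> 'c \<Rightarrow> 'c \<Rightarrow> 'c" where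
  "meet_pair B S f g a b = (THE h. h \<in> hom (cells B) (Dom (cells B) a) (meet S f g) \<and>
    h \<cdot>\<^bsub>cells B\<^esub> meet_l S f g = a \<and> h \<cdot>\<^bsub>cells B\<^esub> meet_r S f g = b)"

definition unit_lax_functor ::
    "('o, 'l, 'c) bicat \<Rightarrow> ('o, 'l, 'c) product_data \<Rightarrow> (unit, unit, unit, 'o, 'l, 'c) lfunc" where
  "unit_lax_functor B S = \<lparr>lfob = (\<lambda>_. one S),
    lfcells = \<lparr>fobj = (\<lambda>_. top_one S), farr = (\<lambda>_. cell_id B (top_one S))\<rparr>,
    lfcomp = (\<lambda>_ _. THE a. a \<in> hom (cells B) (top_one S \<bullet>\<^bsub>B\<^esub> top_one S) (top_one S)),
    lfunit = (\<lambda>_. THE a. a \<in> hom (cells B) (bid B (one S)) (top_one S))\<rparr>"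

definition left_leg :: "('o, 'l, 'c) bicat \<Rightarrow> ('o, 'l, 'c) product_data \<Rightarrow> 'l \<Rightarrow> 'l \<Rightarrow> 'l" where
  "left_leg B S \<alpha> \<beta> =
    (pl S (bsrc B \<alpha>) (bsrc B \<beta>) \<bullet>\<^bsub>B\<^esub> \<alpha>) \<bullet>\<^bsub>B\<^esub> pl_adj S (btgt B \<alpha>) (btgt B \<beta>)"

definition right_leg :: "('o, 'l, 'c) bicat \<Rightarrow> ('o, 'l, 'c) product_data \<Rightarrow> 'l \<Rightarrow> 'l \<Rightarrow> 'l" where
  "right_leg B S \<alpha> \<beta> =
    (pr S (bsrc B \<alpha>) (bsrc B \<beta>) \<bullet>\<^bsub>B\<^esub> \<beta>) \<bullet>\<^bsub>B\<^esub> pr_adj S (btgt B \<alpha>) (btgt B \<beta>)"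

definition tensor ::
    "('o, 'l, 'c) bicat \<Rightarrow> ('o, 'l, 'c) product_data \<Rightarrow> 'l \<Rightarrow> 'l \<Rightarrow> 'l" where
  "tensor B S \<alpha> \<beta> = meet S (left_leg B S \<alpha> \<beta>) (right_leg B S \<alpha> \<beta>)"

definition tensor_l ::
    "('o, 'l, 'c) bicat \<Rightarrow> ('o, 'l, 'c) product_data \<Rightarrow> 'l \<Rightarrow> 'l \<Rightarrow> 'c" where
  "tensor_l B S \<alpha> \<beta> = meet_l S (left_leg B S \<alpha> \<beta>) (right_leg B S \<alpha> \<beta>)"

definition tensor_r ::
    "('o, 'l, 'c) bicat \<Rightarrow> ('o, 'l, 'c) product_data \<Rightarrow> 'l \<Rightarrow> 'l \<Rightarrow> 'c" where
  "tensor_r B S \<alpha> \<beta> = meet_r S (left_leg B S \<alpha> \<beta>) (right_leg B S \<alpha> \<beta>)"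

definition tensor_pair ::
    "('o, 'l, 'c) bicat \<Rightarrow> ('o, 'l, 'c) product_data \<Rightarrow> 'l \<Rightarrow> 'l \<Rightarrow> 'c \<Rightarrow> 'c \<Rightarrow> 'c" where
  "tensor_pair B S \<alpha> \<beta> = meet_pair B S (left_leg B S \<alpha> \<beta>) (right_leg B S \<alpha> \<beta>)"

definition whisker :: "('o, 'l, 'c) bicat \<Rightarrow> 'l \<Rightarrow> 'c \<Rightarrow> 'l \<Rightarrow> 'c" where
  "whisker B h a k = (cell_id B h \<diamondop>\<^bsub>B\<^esub> a) \<diamondop>\<^bsub>B\<^esub> cell_id B k"

definition tensor_cell ::
    "('o, 'l, 'c) bicat \<Rightarrow> ('o, 'l, 'c) product_data \<Rightarrow> 'c \<Rightarrow> 'c \<Rightarrow> 'c" where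
  "tensor_cell B S a b =
    (let \<alpha> = Dom (cells B) a; \<beta> = Dom (cells B) b;
         I = bsrc B \<alpha>; J = btgt B \<alpha>; K = bsrc B \<beta>; L = btgt B \<beta>
     in tensor_pair B S (Cod (cells B) a) (Cod (cells B) b)
          (tensor_l B S \<alpha> \<beta> \<cdot>\<^bsub>cells B\<^esub> whisker B (pl S I K) a (pl_adj S J L))
          (tensor_r B S \<alpha> \<beta> \<cdot>\<^bsub>cells B\<^esub> whisker B (pr S I K) b (pr_adj S J L)))"

(* For \<epsilon> : g \<bullet> f \<Rightarrow> id, the cell ((h \<bullet> \<alpha>) \<bullet> g) \<bullet> ((f \<bullet> \<beta>) \<bullet> k) \<Rightarrow> (h \<bullet> (\<alpha> \<bullet> \<beta>)) \<bullet> k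
   that contracts g \<bullet> f along \<epsilon>. *)
definition contract ::
    "('o, 'l, 'c) bicat \<Rightarrow> 'c \<Rightarrow> 'l \<Rightarrow> 'l \<Rightarrow> 'l \<Rightarrow> 'l \<Rightarrow> 'l \<Rightarrow> 'l \<Rightarrow> 'c" where
  "contract B \<epsilon> h \<alpha> g f \<beta> k =
    cell_inv B (bassoc B ((h \<bullet>\<^bsub>B\<^esub> \<alpha>) \<bullet>\<^bsub>B\<^esub> g) (f \<bullet>\<^bsub>B\<^esub> \<beta>) k)
    \<cdot>\<^bsub>cells B\<^esub>
    ((bassoc B (h \<bullet>\<^bsub>B\<^esub> \<alpha>) g (f \<bullet>\<^bsub>B\<^esub> \<beta>)
      \<cdot>\<^bsub>cells B\<^esub> (cell_id B (h \<bullet>\<^bsub>B\<^esub> \<alpha>) \<diamondop>\<^bsub>B\<^esub>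
          (cell_inv B (bassoc B g f \<beta>) \<cdot>\<^bsub>cells B\<^esub> (\<epsilon> \<diamondop>\<^bsub>B\<^esub> cell_id B \<beta>) \<cdot>\<^bsub>cells B\<^esub> blunit B \<beta>))
      \<cdot>\<^bsub>cells B\<^esub> bassoc B h \<alpha> \<beta>)
     \<diamondop>\<^bsub>B\<^esub> cell_id B k)"

definition tensor_comp ::
    "('o, 'l, 'c) bicat \<Rightarrow> ('o, 'l, 'c) product_data \<Rightarrow> 'l \<times> 'l \<Rightarrow> 'l \<times> 'l \<Rightarrow> 'c" where
  "tensor_comp B S = (\<lambda>(\<alpha>, \<beta>) (\<alpha>', \<beta>').
    let I = bsrc B \<alpha>; J = btgt B \<alpha>; M = btgt B \<alpha>';
        K = bsrc B \<beta>; L = btgt B \<beta>; N = btgt B \<beta>'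
    in tensor_pair B S (\<alpha> \<bullet>\<^bsub>B\<^esub> \<alpha>') (\<beta> \<bullet>\<^bsub>B\<^esub> \<beta>')
         ((tensor_l B S \<alpha> \<beta> \<diamondop>\<^bsub>B\<^esub> tensor_l B S \<alpha>' \<beta>') \<cdot>\<^bsub>cells B\<^esub>
            contract B (pl_counit S J L) (pl S I K) \<alpha> (pl_adj S J L) (pl S J L) \<alpha>' (pl_adj S M N))
         ((tensor_r B S \<alpha> \<beta> \<diamondop>\<^bsub>B\<^esub> tensor_r B S \<alpha>' \<beta>') \<cdot>\<^bsub>cells B\<^esub>
            contract B (pr_counit S J L) (pr S I K) \<beta> (pr_adj S J L) (pr S J L) \<beta>' (pr_adj S M N)))"

definition tensor_unit ::
    "('o, 'l, 'c) bicat \<Rightarrow> ('o, 'l, 'c) product_data \<Rightarrow> 'o \<times> 'o \<Rightarrow> 'c" where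
  "tensor_unit B S = (\<lambda>(I, K).
    tensor_pair B S (bid B I) (bid B K)
      (pl_unit S I K \<cdot>\<^bsub>cells B\<^esub>
        (cell_inv B (brunit B (pl S I K)) \<diamondop>\<^bsub>B\<^esub> cell_id B (pl_adj S I K)))
      (pr_unit S I K \<cdot>\<^bsub>cells B\<^esub>
        (cell_inv B (brunit B (pr S I K)) \<diamondop>\<^bsub>B\<^esub> cell_id B (pr_adj S I K))))"

definition tensor_lax_functor ::
    "('o, 'l, 'c) bicat \<Rightarrow> ('o, 'l, 'c) product_data \<Rightarrow>
      ('o \<times> 'o, 'l \<times> 'l, 'c \<times> 'c, 'o, 'l, 'c) lfunc" where
  "tensor_lax_functor B S = \<lparr>lfob = (\<lambda>(I, K). prd S I K),
    lfcells = \<lparr>fobj = (\<lambda>(\<alpha>, \<beta>). tensor B S \<alpha> \<beta>), farr = (\<lambda>(a, b). tensor_cell B S a b)\<rparr>,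
    lfcomp = tensor_comp B S, lfunit = tensor_unit B S\<rparr>"

(* Different choices of S yield equivalent lax functors, so that the last condition does
   not depend on S; a choice exists by the two preceding conditions. *)
definition cartesian_bicategory :: "('o, 'l, 'c) bicat \<Rightarrow> bool" where
  "cartesian_bicategory B \<longleftrightarrow> bicategory B \<and>
    (\<forall>I \<in> Ob B. \<forall>J \<in> Ob B. has_finite_products (bhom B I J)) \<and>
    has_bicat_finite_products (map_bicat B) \<and>
    (\<exists>S. is_product_data B S \<and>
      pseudofunctor bicat_one B (unit_lax_functor B S) \<and>
      pseudofunctor (bicat_prod B B) B (tensor_lax_functor B S))"

end

theory Submission
  imports Defs
begin

text \<open>The right adjoint of the diagonal makes \<open>\<alpha> \<otimes> \<beta>\<close> a categorical product of \<open>\<alpha>\<close> and \<open>\<beta>\<close> in the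
  category of loose arrows and all cells, with projections over the tight projections \<open>p\<close> and \<open>r\<close>;
  pseudo-functoriality says that these products are stable under loose composition and units.
  Companions and conjoints turn a cell into \<open>\<alpha>\<close> over \<open>(p, p)\<close> into a globular cell into
  \<open>p \<alpha> p\<^sup>*\<close>, so \<open>(p \<alpha> p\<^sup>*) \<and> (r \<beta> r\<^sup>*)\<close> is isomorphic to \<open>\<alpha> \<otimes> \<beta>\<close>.  A canonical laxity cell, composed
  with a projection, becomes a horizontal composite of projections: the lax functor axioms are then
  immediate, and invertibility of the laxity cells is the stability of the products.

  For a map \<open>f \<stileturn> g\<close>, cells \<open>x \<rightarrow> f\<close> correspond to cells \<open>g x \<rightarrow> id\<close>, and the unit of \<open>I \<times> J\<close> is the
  product of the units of \<open>I\<close> and \<open>J\<close>; so composing with \<open>p\<close> and \<open>r\<close> is fully faithful on maps.  The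
  pairing of maps \<open>f\<close>, \<open>f'\<close> is the restriction of \<open>f \<otimes> f'\<close> along the diagonal.  The right adjoint is
  the restriction of \<open>g \<otimes> g'\<close>, and the triangle identities can be tested on the projections.\<close>

section \<open>Categories\<close>

text \<open>Maps of \<open>loose_bicategory D\<close> need not come from tight arrows, so products
  of maps cannot be read off the tight category alone. This is why adjoint transposition enters: it
  moves an arbitrary map \<open>f\<close> out of the codomain of a cell and leaves a unit there, and
  units are where the equipment supplies a terminal object and products. A second obstacle is that
  the laxity cells are prescribed: they are explicit pastings of associators, unitors, units and
  counits, paired by definite description in a hom-category. Comparing such pastings directly would
  need large coherence diagrams. In the category of all cells a projection of the tensor is a single
  cell with tight sides \<open>op1\<close> or \<open>op2\<close>, no companion or conjoint remains,
  and equality of two cells into a tensor is tested on the two projections. The coherence work is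
  thereby confined to a few identities on companions and conjoints.\<close>

context category
begin

lemma Dom_Cod_Obj [simp]: "f \<in> Arr C \<Longrightarrow> Dom C f \<in> Obj C" "f \<in> Arr C \<Longrightarrow> Cod C f \<in> Obj C"
  by (simp_all add: Dom_Obj Cod_Obj)

lemma Ident_simps [simp]:
  assumes "x \<in> Obj C"
  shows "Ident C x \<in> Arr C" "Dom C (Ident C x) = x" "Cod C (Ident C x) = x"
  using Ident_hom [OF assms] by (simp_all add: hom_def)

lemma Comp_simps [simp]:
  assumes "f \<in> Arr C" "g \<in> Arr C" "Cod C f = Dom C g"
  shows "f \<cdot> g \<in> Arr C" "Dom C (f \<cdot> g) = Dom C f" "Cod C (f \<cdot> g) = Cod C g"
  using Comp_hom [of f "Dom C f" "Cod C f" g "Cod C g"] assms by (simp_all add: hom_def)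

lemma Comp_Ident [simp]:
  "f \<in> Arr C \<Longrightarrow> Dom C f = x \<Longrightarrow> Ident C x \<cdot> f = f"
  "f \<in> Arr C \<Longrightarrow> Cod C f = x \<Longrightarrow> f \<cdot> Ident C x = f"
  using Ident_left Ident_right by (auto simp: hom_def)

lemma Comp_assoc_Arr [simp]:
  assumes "f \<in> Arr C" "g \<in> Arr C" "h \<in> Arr C" "Cod C f = Dom C g" "Cod C g = Dom C h"
  shows "(f \<cdot> g) \<cdot> h = f \<cdot> (g \<cdot> h)"
  using assms by (intro Comp_assoc [of _ "Dom C f" "Dom C g" _ "Dom C h" _ "Cod C h"])
    (auto simp: hom_def)

lemma inverse_arrows_unique:
  assumes "inverse_arrows C f g" "inverse_arrows C f g'"
  shows "g = g'"
proof -
  from assms have *: "f \<in> Arr C" "g \<in> Arr C" "g' \<in> Arr C" "Dom C g = Cod C f" "Cod C g = Dom C f"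
    "Dom C g' = Cod C f" "Cod C g' = Dom C f"
    by (auto simp: inverse_arrows_def hom_def)
  have "g = g \<cdot> (f \<cdot> g')"
    using assms * by (auto simp: inverse_arrows_def)
  also have "\<dots> = (g \<cdot> f) \<cdot> g'"
    using * by simp
  also have "\<dots> = g'"
    using assms * by (auto simp: inverse_arrows_def)
  finally show ?thesis .
qed

lemma Inv_eqI: "inverse_arrows C f g \<Longrightarrow> Inv C f = g"
  unfolding Inv_def using inverse_arrows_unique by blast

lemma inverse_arrows_Inv: "invertible C f \<Longrightarrow> inverse_arrows C f (Inv C f)"
  unfolding invertible_def using Inv_eqI by blast

lemma invertible_Arr: "invertible C f \<Longrightarrow> f \<in> Arr C"
  by (auto simp: invertible_def inverse_arrows_def)

lemma Inv_simps [simp]: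
  assumes "invertible C f"
  shows "Inv C f \<in> Arr C" "Dom C (Inv C f) = Cod C f" "Cod C (Inv C f) = Dom C f"
    "f \<cdot> Inv C f = Ident C (Dom C f)" "Inv C f \<cdot> f = Ident C (Cod C f)"
  using inverse_arrows_Inv [OF assms] by (auto simp: inverse_arrows_def hom_def)

lemma Inv_cancel [simp]:
  assumes "invertible C f" "g \<in> Arr C"
  shows "Dom C g = Cod C f \<Longrightarrow> Inv C f \<cdot> (f \<cdot> g) = g"
    "Dom C g = Dom C f \<Longrightarrow> f \<cdot> (Inv C f \<cdot> g) = g"
  using assms invertible_Arr [OF assms(1)]
  by (auto simp flip: Comp_assoc_Arr)

lemma inverse_arrowsI:
  assumes "f \<in> Arr C" "g \<in> Arr C" "Dom C g = Cod C f" "Cod C g = Dom C f"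
    "f \<cdot> g = Ident C (Dom C f)" "g \<cdot> f = Ident C (Cod C f)"
  shows "inverse_arrows C f g"
  using assms by (simp add: inverse_arrows_def hom_def)

lemma invertibleI:
  assumes "f \<in> Arr C" "g \<in> Arr C" "Dom C g = Cod C f" "Cod C g = Dom C f"
    "f \<cdot> g = Ident C (Dom C f)" "g \<cdot> f = Ident C (Cod C f)"
  shows "invertible C f"
  using inverse_arrowsI [OF assms] by (auto simp: invertible_def)

lemma invertible_Inv [simp]: "invertible C f \<Longrightarrow> invertible C (Inv C f)"
  by (rule invertibleI [where g = f]) (auto simp: invertible_Arr)

lemma invertible_Ident [simp]: "x \<in> Obj C \<Longrightarrow> invertible C (Ident C x)"
  by (rule invertibleI [where g = "Ident C x"]) auto

lemma invertible_Comp [simp]: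
  assumes "invertible C f" "invertible C g" "Cod C f = Dom C g"
  shows "invertible C (f \<cdot> g)"
  using assms invertible_Arr [of f] invertible_Arr [of g]
  by (intro invertibleI [where g = "Inv C g \<cdot> Inv C f"]) simp_all

lemma invertible_cancel_left:
  assumes "invertible C f" "g \<in> Arr C" "h \<in> Arr C" "Dom C g = Cod C f" "Dom C h = Cod C f"
    "f \<cdot> g = f \<cdot> h"
  shows "g = h"
  using arg_cong [OF assms(6), of "\<lambda>x. Inv C f \<cdot> x"] assms(1-5) invertible_Arr [OF assms(1)]
  by (simp flip: Comp_assoc_Arr)

lemma invertible_cancel_right:
  assumes "invertible C f" "g \<in> Arr C" "h \<in> Arr C" "Cod C g = Dom C f" "Cod C h = Dom C f"
    "g \<cdot> f = h \<cdot> f"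
  shows "g = h"
  using arg_cong [OF assms(6), of "\<lambda>x. x \<cdot> Inv C f"] assms(1-5) invertible_Arr [OF assms(1)]
  by simp

section \<open>Terminal objects and binary products in a category\<close>

lemma terminal_eq:
  assumes "is_terminal C t" "f \<in> Arr C" "g \<in> Arr C" "Dom C f = Dom C g" "Cod C f = t" "Cod C g = t"
  shows "f = g"
proof -
  have "f \<in> hom C (Dom C f) t" "g \<in> hom C (Dom C f) t"
    using assms by (auto simp: hom_def)
  then show ?thesis using assms Dom_Obj unfolding is_terminal_def by blast
qed

lemma terminal_ex:
  assumes "is_terminal C t" "x \<in> Obj C"
  obtains f where "f \<in> Arr C" "Dom C f = x" "Cod C f = t"
  using assms unfolding is_terminal_def hom_def by blast

lemma product_simps:
  assumes "is_product C a b c \<pi> \<rho>"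
  shows "c \<in> Obj C" "\<pi> \<in> Arr C" "\<rho> \<in> Arr C" "Dom C \<pi> = c" "Dom C \<rho> = c" "Cod C \<pi> = a" "Cod C \<rho> = b"
  using assms by (auto simp: is_product_def hom_def)

lemma product_eq:
  assumes "is_product C a b c \<pi> \<rho>" "f \<in> Arr C" "g \<in> Arr C" "Dom C f = Dom C g"
    "Cod C f = c" "Cod C g = c" "f \<cdot> \<pi> = g \<cdot> \<pi>" "f \<cdot> \<rho> = g \<cdot> \<rho>"
  shows "f = g"
proof -
  let ?x = "Dom C f"
  have h: "f \<in> hom C ?x c" "g \<in> hom C ?x c" and p: "\<pi> \<in> hom C c a" "\<rho> \<in> hom C c b"
    and x: "?x \<in> Obj C"
    using assms by (auto simp: is_product_def hom_def)
  have "f \<cdot> \<pi> \<in> hom C ?x a" "f \<cdot> \<rho> \<in> hom C ?x b"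
    using h p Comp_hom by blast+
  then have "\<exists>!k. k \<in> hom C ?x c \<and> k \<cdot> \<pi> = f \<cdot> \<pi> \<and> k \<cdot> \<rho> = f \<cdot> \<rho>"
    using assms(1) x unfolding is_product_def by blast
  then show ?thesis
    using h assms(7,8) by metis
qed

lemma product_ex:
  assumes "is_product C a b c \<pi> \<rho>" "f \<in> Arr C" "g \<in> Arr C" "Dom C f = x" "Dom C g = x"
    "Cod C f = a" "Cod C g = b"
  obtains k where "k \<in> Arr C" "Dom C k = x" "Cod C k = c" "k \<cdot> \<pi> = f" "k \<cdot> \<rho> = g"
proof -
  have "x \<in> Obj C" "f \<in> hom C x a" "g \<in> hom C x b"
    using assms by (auto simp: hom_def)
  then have "\<exists>!k. k \<in> hom C x c \<and> k \<cdot> \<pi> = f \<and> k \<cdot> \<rho> = g"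
    using assms(1) unfolding is_product_def by blast
  then show ?thesis
    using that by (auto simp: hom_def)
qed

lemma is_productI:
  assumes "c \<in> Obj C" "\<pi> \<in> Arr C" "\<rho> \<in> Arr C" "Dom C \<pi> = c" "Dom C \<rho> = c" "Cod C \<pi> = a" "Cod C \<rho> = b"
    and ex: "\<And>f g. f \<in> Arr C \<Longrightarrow> g \<in> Arr C \<Longrightarrow> Dom C f = Dom C g \<Longrightarrow> Cod C f = a \<Longrightarrow> Cod C g = b \<Longrightarrow>
      \<exists>k \<in> Arr C. Dom C k = Dom C f \<and> Cod C k = c \<and> k \<cdot> \<pi> = f \<and> k \<cdot> \<rho> = g"
    and uniq: "\<And>f g. f \<in> Arr C \<Longrightarrow> g \<in> Arr C \<Longrightarrow> Dom C f = Dom C g \<Longrightarrow> Cod C f = c \<Longrightarrow> Cod C g = c \<Longrightarrow>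
      f \<cdot> \<pi> = g \<cdot> \<pi> \<Longrightarrow> f \<cdot> \<rho> = g \<cdot> \<rho> \<Longrightarrow> f = g"
  shows "is_product C a b c \<pi> \<rho>"
  unfolding is_product_def
proof (intro conjI ballI)
  fix x f g assume *: "x \<in> Obj C" "f \<in> hom C x a" "g \<in> hom C x b"
  then obtain k where k: "k \<in> hom C x c \<and> k \<cdot> \<pi> = f \<and> k \<cdot> \<rho> = g"
    using ex [of f g] by (auto simp: hom_def)
  show "\<exists>!k. k \<in> hom C x c \<and> k \<cdot> \<pi> = f \<and> k \<cdot> \<rho> = g"
  proof (rule ex1I [of _ k], rule k)
    fix k' assume "k' \<in> hom C x c \<and> k' \<cdot> \<pi> = f \<and> k' \<cdot> \<rho> = g"
    then show "k' = k"
      using k by - (rule uniq, simp_all add: hom_def)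
  qed
qed (use assms in \<open>auto simp: hom_def\<close>)

text \<open>Products are obtained first at the image of a right adjoint; invertible comparison cells
  then carry the universal property to composites of products, to units and to tensors.\<close>

lemma product_precomp_iso:
  assumes P: "is_product C a b c \<pi> \<rho>" and i: "invertible C i" "Cod C i = c"
  shows "is_product C a b (Dom C i) (i \<cdot> \<pi>) (i \<cdot> \<rho>)"
proof -
  note [simp] = product_simps [OF P] invertible_Arr [OF i(1)] i
  show ?thesis
  proof (rule is_productI)
    fix f g assume *: "f \<in> Arr C" "g \<in> Arr C" "Dom C f = Dom C g" "Cod C f = a" "Cod C g = b"
    obtain k where k: "k \<in> Arr C" "Dom C k = Dom C f" "Cod C k = c" "k \<cdot> \<pi> = f" "k \<cdot> \<rho> = g"
      using product_ex [OF P *(1,2) refl] * by metis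
    show "\<exists>k\<in>Arr C. Dom C k = Dom C f \<and> Cod C k = Dom C i \<and> k \<cdot> (i \<cdot> \<pi>) = f \<and> k \<cdot> (i \<cdot> \<rho>) = g"
      using k by (intro bexI [of _ "k \<cdot> Inv C i"]) auto
  next
    fix f g assume *: "f \<in> Arr C" "g \<in> Arr C" "Dom C f = Dom C g" "Cod C f = Dom C i" "Cod C g = Dom C i"
      "f \<cdot> (i \<cdot> \<pi>) = g \<cdot> (i \<cdot> \<pi>)" "f \<cdot> (i \<cdot> \<rho>) = g \<cdot> (i \<cdot> \<rho>)"
    have "f \<cdot> i = g \<cdot> i"
      by (rule product_eq [OF P]) (use * in simp_all)
    then show "f = g"
      using *(1-5) by - (rule invertible_cancel_right [OF i(1)], simp_all)
  qed auto
qed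

text \<open>Used to see that a laxity cell is invertible: once it is known to commute with two
  product cones, it must be this comparison.\<close>

lemma product_compare:
  assumes P: "is_product C a b c \<pi> \<rho>" and Q: "is_product C a b c' \<pi>' \<rho>'"
  obtains i where "invertible C i" "Dom C i = c" "Cod C i = c'" "i \<cdot> \<pi>' = \<pi>" "i \<cdot> \<rho>' = \<rho>"
proof -
  note [simp] = product_simps [OF P] product_simps [OF Q]
  obtain i where i [simp]: "i \<in> Arr C" "Dom C i = c" "Cod C i = c'" "i \<cdot> \<pi>' = \<pi>" "i \<cdot> \<rho>' = \<rho>"
    using product_ex [OF Q, of \<pi> \<rho> c] by auto
  obtain j where j [simp]: "j \<in> Arr C" "Dom C j = c'" "Cod C j = c" "j \<cdot> \<pi> = \<pi>'" "j \<cdot> \<rho> = \<rho>'"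
    using product_ex [OF P, of \<pi>' \<rho>' c'] by auto
  have "i \<cdot> j = Ident C c"
    by (rule product_eq [OF P]) simp_all
  moreover have "j \<cdot> i = Ident C c'"
    by (rule product_eq [OF Q]) simp_all
  ultimately have "invertible C i"
    by (intro invertibleI [where g = j]) auto
  then show ?thesis using that by simp
qed

end

section \<open>Full subcategories, products of categories and recognition of equivalences\<close>

lemma full_subcat_simps [simp]:
  "Obj (full_subcat C S) = Obj C \<inter> S" "Arr (full_subcat C S) = {f \<in> Arr C. Dom C f \<in> S \<and> Cod C f \<in> S}"
  "Dom (full_subcat C S) = Dom C" "Cod (full_subcat C S) = Cod C" "Ident (full_subcat C S) = Ident C"
  "Comp (full_subcat C S) = Comp C"
  by (auto simp: full_subcat_def)

lemma hom_full_subcat: "hom (full_subcat C S) x y = (if x \<in> S \<and> y \<in> S then hom C x y else {})"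
  by (auto simp: hom_def)

lemma category_full_subcat: "category C \<Longrightarrow> category (full_subcat C S)"
proof -
  assume "category C"
  then interpret category C .
  show ?thesis
    by unfold_locales (auto simp: hom_def)
qed

lemma cat_prod_simps [simp]:
  "Obj (cat_prod A B) = Obj A \<times> Obj B" "Arr (cat_prod A B) = Arr A \<times> Arr B"
  "Dom (cat_prod A B) = map_prod (Dom A) (Dom B)" "Cod (cat_prod A B) = map_prod (Cod A) (Cod B)"
  "Ident (cat_prod A B) = map_prod (Ident A) (Ident B)"
  "Comp (cat_prod A B) (f, f') (g, g') = (f \<cdot>\<^bsub>A\<^esub> g, f' \<cdot>\<^bsub>B\<^esub> g')"
  by (auto simp: cat_prod_def)

lemma hom_cat_prod: "hom (cat_prod A B) (x, x') (y, y') = hom A x y \<times> hom B x' y'"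
  by (auto simp: hom_def)

lemma category_cat_prod: "category A \<Longrightarrow> category B \<Longrightarrow> category (cat_prod A B)"
proof -
  assume "category A" "category B"
  then interpret A: category A + B: category B by simp_all
  show ?thesis
    by unfold_locales (auto simp: hom_def)
qed

lemma inverse_arrows_cat_prod:
  "inverse_arrows A f g \<Longrightarrow> inverse_arrows B f' g' \<Longrightarrow> inverse_arrows (cat_prod A B) (f, f') (g, g')"
  by (auto simp: inverse_arrows_def hom_def)

lemma invertible_cat_prod:
  "invertible A f \<Longrightarrow> invertible B f' \<Longrightarrow> invertible (cat_prod A B) (f, f')"
  unfolding invertible_def by (metis inverse_arrows_cat_prod)

lemma cat_one_simps [simp]:
  "Obj cat_one = UNIV" "Arr cat_one = UNIV" "Dom cat_one f = ()" "Cod cat_one f = ()"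
  "Ident cat_one x = ()" "Comp cat_one f g = ()"
  by (auto simp: cat_one_def)

lemma category_cat_one: "category cat_one"
  by unfold_locales (auto simp: hom_def)

context is_functor
begin

lemma fobj_Obj_simp [simp]: "x \<in> Obj A \<Longrightarrow> fobj F x \<in> Obj B"
  by (rule fobj_Obj)

lemma farr_simps [simp]:
  assumes "f \<in> Arr A"
  shows "farr F f \<in> Arr B" "Dom B (farr F f) = fobj F (Dom A f)" "Cod B (farr F f) = fobj F (Cod A f)"
  using farr_hom [of f "Dom A f" "Cod A f"] assms by (auto simp: hom_def)

lemma farr_Comp_Arr [simp]:
  "f \<in> Arr A \<Longrightarrow> g \<in> Arr A \<Longrightarrow> Cod A f = Dom A g \<Longrightarrow> farr F (f \<cdot>\<^bsub>A\<^esub> g) = farr F f \<cdot>\<^bsub>B\<^esub> farr F g"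
  by (rule farr_Comp) (auto simp: hom_def)

lemma farr_Ident_simp [simp]: "x \<in> Obj A \<Longrightarrow> farr F (Ident A x) = Ident B (fobj F x)"
  by (rule farr_Ident)

text \<open>An inverse on objects is selected by choice; full faithfulness determines it on arrows.\<close>

lemma is_equivalenceI:
  assumes ff: "\<And>x y g. x \<in> Obj A \<Longrightarrow> y \<in> Obj A \<Longrightarrow> g \<in> hom B (fobj F x) (fobj F y) \<Longrightarrow>
      \<exists>!f. f \<in> hom A x y \<and> farr F f = g"
    and eso: "\<And>b. b \<in> Obj B \<Longrightarrow> \<exists>x \<in> Obj A. \<exists>i \<in> hom B (fobj F x) b. invertible B i"
  shows "is_equivalence A B F"
proof -
  define P where "P = (\<lambda>b xi. fst xi \<in> Obj A \<and> snd xi \<in> hom B (fobj F (fst xi)) b \<and> invertible B (snd xi))"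
  define c where "c = (\<lambda>b. SOME xi. P b xi)"
  have c: "P b (c b)" if b: "b \<in> Obj B" for b
  proof -
    obtain x i where "P b (x, i)"
      proof -
      obtain x i where "x \<in> Obj A" "i \<in> hom B (fobj F x) b" "invertible B i"
        using eso [OF b] by blast
      then show ?thesis
        using that [of x i] by (simp add: P_def)
    qed
    then show ?thesis unfolding c_def by (rule someI)
  qed
  define g0 where "g0 = (\<lambda>b. fst (c b))"
  define \<tau> where "\<tau> = (\<lambda>b. snd (c b))"
  have g0 [simp]: "g0 b \<in> Obj A" and \<tau> [simp]: "\<tau> b \<in> Arr B" "Dom B (\<tau> b) = fobj F (g0 b)" "Cod B (\<tau> b) = b"
    "invertible B (\<tau> b)" if "b \<in> Obj B" for b
    using c [OF that] by (auto simp: P_def g0_def \<tau>_def hom_def)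
  define lift where "lift = (\<lambda>x y g. THE f. f \<in> hom A x y \<and> farr F f = g)"
  have lift: "lift x y g \<in> hom A x y \<and> farr F (lift x y g) = g"
    if "x \<in> Obj A" "y \<in> Obj A" "g \<in> hom B (fobj F x) (fobj F y)" for x y g
    unfolding lift_def by (rule theI' [OF ff [OF that]])
  have faithful: "f = f'" if "f \<in> Arr A" "f' \<in> Arr A" "Dom A f = Dom A f'" "Cod A f = Cod A f'"
    "farr F f = farr F f'" for f f'
  proof -
    have "f \<in> hom A (Dom A f) (Cod A f)" "f' \<in> hom A (Dom A f) (Cod A f)"
      "Dom A f \<in> Obj A" "Cod A f \<in> Obj A" "farr F f \<in> hom B (fobj F (Dom A f)) (fobj F (Cod A f))"
      using that by (auto simp: hom_def)
    then show ?thesis using ff that(5) by metis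
  qed
  define G where "G = \<lparr>fobj = g0, farr = (\<lambda>g. lift (g0 (Dom B g)) (g0 (Cod B g))
    (\<tau> (Dom B g) \<cdot>\<^bsub>B\<^esub> g \<cdot>\<^bsub>B\<^esub> Inv B (\<tau> (Cod B g))))\<rparr>"
  have G0 [simp]: "fobj G = g0" by (simp add: G_def)
  have "farr G g \<in> hom A (g0 (Dom B g)) (g0 (Cod B g)) \<and>
    farr F (farr G g) = \<tau> (Dom B g) \<cdot>\<^bsub>B\<^esub> g \<cdot>\<^bsub>B\<^esub> Inv B (\<tau> (Cod B g))" if "g \<in> Arr B" for g
    unfolding G_def using that by (simp del: B.Comp_assoc_Arr) (rule lift, auto simp: hom_def)
  then have G1 [simp]: "farr G g \<in> Arr A" "Dom A (farr G g) = g0 (Dom B g)" "Cod A (farr G g) = g0 (Cod B g)"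
    "farr F (farr G g) = \<tau> (Dom B g) \<cdot>\<^bsub>B\<^esub> g \<cdot>\<^bsub>B\<^esub> Inv B (\<tau> (Cod B g))" if "g \<in> Arr B" for g
    using that by (auto simp: hom_def)
  have GF: "is_functor B A G"
  proof unfold_locales
    show "farr G (Ident B x) = Ident A (fobj G x)" if "x \<in> Obj B" for x
      using that by (intro faithful) auto
    show "farr G (f \<cdot>\<^bsub>B\<^esub> g) = farr G f \<cdot>\<^bsub>A\<^esub> farr G g" if "f \<in> hom B x y" "g \<in> hom B y z" for f g x y z
      using that by (intro faithful) (auto simp: hom_def)
  qed (auto simp: hom_def)
  interpret G: is_functor B A G by (rule GF)
  define \<sigma> where "\<sigma> = (\<lambda>x. lift x (g0 (fobj F x)) (Inv B (\<tau> (fobj F x))))"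
  have "\<sigma> x \<in> hom A x (g0 (fobj F x)) \<and> farr F (\<sigma> x) = Inv B (\<tau> (fobj F x))" if "x \<in> Obj A" for x
    unfolding \<sigma>_def using that by (intro lift) (auto simp: hom_def)
  then have \<sigma> [simp]: "\<sigma> x \<in> Arr A" "Dom A (\<sigma> x) = x" "Cod A (\<sigma> x) = g0 (fobj F x)"
    "farr F (\<sigma> x) = Inv B (\<tau> (fobj F x))" if "x \<in> Obj A" for x
    using that by (auto simp: hom_def)
  have iso: "invertible A (\<sigma> x)" if x: "x \<in> Obj A" for x
  proof -
    define k where "k = lift (g0 (fobj F x)) x (\<tau> (fobj F x))"
    have "k \<in> hom A (g0 (fobj F x)) x \<and> farr F k = \<tau> (fobj F x)"
      unfolding k_def using x by (intro lift) (auto simp: hom_def)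
    then have k [simp]: "k \<in> Arr A" "Dom A k = g0 (fobj F x)" "Cod A k = x" "farr F k = \<tau> (fobj F x)"
      by (auto simp: hom_def)
    show ?thesis
      using x by (intro A.invertibleI [where g = k]) (auto intro!: faithful)
  qed
  have nat: "f \<cdot>\<^bsub>A\<^esub> \<sigma> (Cod A f) = \<sigma> (Dom A f) \<cdot>\<^bsub>A\<^esub> farr G (farr F f)" if "f \<in> Arr A" for f
    using that by (intro faithful) auto
  have FG: "is_functor A A (func_comp F G)" "is_functor B B (func_comp G F)"
    by (unfold_locales; auto simp: func_comp_def hom_def)+
  have ids: "is_functor A A func_id" "is_functor B B func_id"
    by (unfold_locales; auto simp: func_id_def hom_def)+
  show ?thesis
    unfolding is_equivalence_def
  proof (intro exI conjI)
    show "natural_iso A A func_id (func_comp F G) \<sigma>"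
      unfolding natural_iso_def using FG ids iso nat by (auto simp: func_id_def func_comp_def hom_def)
    show "natural_iso B B (func_comp G F) func_id \<tau>"
      unfolding natural_iso_def using FG ids by (auto simp: func_id_def func_comp_def hom_def)
  qed (use is_functor_axioms GF in auto)
qed

end

section \<open>Calculus of cells\<close>

sublocale double_category \<subseteq> src: is_functor "loose D" "tight D" "src D"
  by (rule src_functor)

sublocale double_category \<subseteq> tgt: is_functor "loose D" "tight D" "tgt D"
  by (rule tgt_functor)

sublocale double_category \<subseteq> units: is_functor "tight D" "loose D" "units D"
  by (rule units_functor)

context double_category
begin

abbreviation vcomp (infixr "\<Zsemi>" 70) where "a \<Zsemi> b \<equiv> a \<cdot>\<^bsub>loose D\<^esub> b"
abbreviation tcomp (infixr "\<Zcomp>" 70) where "f \<Zcomp> g \<equiv> f \<cdot>\<^bsub>tight D\<^esub> g"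
abbreviation "tdom \<equiv> Dom (tight D)"
abbreviation "tcod \<equiv> Cod (tight D)"
abbreviation "so \<equiv> fobj (src D)"
abbreviation "to \<equiv> fobj (tgt D)"
abbreviation "sd \<equiv> farr (src D)"
abbreviation "td \<equiv> farr (tgt D)"
abbreviation "un \<equiv> farr (units D)"
abbreviation "li \<equiv> fobj (units D)"
abbreviation "idl \<equiv> Ident (loose D)"
abbreviation "idt \<equiv> Ident (tight D)"
abbreviation "vinv \<equiv> Inv (loose D)"
abbreviation "Iso \<equiv> invertible (loose D)"
abbreviation "dm \<equiv> Dom (loose D)"
abbreviation "cd \<equiv> Cod (loose D)"
abbreviation "Cell \<equiv> Arr (loose D)"
abbreviation "Lo \<equiv> Obj (loose D)"
abbreviation "Ti \<equiv> Arr (tight D)"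
abbreviation "Tob \<equiv> Obj (tight D)"
abbreviation "as \<equiv> lassoc D"
abbreviation "lu \<equiv> lunit D"
abbreviation "ru \<equiv> runit D"

declare src_lid [simp] tgt_lid [simp] src_units [simp] tgt_units [simp]

lemma composable2_iff: "composable2 D A B \<longleftrightarrow> A \<in> Lo \<and> B \<in> Lo \<and> to A = so B"
  by (simp add: composable2_def composable_pairs_def)

lemma composable2_cells_iff: "composable2_cells D a b \<longleftrightarrow> a \<in> Cell \<and> b \<in> Cell \<and> td a = sd b"
  by (simp add: composable2_cells_def composable_pairs_def)

text \<open>Equal tight arrows have equal domains and codomains, so gluing two cells along a side
  makes their loose domains and codomains composable.\<close>

lemma sides_match:
  assumes "a \<in> Cell" "b \<in> Cell" "td a = sd b"
  shows "to (dm a) = so (dm b)" "to (cd a) = so (cd b)"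
  using arg_cong [OF assms(3), of "tdom"] arg_cong [OF assms(3), of "tcod"] assms(1,2)
  by simp_all

lemma lcomp_simps [simp]:
  assumes "A \<in> Lo" "B \<in> Lo" "to A = so B"
  shows "A \<odot> B \<in> Lo" "so (A \<odot> B) = so A" "to (A \<odot> B) = to B"
proof -
  have *: "composable2 D A B" using assms by (simp add: composable2_iff)
  then show "so (A \<odot> B) = so A" "to (A \<odot> B) = to B"
    by (simp_all add: src_lcomp tgt_lcomp)
  show "A \<odot> B \<in> Lo"
    using is_functor.fobj_Obj [OF composition_functor, of "(A, B)"] *
    by (simp add: composable2_def Defs.composition_functor_def)
qed

lemma ccomp_simps [simp]:
  assumes "a \<in> Cell" "b \<in> Cell" "td a = sd b"
  shows "a \<star> b \<in> Cell" "dm (a \<star> b) = dm a \<odot> dm b" "cd (a \<star> b) = cd a \<odot> cd b"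
    "sd (a \<star> b) = sd a" "td (a \<star> b) = td b"
proof -
  have *: "composable2_cells D a b" using assms by (simp add: composable2_cells_iff)
  then show "sd (a \<star> b) = sd a" "td (a \<star> b) = td b"
    by (simp_all add: src_ccomp tgt_ccomp)
  have "(a, b) \<in> Arr (composable_pairs D)" using * by (simp add: composable2_cells_def)
  from is_functor.farr_simps [OF composition_functor this]
  show "a \<star> b \<in> Cell" "dm (a \<star> b) = dm a \<odot> dm b" "cd (a \<star> b) = cd a \<odot> cd b"
    by (simp_all add: Defs.composition_functor_def composable_pairs_def)
qed

lemma ccomp_idl [simp]:
  assumes "A \<in> Lo" "B \<in> Lo" "to A = so B"
  shows "idl A \<star> idl B = idl (A \<odot> B)"
  using is_functor.farr_Ident [OF composition_functor, of "(A, B)"] assms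
  by (simp add: Defs.composition_functor_def composable_pairs_def)

lemma interchange:
  assumes "a \<in> Cell" "b \<in> Cell" "c \<in> Cell" "d \<in> Cell" "cd a = dm c" "cd b = dm d"
    "td a = sd b" "td c = sd d"
  shows "(a \<star> b) \<Zsemi> (c \<star> d) = (a \<Zsemi> c) \<star> (b \<Zsemi> d)"
  using is_functor.farr_Comp_Arr [OF composition_functor, of "(a, b)" "(c, d)"] assms
  by (simp add: Defs.composition_functor_def composable_pairs_def)

text \<open>Simplification keeps vertical composites right-nested, so the interchange law must also
  fire in front of a remaining factor \<open>z\<close>; \<open>merge\<close> bundles both
  shapes.\<close>

lemma interchange_assoc:
  assumes "a \<in> Cell" "b \<in> Cell" "c \<in> Cell" "d \<in> Cell" "cd a = dm c" "cd b = dm d"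
    "td a = sd b" "td c = sd d" "z \<in> Cell" "dm z = cd c \<odot> cd d"
  shows "(a \<star> b) \<Zsemi> (c \<star> d) \<Zsemi> z = ((a \<Zsemi> c) \<star> (b \<Zsemi> d)) \<Zsemi> z"
  using assms by (simp flip: src.A.Comp_assoc_Arr add: interchange)

lemmas merge = interchange interchange_assoc

lemma iso_Cell [simp]: "Iso a \<Longrightarrow> a \<in> Cell"
  by (rule src.A.invertible_Arr)

lemma sides_inv [simp]:
  assumes "Iso a"
  shows "sd (vinv a) = Inv (tight D) (sd a)" "td (vinv a) = Inv (tight D) (td a)"
proof -
  have "inverse_arrows (tight D) (sd a) (sd (vinv a))"
    using assms src.farr_Comp_Arr [of a "vinv a"] src.farr_Comp_Arr [of "vinv a" a]
    by (intro src.B.inverse_arrowsI) simp_all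
  then show "sd (vinv a) = Inv (tight D) (sd a)" by (simp add: src.B.Inv_eqI)
  have "inverse_arrows (tight D) (td a) (td (vinv a))"
    using assms tgt.farr_Comp_Arr [of a "vinv a"] tgt.farr_Comp_Arr [of "vinv a" a]
    by (intro src.B.inverse_arrowsI) simp_all
  then show "td (vinv a) = Inv (tight D) (td a)" by (simp add: src.B.Inv_eqI)
qed

lemma Inv_idt [simp]: "I \<in> Tob \<Longrightarrow> Inv (tight D) (idt I) = idt I"
  by (rule src.B.Inv_eqI) (rule src.B.inverse_arrowsI, simp_all)

lemma iso_ccomp [simp]:
  assumes "Iso a" "Iso b" "td a = sd b"
  shows "Iso (a \<star> b)"
  by (rule src.A.invertibleI [where g = "vinv a \<star> vinv b"])
    (use assms sides_match [of a b] in \<open>simp_all add: merge\<close>)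

lemma globularD:
  assumes "globular_iso D a A B"
  shows "Iso a" "dm a = A" "cd a = B" "sd a = idt (so A)" "td a = idt (to A)"
  using assms by (auto simp: globular_iso_def globular_def hom_def)

lemma as_simps [simp]:
  assumes "A \<in> Lo" "B \<in> Lo" "C \<in> Lo" "to A = so B" "to B = so C"
  shows "Iso (as A B C)" "dm (as A B C) = (A \<odot> B) \<odot> C" "cd (as A B C) = A \<odot> (B \<odot> C)"
    "sd (as A B C) = idt (so A)" "td (as A B C) = idt (to C)"
  using globularD [OF lassoc_iso, of A B C] assms by (simp_all add: composable2_iff)

lemma lu_simps [simp]:
  assumes "A \<in> Lo"
  shows "Iso (lu A)" "dm (lu A) = li (so A) \<odot> A" "cd (lu A) = A"
    "sd (lu A) = idt (so A)" "td (lu A) = idt (to A)"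
  using globularD [OF lunit_iso, of A] assms by simp_all

lemma ru_simps [simp]:
  assumes "A \<in> Lo"
  shows "Iso (ru A)" "dm (ru A) = A \<odot> li (to A)" "cd (ru A) = A"
    "sd (ru A) = idt (so A)" "td (ru A) = idt (to A)"
  using globularD [OF runit_iso, of A] assms by simp_all

lemma iso_inv_naturality:
  assumes "Iso i" "Iso j" "a \<in> Cell" "b \<in> Cell" "cd a = dm j" "cd i = dm b"
    "dm a = dm i" "cd b = cd j" "a \<Zsemi> j = i \<Zsemi> b"
  shows "vinv i \<Zsemi> a = b \<Zsemi> vinv j"
proof -
  have "vinv i \<Zsemi> (a \<Zsemi> j) \<Zsemi> vinv j = vinv i \<Zsemi> (i \<Zsemi> b) \<Zsemi> vinv j"
    by (simp only: assms(9))
  then show ?thesis using assms(1-8) by simp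
qed

lemma as_natural:
  assumes "a \<in> Cell" "b \<in> Cell" "c \<in> Cell" "td a = sd b" "td b = sd c"
    "cd a = A" "cd b = B" "cd c = C"
  shows "((a \<star> b) \<star> c) \<Zsemi> as A B C = as (dm a) (dm b) (dm c) \<Zsemi> (a \<star> (b \<star> c))"
  using assms by (intro lassoc_natural) (auto simp: hom_def composable2_cells_iff)

lemma as_natural_assoc:
  assumes "a \<in> Cell" "b \<in> Cell" "c \<in> Cell" "td a = sd b" "td b = sd c"
    "cd a = A" "cd b = B" "cd c = C" "z \<in> Cell" "dm z = A \<odot> (B \<odot> C)"
  shows "((a \<star> b) \<star> c) \<Zsemi> as A B C \<Zsemi> z = as (dm a) (dm b) (dm c) \<Zsemi> (a \<star> (b \<star> c)) \<Zsemi> z"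
  using assms sides_match [of a b] sides_match [of b c] as_natural [of a b c A B C]
  by (auto simp flip: src.A.Comp_assoc_Arr)

lemma inv_as_natural:
  assumes "a \<in> Cell" "b \<in> Cell" "c \<in> Cell" "td a = sd b" "td b = sd c"
    "cd a = A" "cd b = B" "cd c = C"
  shows "(a \<star> (b \<star> c)) \<Zsemi> vinv (as A B C) = vinv (as (dm a) (dm b) (dm c)) \<Zsemi> ((a \<star> b) \<star> c)"
  by (rule iso_inv_naturality [symmetric])
    (use assms sides_match [of a b] sides_match [of b c] as_natural [of a b c] in auto)

lemma inv_as_natural_assoc:
  assumes "a \<in> Cell" "b \<in> Cell" "c \<in> Cell" "td a = sd b" "td b = sd c"
    "cd a = A" "cd b = B" "cd c = C" "z \<in> Cell" "dm z = (A \<odot> B) \<odot> C"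
  shows "(a \<star> (b \<star> c)) \<Zsemi> vinv (as A B C) \<Zsemi> z =
    vinv (as (dm a) (dm b) (dm c)) \<Zsemi> ((a \<star> b) \<star> c) \<Zsemi> z"
  using assms sides_match [of a b] sides_match [of b c] inv_as_natural [of a b c A B C]
  by (auto simp flip: src.A.Comp_assoc_Arr)

lemma lu_natural:
  assumes "a \<in> Cell" "sd a = f" "cd a = B"
  shows "(un f \<star> a) \<Zsemi> lu B = lu (dm a) \<Zsemi> a"
  using lunit_natural [of a "dm a" B] assms by (auto simp: hom_def)

lemma lu_natural_assoc:
  assumes "a \<in> Cell" "sd a = f" "cd a = B" "z \<in> Cell" "dm z = B"
  shows "(un f \<star> a) \<Zsemi> lu B \<Zsemi> z = lu (dm a) \<Zsemi> a \<Zsemi> z"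
  using assms lu_natural [of a] by (auto simp flip: src.A.Comp_assoc_Arr)

lemma ru_natural:
  assumes "a \<in> Cell" "td a = f" "cd a = B"
  shows "(a \<star> un f) \<Zsemi> ru B = ru (dm a) \<Zsemi> a"
  using runit_natural [of a "dm a" B] assms by (auto simp: hom_def)

lemma ru_natural_assoc:
  assumes "a \<in> Cell" "td a = f" "cd a = B" "z \<in> Cell" "dm z = B"
  shows "(a \<star> un f) \<Zsemi> ru B \<Zsemi> z = ru (dm a) \<Zsemi> a \<Zsemi> z"
  using assms ru_natural [of a] by (auto simp flip: src.A.Comp_assoc_Arr)

text \<open>When the source side is an identity, the unit cell on it is simplified to
  \<open>idl (li I)\<close>, a shape that \<open>lu_natural\<close> no longer matches; hence a
  separate version, again with and without a trailing factor.\<close>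

lemma lu_natural_globular:
  assumes "a \<in> Cell" "sd a = idt I" "I \<in> Tob" "cd a = B"
  shows "(idl (li I) \<star> a) \<Zsemi> lu B = lu (dm a) \<Zsemi> a"
    "z \<in> Cell \<Longrightarrow> dm z = B \<Longrightarrow> (idl (li I) \<star> a) \<Zsemi> lu B \<Zsemi> z = lu (dm a) \<Zsemi> a \<Zsemi> z"
  using lu_natural [of a "idt I" B] lu_natural_assoc [of a "idt I" B z] assms by simp_all

lemma ru_natural_globular:
  assumes "a \<in> Cell" "td a = idt I" "I \<in> Tob" "cd a = B"
  shows "(a \<star> idl (li I)) \<Zsemi> ru B = ru (dm a) \<Zsemi> a"
    "z \<in> Cell \<Longrightarrow> dm z = B \<Longrightarrow> (a \<star> idl (li I)) \<Zsemi> ru B \<Zsemi> z = ru (dm a) \<Zsemi> a \<Zsemi> z"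
  using ru_natural [of a "idt I" B] ru_natural_assoc [of a "idt I" B z] assms by simp_all

text \<open>Oriented so that the structural isomorphisms move to the left.\<close>

lemmas natural = as_natural as_natural_assoc lu_natural lu_natural_assoc ru_natural ru_natural_assoc
  lu_natural_globular ru_natural_globular

lemma inv_lu_natural:
  assumes "a \<in> Cell"
  shows "a \<Zsemi> vinv (lu (cd a)) = vinv (lu (dm a)) \<Zsemi> (un (sd a) \<star> a)"
  by (rule iso_inv_naturality [symmetric]) (use assms lu_natural [of a] in auto)

lemma inv_ru_natural:
  assumes "a \<in> Cell"
  shows "a \<Zsemi> vinv (ru (cd a)) = vinv (ru (dm a)) \<Zsemi> (a \<star> un (td a))"
  by (rule iso_inv_naturality [symmetric]) (use assms ru_natural [of a] in auto)

lemma triangle':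
  assumes "A \<in> Lo" "B \<in> Lo" "to A = so B" "so B = I"
  shows "as A (li I) B \<Zsemi> (idl A \<star> lu B) = ru A \<star> idl B"
  using triangle [of A B] assms by (simp add: composable2_iff)

lemma pentagon':
  assumes "A \<in> Lo" "B \<in> Lo" "C \<in> Lo" "E \<in> Lo" "to A = so B" "to B = so C" "to C = so E"
  shows "as (A \<odot> B) C E \<Zsemi> as A B (C \<odot> E) =
      (as A B C \<star> idl E) \<Zsemi> as A (B \<odot> C) E \<Zsemi> (idl A \<star> as B C E)"
  using pentagon [of A B C E] assms by (simp add: composable2_iff)

subsection \<open>Unit coherence\<close>

text \<open>By naturality of the invertible \<open>lu\<close>, whiskering with a unit is faithful on
  cells whose source side is an identity. This removes the auxiliary unit from the coherence
  argument below.\<close>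

lemma unit_whisker_cancel:
  assumes "a \<in> Cell" "b \<in> Cell" "dm a = dm b" "cd a = cd b" "sd a = idt I" "sd b = idt I" "I \<in> Tob"
    "idl (li I) \<star> a = idl (li I) \<star> b"
  shows "a = b"
proof (rule src.A.invertible_cancel_left [of "lu (dm a)"])
  show "lu (dm a) \<Zsemi> a = lu (dm a) \<Zsemi> b"
    using lu_natural_globular(1) [of a I "cd a"] lu_natural_globular(1) [of b I "cd a"] assms by simp
qed (use assms in simp_all)

lemma whisker_unit_cancel:
  assumes "a \<in> Cell" "b \<in> Cell" "dm a = dm b" "cd a = cd b" "td a = idt I" "td b = idt I" "I \<in> Tob"
    "a \<star> idl (li I) = b \<star> idl (li I)"
  shows "a = b"
proof (rule src.A.invertible_cancel_left [of "ru (dm a)"])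
  show "ru (dm a) \<Zsemi> a = ru (dm a) \<Zsemi> b"
    using ru_natural_globular(1) [of a I "cd a"] ru_natural_globular(1) [of b I "cd a"] assms by simp
qed (use assms in simp_all)

text \<open>One of the unit laws that Kelly derived from pentagon and triangle. The pentagon for
  \<open>li I\<close>, \<open>li I\<close>, \<open>A\<close>, \<open>B\<close> proves the equation
  after whiskering with \<open>li I\<close> on the left; the whiskering is then cancelled.\<close>

lemma as_lu:
  assumes [simp]: "A \<in> Lo" "B \<in> Lo" "to A = so B" "so A = I"
  shows "as (li I) A B \<Zsemi> lu (A \<odot> B) = lu A \<star> idl B"
proof -
  have [simp]: "I \<in> Tob" using src.fobj_Obj [of A] by simp
  let ?u = "li I" and ?p = "(as (li I) (li I) A \<star> idl B) \<Zsemi> as (li I) (li I \<odot> A) B"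
  have "?p \<Zsemi> (idl ?u \<star> as ?u A B) \<Zsemi> (idl ?u \<star> lu (A \<odot> B)) =
    as (?u \<odot> ?u) A B \<Zsemi> as ?u ?u (A \<odot> B) \<Zsemi> (idl ?u \<star> lu (A \<odot> B))"
    using arg_cong [OF pentagon' [of ?u ?u A B], of "\<lambda>x. x \<Zsemi> (idl ?u \<star> lu (A \<odot> B))"]
    by simp
  also have "\<dots> = as (?u \<odot> ?u) A B \<Zsemi> (ru ?u \<star> (idl A \<star> idl B))"
    by (simp add: triangle')
  also have "\<dots> = ((ru ?u \<star> idl A) \<star> idl B) \<Zsemi> as ?u A B"
    by (simp add: as_natural del: ccomp_idl)
  also have "\<dots> = ((as ?u ?u A \<Zsemi> (idl ?u \<star> lu A)) \<star> (idl B \<Zsemi> idl B)) \<Zsemi> as ?u A B"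
    by (simp add: triangle')
  also have "\<dots> = (as ?u ?u A \<star> idl B) \<Zsemi> ((idl ?u \<star> lu A) \<star> idl B) \<Zsemi> as ?u A B"
    by (simp add: merge)
  also have "\<dots> = ?p \<Zsemi> (idl ?u \<star> (lu A \<star> idl B))"
    by (simp add: as_natural)
  finally have "?p \<Zsemi> (idl ?u \<star> (as ?u A B \<Zsemi> lu (A \<odot> B))) = ?p \<Zsemi> (idl ?u \<star> (lu A \<star> idl B))"
    by (simp add: merge)
  then have "idl ?u \<star> (as ?u A B \<Zsemi> lu (A \<odot> B)) = idl ?u \<star> (lu A \<star> idl B)"
    by - (rule src.A.invertible_cancel_left [of ?p], simp_all)
  then show ?thesis
    by - (rule unit_whisker_cancel [of _ _ I], simp_all)
qed

text \<open>Mirror image of \<open>as_lu\<close>: the pentagon for \<open>A\<close>,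
  \<open>B\<close>, \<open>li I\<close>, \<open>li I\<close>, with the whiskering cancelled on the
  right.\<close>

lemma as_ru:
  assumes [simp]: "A \<in> Lo" "B \<in> Lo" "to A = so B" "to B = I"
  shows "as A B (li I) \<Zsemi> (idl A \<star> ru B) = ru (A \<odot> B)"
proof -
  have [simp]: "I \<in> Tob" using tgt.fobj_Obj [of B] by simp
  let ?u = "li I"
  have "(as A B ?u \<star> idl ?u) \<Zsemi> as A (B \<odot> ?u) ?u \<Zsemi> (idl A \<star> as B ?u ?u) \<Zsemi> (idl A \<star> (idl B \<star> lu ?u))
    = as (A \<odot> B) ?u ?u \<Zsemi> as A B (?u \<odot> ?u) \<Zsemi> (idl A \<star> (idl B \<star> lu ?u))"
    using arg_cong [OF pentagon' [of A B ?u ?u], of "\<lambda>x. x \<Zsemi> (idl A \<star> (idl B \<star> lu ?u))"]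
    by simp
  also have "\<dots> = as (A \<odot> B) ?u ?u \<Zsemi> ((idl A \<star> idl B) \<star> lu ?u) \<Zsemi> as A B ?u"
    by (simp add: as_natural del: ccomp_idl)
  also have "\<dots> = (ru (A \<odot> B) \<star> idl ?u) \<Zsemi> as A B ?u"
    by (simp add: triangle' flip: src.A.Comp_assoc_Arr)
  finally have "(ru (A \<odot> B) \<star> idl ?u) \<Zsemi> as A B ?u =
    (as A B ?u \<star> idl ?u) \<Zsemi> as A (B \<odot> ?u) ?u \<Zsemi> (idl A \<star> (ru B \<star> idl ?u))"
    by (simp add: merge triangle')
  also have "\<dots> = (as A B ?u \<star> idl ?u) \<Zsemi> ((idl A \<star> ru B) \<star> idl ?u) \<Zsemi> as A B ?u"
    by (simp add: as_natural)
  also have "\<dots> = ((as A B ?u \<Zsemi> (idl A \<star> ru B)) \<star> idl ?u) \<Zsemi> as A B ?u"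
    by (simp add: merge)
  finally have "ru (A \<odot> B) \<star> idl ?u = (as A B ?u \<Zsemi> (idl A \<star> ru B)) \<star> idl ?u"
    by - (rule src.A.invertible_cancel_right [of "as A B ?u"], simp_all)
  then show ?thesis
    by - (rule whisker_unit_cancel [of _ _ I, symmetric], simp_all)
qed

text \<open>The triangle and \<open>as_lu\<close>, both taken at units, start with the same
  associator, so the two unitors agree after whiskering with a unit.\<close>

lemma lu_li:
  assumes [simp]: "I \<in> Tob"
  shows "lu (li I) = ru (li I)"
proof -
  let ?u = "li I"
  \<comment> \<open>Naturality of \<open>lu\<close> with respect to the cell
    \<open>lu (li I)\<close> itself; cancelling the last factor computes \<open>lu\<close> at the
    double unit.\<close>
  have "(idl ?u \<star> lu ?u) \<Zsemi> lu ?u = lu (?u \<odot> ?u) \<Zsemi> lu ?u"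
    by (simp add: lu_natural_globular)
  then have *: "lu (?u \<odot> ?u) = idl ?u \<star> lu ?u"
    by - (rule src.A.invertible_cancel_right [of "lu ?u"], simp_all)
  have "lu ?u \<star> idl ?u = ru ?u \<star> idl ?u"
    using as_lu [of ?u ?u I] triangle' [of ?u ?u I] * by simp
  then show ?thesis
    by - (rule whisker_unit_cancel [of _ _ I], simp_all)
qed

end

section \<open>The loose bicategory\<close>

context double_category
begin

abbreviation "LB \<equiv> loose_bicategory D"

lemma LB_simps [simp]:
  "Ob LB = Tob" "Obj (cells LB) = Lo" "Dom (cells LB) = dm" "Cod (cells LB) = cd"
  "Ident (cells LB) = idl" "Comp (cells LB) = Comp (loose D)" "bsrc LB = so" "btgt LB = to" "bid LB = li"
  "bcomp LB = lcomp D" "hcomp LB = ccomp D" "bassoc LB = as" "blunit LB = lu" "brunit LB = ru"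
  "Arr (cells LB) = {a. globular D a}"
  by (auto simp: loose_bicategory_def)

lemma one_cells_LB [simp]: "A \<in> one_cells LB I J \<longleftrightarrow> A \<in> Lo \<and> so A = I \<and> to A = J"
  by (simp add: one_cells_def)

lemma globular_iff:
  "globular D a \<longleftrightarrow> a \<in> Cell \<and> sd a = idt (so (dm a)) \<and> td a = idt (to (dm a))"
  by (simp add: globular_def)

lemma globular_ends:
  assumes "a \<in> Cell"
  shows "sd a = idt (so (dm a)) \<Longrightarrow> so (cd a) = so (dm a)" "td a = idt (to (dm a)) \<Longrightarrow> to (cd a) = to (dm a)"
  using src.farr_simps(3) [OF assms] tgt.farr_simps(3) [OF assms] assms by simp_all

lemma hom_cells_LB:
  "a \<in> hom (cells LB) A B \<longleftrightarrow>
    a \<in> Cell \<and> dm a = A \<and> cd a = B \<and> sd a = idt (so A) \<and> td a = idt (to A) \<and>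
    so B = so A \<and> to B = to A"
  using globular_ends [of a] by (auto simp: hom_def globular_iff)

lemma category_cells_LB: "category (cells LB)"
  by unfold_locales (auto simp: hom_cells_LB globular_iff)

text \<open>The inverse of a globular isomorphism has identity sides again, so inverses among all
  cells are inverses in \<open>cells LB\<close>, and \<open>cell_inv\<close> in the definitions of
  adjunctions and laxity cells can be replaced by \<open>vinv\<close>.\<close>

lemma inverse_arrows_LB:
  assumes "Iso a" "sd a = idt (so (dm a))" "td a = idt (to (dm a))"
  shows "inverse_arrows (cells LB) a (vinv a)"
  using assms globular_ends [of a] by (simp add: inverse_arrows_def hom_cells_LB globular_iff)

lemma
  assumes "Iso a" "sd a = idt (so (dm a))" "td a = idt (to (dm a))"
  shows cell_inv_LB [simp]: "cell_inv LB a = vinv a" and invertible_LB [simp]: "invertible (cells LB) a"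
  using inverse_arrows_LB [OF assms] category.Inv_eqI [OF category_cells_LB]
  by (auto simp: invertible_def)

lemma bicategory_LB: "bicategory LB"
proof (rule bicategory.intro, goal_cases)
  case 1
  show ?case by (rule category_cells_LB)
next
  case (10 f I J g K a f' a' f'' b g' b')
  then show ?case by (simp add: interchange hom_cells_LB)
next
  case (14 f I J g K h L a f' b g' c h')
  then show ?case by (auto simp: as_natural hom_cells_LB)
next
  case (15 f I J a g)
  then show ?case by (auto simp: lu_natural_globular hom_cells_LB)
next
  case (16 f I J a g)
  then show ?case by (auto simp: ru_natural_globular hom_cells_LB)
next
  case (17 f I J g K h L k M)
  then show ?case by (simp add: pentagon')
next
  case (18 f I J g K)
  then show ?case by (simp add: triangle')
qed (auto simp: hom_cells_LB)

end

section \<open>Companions and conjoints\<close>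

locale equip = double_category +
  assumes fibration: "is_fibration (loose D) (cat_prod (tight D) (tight D)) (func_pair (src D) (tgt D))"
begin

abbreviation "cartesian \<equiv> cartesian_arrow (loose D) (cat_prod (tight D) (tight D)) (func_pair (src D) (tgt D))"

lemma cartesian_lift:
  assumes "B \<in> Lo" "f \<in> Ti" "g \<in> Ti" "tcod f = so B" "tcod g = to B"
  obtains \<phi> where "cartesian \<phi>" "\<phi> \<in> Cell" "cd \<phi> = B" "sd \<phi> = f" "td \<phi> = g"
proof -
  have "B \<in> Lo" "(f, g) \<in> Arr (cat_prod (tight D) (tight D))"
    "Cod (cat_prod (tight D) (tight D)) (f, g) = fobj (func_pair (src D) (tgt D)) B"
    using assms by (simp_all add: func_pair_def)
  then obtain \<phi> where "cartesian \<phi>" "cd \<phi> = B" "farr (func_pair (src D) (tgt D)) \<phi> = (f, g)"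
    using fibration unfolding is_fibration_def by blast
  then show ?thesis
    using that [of \<phi>] by (simp add: func_pair_def cartesian_arrow_def)
qed

lemma cartesian_ex1:
  assumes "cartesian \<phi>" "c \<in> Cell" "cd c = cd \<phi>" "h \<in> Ti" "h' \<in> Ti" "tdom h = so (dm c)"
    "tdom h' = to (dm c)" "tcod h = so (dm \<phi>)" "tcod h' = to (dm \<phi>)"
    "sd c = h \<Zcomp> sd \<phi>" "td c = h' \<Zcomp> td \<phi>"
  shows "\<exists>!k. k \<in> hom (loose D) (dm c) (dm \<phi>) \<and> sd k = h \<and> td k = h' \<and> k \<Zsemi> \<phi> = c"
proof -
  let ?P = "func_pair (src D) (tgt D)"
  have "(h, h') \<in> hom (cat_prod (tight D) (tight D)) (fobj ?P (dm c)) (fobj ?P (dm \<phi>))"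
    "cd c = cd \<phi> \<and> (h, h') \<cdot>\<^bsub>cat_prod (tight D) (tight D)\<^esub> farr ?P \<phi> = farr ?P c"
    using assms by (auto simp: hom_def func_pair_def)
  then have "\<exists>!k. k \<in> hom (loose D) (dm c) (dm \<phi>) \<and> farr ?P k = (h, h') \<and> k \<Zsemi> \<phi> = c"
    using assms(1,2) unfolding cartesian_arrow_def by blast
  then show ?thesis
    by (simp add: func_pair_def conj_assoc)
qed

lemma cartesian_factor:
  assumes "cartesian \<phi>" "c \<in> Cell" "cd c = cd \<phi>" "h \<in> Ti" "h' \<in> Ti" "tdom h = so (dm c)"
    "tdom h' = to (dm c)" "tcod h = so (dm \<phi>)" "tcod h' = to (dm \<phi>)"
    "sd c = h \<Zcomp> sd \<phi>" "td c = h' \<Zcomp> td \<phi>"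
  obtains k where "k \<in> Cell" "dm k = dm c" "cd k = dm \<phi>" "sd k = h" "td k = h'" "k \<Zsemi> \<phi> = c"
  using ex1_implies_ex [OF cartesian_ex1 [OF assms]] that by (auto simp: hom_def)

text \<open>Uniqueness of cartesian factorizations in the form used throughout: a cartesian cell is
  monic with respect to cells with the same sides.\<close>

lemma cartesian_eq:
  assumes "cartesian \<phi>" "k \<in> Cell" "k' \<in> Cell" "dm k = dm k'" "cd k = dm \<phi>" "cd k' = dm \<phi>"
    "sd k = sd k'" "td k = td k'" "k \<Zsemi> \<phi> = k' \<Zsemi> \<phi>"
  shows "k = k'"
proof -
  have [simp]: "\<phi> \<in> Cell" using assms(1) by (simp add: cartesian_arrow_def)
  have "so (cd k) = so (dm \<phi>)" "to (cd k) = to (dm \<phi>)"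
    using assms by simp_all
  then have "\<exists>!x. x \<in> hom (loose D) (dm (k \<Zsemi> \<phi>)) (dm \<phi>) \<and> sd x = sd k \<and> td x = td k \<and>
      x \<Zsemi> \<phi> = k \<Zsemi> \<phi>"
    using assms(1-5) by (intro cartesian_ex1) simp_all
  moreover have "k \<in> hom (loose D) (dm (k \<Zsemi> \<phi>)) (dm \<phi>)" "k' \<in> hom (loose D) (dm (k \<Zsemi> \<phi>)) (dm \<phi>)"
    using assms(2-6) by (simp_all add: hom_def)
  ultimately show ?thesis
    using assms(7-9) by metis
qed

text \<open>The cells \<open>k\<close> and \<open>e\<close> are the binding cells of a companion:
  vertically they compose to the unit cell of \<open>f\<close>, horizontally to an identity up to
  unitors. \<open>conjoint\<close> is the same notion with source and target exchanged.\<close>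

definition companion :: "'b \<Rightarrow> 'c \<Rightarrow> 'd \<Rightarrow> 'd \<Rightarrow> bool" where
  "companion f x k e \<longleftrightarrow> x \<in> Lo \<and> so x = tdom f \<and> to x = tcod f \<and>
    k \<in> Cell \<and> dm k = x \<and> cd k = li (tcod f) \<and> sd k = f \<and> td k = idt (tcod f) \<and>
    e \<in> Cell \<and> dm e = li (tdom f) \<and> cd e = x \<and> sd e = idt (tdom f) \<and> td e = f \<and>
    e \<Zsemi> k = un f \<and> (e \<star> k) \<Zsemi> ru x = lu x"

definition conjoint :: "'b \<Rightarrow> 'c \<Rightarrow> 'd \<Rightarrow> 'd \<Rightarrow> bool" where
  "conjoint f x k e \<longleftrightarrow> x \<in> Lo \<and> so x = tcod f \<and> to x = tdom f \<and>
    k \<in> Cell \<and> dm k = x \<and> cd k = li (tcod f) \<and> sd k = idt (tcod f) \<and> td k = f \<and>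
    e \<in> Cell \<and> dm e = li (tdom f) \<and> cd e = x \<and> sd e = f \<and> td e = idt (tdom f) \<and>
    e \<Zsemi> k = un f \<and> (k \<star> e) \<Zsemi> lu x = ru x"

text \<open>Restricting the unit at the codomain of \<open>f\<close> along \<open>f\<close> on the
  source side only gives the companion; the binding cell \<open>e\<close> is the factorization of
  \<open>un f\<close> through the cartesian cell \<open>k\<close>.\<close>

lemma companion_ex:
  assumes f [simp]: "f \<in> Ti"
  shows "\<exists>x k e. companion f x k e"
proof -
  let ?I = "tdom f" and ?J = "tcod f"
  obtain k where ca: "cartesian k" and k [simp]: "k \<in> Cell" "cd k = li ?J" "sd k = f" "td k = idt ?J"
    by (rule cartesian_lift [of "li ?J" f "idt ?J"]) simp_all
  define x where "x = dm k"
  have x [simp]: "dm k = x" "x \<in> Lo" "so x = ?I" "to x = ?J"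
    using src.farr_simps(2) [of k] tgt.farr_simps(2) [of k] by (simp_all add: x_def)
  obtain e where e [simp]: "e \<in> Cell" "dm e = li ?I" "cd e = x" "sd e = idt ?I" "td e = f" "e \<Zsemi> k = un f"
    by (rule cartesian_factor [OF ca, of "un f" "idt ?I" f]) simp_all
  \<comment> \<open>Both sides are globular, and they agree after composition with the cartesian
    \<open>k\<close> by naturality of the unitors and \<open>e \<Zsemi> k = un f\<close>.\<close>
  have "vinv (lu x) \<Zsemi> (e \<star> k) \<Zsemi> ru x = idl x"
  proof (rule cartesian_eq [OF ca])
    have "(e \<star> k) \<Zsemi> ru x \<Zsemi> k = (e \<star> k) \<Zsemi> (k \<star> idl (li ?J)) \<Zsemi> ru (li ?J)"
      by (simp add: ru_natural_globular)
    also have "\<dots> = lu x \<Zsemi> k"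
      by (simp add: merge lu_natural flip: lu_li)
    finally show "(vinv (lu x) \<Zsemi> (e \<star> k) \<Zsemi> ru x) \<Zsemi> k = idl x \<Zsemi> k"
      by simp
  qed simp_all
  then have "lu x \<Zsemi> (vinv (lu x) \<Zsemi> (e \<star> k) \<Zsemi> ru x) = lu x \<Zsemi> idl x"
    by simp
  then have "companion f x k e"
    by (simp add: companion_def)
  then show ?thesis by blast
qed

lemma conjoint_ex:
  assumes f [simp]: "f \<in> Ti"
  shows "\<exists>x k e. conjoint f x k e"
proof -
  let ?I = "tdom f" and ?J = "tcod f"
  obtain k where ca: "cartesian k" and k [simp]: "k \<in> Cell" "cd k = li ?J" "sd k = idt ?J" "td k = f"
    by (rule cartesian_lift [of "li ?J" "idt ?J" f]) simp_all
  define x where "x = dm k"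
  have x [simp]: "dm k = x" "x \<in> Lo" "so x = ?J" "to x = ?I"
    using src.farr_simps(2) [of k] tgt.farr_simps(2) [of k] by (simp_all add: x_def)
  obtain e where e [simp]: "e \<in> Cell" "dm e = li ?I" "cd e = x" "sd e = f" "td e = idt ?I" "e \<Zsemi> k = un f"
    by (rule cartesian_factor [OF ca, of "un f" f "idt ?I"]) simp_all
  have "vinv (ru x) \<Zsemi> (k \<star> e) \<Zsemi> lu x = idl x"
  proof (rule cartesian_eq [OF ca])
    have "(k \<star> e) \<Zsemi> lu x \<Zsemi> k = (k \<star> e) \<Zsemi> (idl (li ?J) \<star> k) \<Zsemi> lu (li ?J)"
      by (simp add: lu_natural_globular)
    also have "\<dots> = ru x \<Zsemi> k"
      by (simp add: merge ru_natural lu_li)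
    finally show "(vinv (ru x) \<Zsemi> (k \<star> e) \<Zsemi> lu x) \<Zsemi> k = idl x \<Zsemi> k"
      by simp
  qed simp_all
  then have "ru x \<Zsemi> (vinv (ru x) \<Zsemi> (k \<star> e) \<Zsemi> lu x) = ru x \<Zsemi> idl x"
    by simp
  then have "conjoint f x k e"
    by (simp add: conjoint_def)
  then show ?thesis by blast
qed

definition "cmp f = (SOME x. \<exists>k e. companion f x k e)"
definition "cmpK f = (SOME k. \<exists>e. companion f (cmp f) k e)"
definition "cmpE f = (SOME e. companion f (cmp f) (cmpK f) e)"
definition "cnj f = (SOME x. \<exists>k e. conjoint f x k e)"
definition "cnjK f = (SOME k. \<exists>e. conjoint f (cnj f) k e)"
definition "cnjE f = (SOME e. conjoint f (cnj f) (cnjK f) e)"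

lemma companion_cmp: "f \<in> Ti \<Longrightarrow> companion f (cmp f) (cmpK f) (cmpE f)"
  unfolding cmpE_def by (rule someI_ex, unfold cmpK_def, rule someI_ex, unfold cmp_def,
      rule someI_ex, rule companion_ex)

lemma conjoint_cnj: "f \<in> Ti \<Longrightarrow> conjoint f (cnj f) (cnjK f) (cnjE f)"
  unfolding cnjE_def by (rule someI_ex, unfold cnjK_def, rule someI_ex, unfold cnj_def,
      rule someI_ex, rule conjoint_ex)

lemma cmp_simps [simp]:
  assumes "f \<in> Ti"
  shows "cmp f \<in> Lo" "so (cmp f) = tdom f" "to (cmp f) = tcod f"
    "cmpK f \<in> Cell" "dm (cmpK f) = cmp f" "cd (cmpK f) = li (tcod f)" "sd (cmpK f) = f"
    "td (cmpK f) = idt (tcod f)" "cmpE f \<in> Cell" "dm (cmpE f) = li (tdom f)"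
    "cd (cmpE f) = cmp f" "sd (cmpE f) = idt (tdom f)" "td (cmpE f) = f"
    "cmpE f \<Zsemi> cmpK f = un f"
  using companion_cmp [OF assms] by (simp_all add: companion_def)

lemma cnj_simps [simp]:
  assumes "f \<in> Ti"
  shows "cnj f \<in> Lo" "so (cnj f) = tcod f" "to (cnj f) = tdom f"
    "cnjK f \<in> Cell" "dm (cnjK f) = cnj f" "cd (cnjK f) = li (tcod f)" "sd (cnjK f) = idt (tcod f)"
    "td (cnjK f) = f" "cnjE f \<in> Cell" "dm (cnjE f) = li (tdom f)"
    "cd (cnjE f) = cnj f" "sd (cnjE f) = f" "td (cnjE f) = idt (tdom f)"
    "cnjE f \<Zsemi> cnjK f = un f"
  using conjoint_cnj [OF assms] by (simp_all add: conjoint_def)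

lemma cnj_cancel [simp]:
  assumes "f \<in> Ti" "z \<in> Cell" "dm z = li (tcod f)"
  shows "cnjE f \<Zsemi> cnjK f \<Zsemi> z = un f \<Zsemi> z"
  using assms by (auto simp flip: src.A.Comp_assoc_Arr)

lemma cmp_zigzag: "f \<in> Ti \<Longrightarrow> (cmpE f \<star> cmpK f) \<Zsemi> ru (cmp f) = lu (cmp f)"
  using companion_cmp [of f] by (simp add: companion_def)

lemma cnj_zigzag: "f \<in> Ti \<Longrightarrow> (cnjK f \<star> cnjE f) \<Zsemi> lu (cnj f) = ru (cnj f)"
  using conjoint_cnj [of f] by (simp add: conjoint_def)

text \<open>Unit and counit of the adjunction between companion and conjoint: binding cells placed
  side by side, with a unitor splitting or merging the unit loose arrow.\<close>

definition "cunit f = vinv (lu (li (tdom f))) \<Zsemi> (cmpE f \<star> cnjE f)"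
definition "ccounit f = (cnjK f \<star> cmpK f) \<Zsemi> lu (li (tcod f))"

lemma cunit_simps [simp]:
  assumes "f \<in> Ti"
  shows "cunit f \<in> Cell" "dm (cunit f) = li (tdom f)" "cd (cunit f) = cmp f \<odot> cnj f"
    "sd (cunit f) = idt (tdom f)" "td (cunit f) = idt (tdom f)"
    "ccounit f \<in> Cell" "dm (ccounit f) = cnj f \<odot> cmp f" "cd (ccounit f) = li (tcod f)"
    "sd (ccounit f) = idt (tcod f)" "td (ccounit f) = idt (tcod f)"
  using assms by (simp_all add: cunit_def ccounit_def)

text \<open>In each triangle composite interchange brings the binding cells of one kind together
  vertically, where they collapse to \<open>un f\<close> and are absorbed by a unitor. What remains
  is the zigzag identity of the other kind: \<open>cmp_zigzag\<close> for the first triangle,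
  \<open>cnj_zigzag\<close> for the second.\<close>

lemma adjunction_cmp_cnj:
  assumes f [simp]: "f \<in> Ti"
  shows "adjunction LB (cmp f) (cnj f) (cunit f) (ccounit f)"
proof -
  let ?I = "tdom f" and ?J = "tcod f"
  let ?x = "cmp f" and ?y = "cnj f"
  have "(cunit f \<star> idl ?x) \<Zsemi> as ?x ?y ?x \<Zsemi> (idl ?x \<star> ccounit f) \<Zsemi> ru ?x =
    (vinv (lu (li ?I)) \<star> idl ?x) \<Zsemi> ((cmpE f \<star> cnjE f) \<star> idl ?x) \<Zsemi> as ?x ?y ?x \<Zsemi> (idl ?x \<star> ccounit f) \<Zsemi> ru ?x"
    by (simp add: cunit_def merge)
  also have "\<dots> = (vinv (lu (li ?I)) \<star> idl ?x) \<Zsemi> as (li ?I) (li ?I) ?x \<Zsemi>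
    (cmpE f \<star> ((un f \<star> cmpK f) \<Zsemi> lu (li ?J))) \<Zsemi> ru ?x"
    by (simp add: natural ccounit_def merge)
  also have "\<dots> = (vinv (lu (li ?I)) \<star> idl ?x) \<Zsemi> as (li ?I) (li ?I) ?x \<Zsemi>
    (idl (li ?I) \<star> lu ?x) \<Zsemi> (cmpE f \<star> cmpK f) \<Zsemi> ru ?x"
    by (simp add: lu_natural merge)
  also have "\<dots> = (vinv (lu (li ?I)) \<star> idl ?x) \<Zsemi> (as (li ?I) (li ?I) ?x \<Zsemi>
    (idl (li ?I) \<star> lu ?x)) \<Zsemi> (cmpE f \<star> cmpK f) \<Zsemi> ru ?x"
    by simp
  also have "\<dots> = (cmpE f \<star> cmpK f) \<Zsemi> ru ?x"
    unfolding triangle' [of "li ?I" ?x ?I, simplified] by (simp add: merge lu_li)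
  finally have 1: "(cunit f \<star> idl ?x) \<Zsemi> as ?x ?y ?x \<Zsemi> (idl ?x \<star> ccounit f) \<Zsemi> ru ?x = lu ?x"
    by (simp add: cmp_zigzag)
  have "(idl ?y \<star> cunit f) \<Zsemi> vinv (as ?y ?x ?y) \<Zsemi> (ccounit f \<star> idl ?y) \<Zsemi> lu ?y =
    (idl ?y \<star> vinv (lu (li ?I))) \<Zsemi> (idl ?y \<star> (cmpE f \<star> cnjE f)) \<Zsemi> vinv (as ?y ?x ?y) \<Zsemi>
      (ccounit f \<star> idl ?y) \<Zsemi> lu ?y"
    by (simp add: cunit_def merge)
  also have "\<dots> = (idl ?y \<star> vinv (lu (li ?I))) \<Zsemi> vinv (as ?y (li ?I) (li ?I)) \<Zsemi>
    (((cnjK f \<star> un f) \<Zsemi> lu (li ?J)) \<star> cnjE f) \<Zsemi> lu ?y"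
    by (simp add: inv_as_natural_assoc ccounit_def merge)
  also have "\<dots> = (idl ?y \<star> vinv (lu (li ?I))) \<Zsemi> vinv (as ?y (li ?I) (li ?I)) \<Zsemi>
    (ru ?y \<star> idl (li ?I)) \<Zsemi> (cnjK f \<star> cnjE f) \<Zsemi> lu ?y"
    by (simp add: natural merge lu_li)
  also have "\<dots> = (idl ?y \<star> vinv (lu (li ?I))) \<Zsemi> vinv (as ?y (li ?I) (li ?I)) \<Zsemi>
    (as ?y (li ?I) (li ?I) \<Zsemi> (idl ?y \<star> lu (li ?I))) \<Zsemi> (cnjK f \<star> cnjE f) \<Zsemi> lu ?y"
    by (subst triangle' [of ?y "li ?I" ?I]) simp_all
  also have "\<dots> = (cnjK f \<star> cnjE f) \<Zsemi> lu ?y"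
    by (simp add: merge)
  finally have 2: "(idl ?y \<star> cunit f) \<Zsemi> vinv (as ?y ?x ?y) \<Zsemi> (ccounit f \<star> idl ?y) \<Zsemi> lu ?y = ru ?y"
    by (simp add: cnj_zigzag)
  show ?thesis
    using arg_cong [OF 1, of "\<lambda>x. vinv (lu ?x) \<Zsemi> x"] arg_cong [OF 2, of "\<lambda>x. vinv (ru ?y) \<Zsemi> x"]
    by (simp add: adjunction_def hom_cells_LB)
qed

subsection \<open>Restrictions and extensions\<close>

text \<open>\<open>restl f A\<close> and \<open>restr f A\<close> restrict a loose arrow along a tight arrow at its source and
  target; \<open>liftl\<close> and \<open>liftr\<close> are the corresponding factorizations.  Dually, \<open>extr f A\<close> and
  \<open>extl f A\<close> extend a loose arrow, with factorizations \<open>downr\<close> and \<open>downl\<close>.\<close>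

definition "restl f A = (cmpK f \<star> idl A) \<Zsemi> lu A"
definition "restr f A = (idl A \<star> cnjK f) \<Zsemi> ru A"
definition "extr f A = vinv (ru A) \<Zsemi> (idl A \<star> cmpE f)"
definition "extl f A = vinv (lu A) \<Zsemi> (cnjE f \<star> idl A)"
definition "liftl f c = vinv (lu (dm c)) \<Zsemi> (cmpE f \<star> c)"
definition "liftr f c = vinv (ru (dm c)) \<Zsemi> (c \<star> cnjE f)"
definition "downr f c = (c \<star> cmpK f) \<Zsemi> ru (cd c)"
definition "downl f c = (cnjK f \<star> c) \<Zsemi> lu (cd c)"

lemma tsides: "a \<in> Cell \<Longrightarrow> sd a = f \<Longrightarrow> so (dm a) = tdom f \<and> so (cd a) = tcod f"
  "a \<in> Cell \<Longrightarrow> td a = f \<Longrightarrow> to (dm a) = tdom f \<and> to (cd a) = tcod f"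
  by auto

lemma restl_simps [simp]:
  assumes "f \<in> Ti" "A \<in> Lo" "so A = tcod f"
  shows "restl f A \<in> Cell" "dm (restl f A) = cmp f \<odot> A" "cd (restl f A) = A" "sd (restl f A) = f"
    "td (restl f A) = idt (to A)"
  using assms by (simp_all add: restl_def)

lemma restr_simps [simp]:
  assumes "f \<in> Ti" "A \<in> Lo" "to A = tcod f"
  shows "restr f A \<in> Cell" "dm (restr f A) = A \<odot> cnj f" "cd (restr f A) = A" "sd (restr f A) = idt (so A)"
    "td (restr f A) = f"
  using assms by (simp_all add: restr_def)

lemma extr_simps [simp]:
  assumes "f \<in> Ti" "A \<in> Lo" "to A = tdom f"
  shows "extr f A \<in> Cell" "dm (extr f A) = A" "cd (extr f A) = A \<odot> cmp f" "sd (extr f A) = idt (so A)"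
    "td (extr f A) = f"
  using assms by (simp_all add: extr_def)

lemma extl_simps [simp]:
  assumes "f \<in> Ti" "A \<in> Lo" "so A = tdom f"
  shows "extl f A \<in> Cell" "dm (extl f A) = A" "cd (extl f A) = cnj f \<odot> A" "sd (extl f A) = f"
    "td (extl f A) = idt (to A)"
  using assms by (simp_all add: extl_def)

lemma liftl_simps [simp]:
  assumes "f \<in> Ti" "c \<in> Cell" "sd c = f"
  shows "liftl f c \<in> Cell" "dm (liftl f c) = dm c" "cd (liftl f c) = cmp f \<odot> cd c"
    "sd (liftl f c) = idt (tdom f)" "td (liftl f c) = td c"
  using assms tsides(1) [OF assms(2,3)] by (simp_all add: liftl_def)

lemma liftr_simps [simp]:
  assumes "f \<in> Ti" "c \<in> Cell" "td c = f"
  shows "liftr f c \<in> Cell" "dm (liftr f c) = dm c" "cd (liftr f c) = cd c \<odot> cnj f"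
    "td (liftr f c) = idt (tdom f)" "sd (liftr f c) = sd c"
  using assms tsides(2) [OF assms(2,3)] by (simp_all add: liftr_def)

lemma downr_simps [simp]:
  assumes "f \<in> Ti" "c \<in> Cell" "td c = f"
  shows "downr f c \<in> Cell" "dm (downr f c) = dm c \<odot> cmp f" "cd (downr f c) = cd c"
    "td (downr f c) = idt (tcod f)" "sd (downr f c) = sd c"
  using assms tsides(2) [OF assms(2,3)] by (simp_all add: downr_def)

lemma downl_simps [simp]:
  assumes "f \<in> Ti" "c \<in> Cell" "sd c = f"
  shows "downl f c \<in> Cell" "dm (downl f c) = cnj f \<odot> dm c" "cd (downl f c) = cd c"
    "sd (downl f c) = idt (tcod f)" "td (downl f c) = td c"
  using assms tsides(1) [OF assms(2,3)] by (simp_all add: downl_def)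

lemma liftl_restl:
  assumes "f \<in> Ti" "c \<in> Cell" "sd c = f" "cd c = A"
  shows "liftl f c \<Zsemi> restl f A = c"
proof -
  have "so A = tcod f" "so (dm c) = tdom f" "A \<in> Lo"
    using tsides(1) [OF assms(2,3)] assms(2,4) by auto
  then show ?thesis
    using assms by (simp add: liftl_def restl_def merge lu_natural)
qed

lemma liftr_restr:
  assumes "f \<in> Ti" "c \<in> Cell" "td c = f" "cd c = A"
  shows "liftr f c \<Zsemi> restr f A = c"
proof -
  have "to A = tcod f" "to (dm c) = tdom f" "A \<in> Lo"
    using tsides(2) [OF assms(2,3)] assms(2,4) by auto
  then show ?thesis
    using assms by (simp add: liftr_def restr_def merge ru_natural)
qed

lemma extr_downr:
  assumes "f \<in> Ti" "c \<in> Cell" "td c = f" "dm c = A"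
  shows "extr f A \<Zsemi> downr f c = c"
proof -
  have "to (cd c) = tcod f" "to A = tdom f" "A \<in> Lo"
    using tsides(2) [OF assms(2,3)] assms(2,4) by auto
  then show ?thesis
    using assms by (simp add: downr_def extr_def merge ru_natural)
qed

lemma extl_downl:
  assumes "f \<in> Ti" "c \<in> Cell" "sd c = f" "dm c = A"
  shows "extl f A \<Zsemi> downl f c = c"
proof -
  have "so (cd c) = tcod f" "so A = tdom f" "A \<in> Lo"
    using tsides(1) [OF assms(2,3)] assms(2,4) by auto
  then show ?thesis
    using assms by (simp add: downl_def extl_def merge lu_natural)
qed

text \<open>The companion zigzag whiskered with \<open>A\<close>. Placing \<open>cmpE f\<close> on
  the left undoes the restriction cell up to a unitor, which is the source of uniqueness in
  \<open>restl_eq\<close>.\<close>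

lemma cmpE_restl:
  assumes [simp]: "f \<in> Ti" "A \<in> Lo" "so A = tcod f"
  shows "cmpE f \<star> restl f A = lu (cmp f \<odot> A)"
proof -
  let ?I = "tdom f"
  have "as (li ?I) (cmp f) A \<Zsemi> (cmpE f \<star> restl f A) =
    (as (li ?I) (cmp f) A \<Zsemi> (cmpE f \<star> (cmpK f \<star> idl A))) \<Zsemi> (idl (cmp f) \<star> lu A)"
    by (simp add: merge restl_def)
  also have "\<dots> = ((cmpE f \<star> cmpK f) \<star> idl A) \<Zsemi> as (cmp f) (li (tcod f)) A \<Zsemi> (idl (cmp f) \<star> lu A)"
    by (simp add: as_natural_assoc)
  also have "\<dots> = as (li ?I) (cmp f) A \<Zsemi> lu (cmp f \<odot> A)"
    by (simp add: triangle' as_lu merge cmp_zigzag)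
  finally show ?thesis
    by - (rule src.A.invertible_cancel_left [of "as (li ?I) (cmp f) A"], simp_all)
qed

lemma restr_cnjE:
  assumes [simp]: "f \<in> Ti" "A \<in> Lo" "to A = tcod f"
  shows "restr f A \<star> cnjE f = ru (A \<odot> cnj f)"
proof -
  let ?I = "tdom f" and ?J = "tcod f"
  have "restr f A \<star> cnjE f = ((idl A \<star> cnjK f) \<star> cnjE f) \<Zsemi> (ru A \<star> idl (cnj f))"
    by (simp add: merge restr_def)
  also have "\<dots> = ((idl A \<star> cnjK f) \<star> cnjE f) \<Zsemi> as A (li ?J) (cnj f) \<Zsemi> (idl A \<star> lu (cnj f))"
    by (simp add: triangle')
  also have "\<dots> = as A (cnj f) (li ?I) \<Zsemi> (idl A \<star> ru (cnj f))"
    by (simp add: as_natural_assoc merge cnj_zigzag)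
  also have "\<dots> = ru (A \<odot> cnj f)"
    by (simp add: as_ru)
  finally show ?thesis .
qed

text \<open>The left side is \<open>downr f\<close> applied to the extension cell; that it is an
  identity lets a cell out of an extension be recovered from its composite with
  \<open>extr f A\<close>.\<close>

lemma extr_cmpK:
  assumes [simp]: "f \<in> Ti" "A \<in> Lo" "to A = tdom f"
  shows "(extr f A \<star> cmpK f) \<Zsemi> ru (A \<odot> cmp f) = idl (A \<odot> cmp f)"
proof -
  let ?I = "tdom f" and ?J = "tcod f"
  have "(extr f A \<star> cmpK f) \<Zsemi> ru (A \<odot> cmp f) =
    (vinv (ru A) \<star> idl (cmp f)) \<Zsemi> ((idl A \<star> cmpE f) \<star> cmpK f) \<Zsemi> ru (A \<odot> cmp f)"
    by (simp add: merge extr_def)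
  also have "\<dots> = (vinv (ru A) \<star> idl (cmp f)) \<Zsemi> as A (li ?I) (cmp f) \<Zsemi> (idl A \<star> (cmpE f \<star> cmpK f)) \<Zsemi>
      (idl A \<star> ru (cmp f))"
    by (simp add: as_natural_assoc flip: as_ru)
  also have "\<dots> = (vinv (ru A) \<star> idl (cmp f)) \<Zsemi> as A (li ?I) (cmp f) \<Zsemi> (idl A \<star> lu (cmp f))"
    by (simp add: merge cmp_zigzag)
  also have "\<dots> = idl (A \<odot> cmp f)"
    by (simp add: triangle' merge)
  finally show ?thesis .
qed

lemma cnjK_extl:
  assumes [simp]: "f \<in> Ti" "A \<in> Lo" "so A = tdom f"
  shows "(cnjK f \<star> extl f A) \<Zsemi> lu (cnj f \<odot> A) = idl (cnj f \<odot> A)"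
proof -
  let ?I = "tdom f" and ?J = "tcod f"
  have "as (cnj f) (li ?I) A \<Zsemi> (cnjK f \<star> (cnjE f \<star> idl A)) \<Zsemi> lu (cnj f \<odot> A) =
    ((cnjK f \<star> cnjE f) \<star> idl A) \<Zsemi> as (li ?J) (cnj f) A \<Zsemi> lu (cnj f \<odot> A)"
    by (simp add: as_natural_assoc)
  also have "\<dots> = as (cnj f) (li ?I) A \<Zsemi> (idl (cnj f) \<star> lu A)"
    by (simp add: as_lu merge cnj_zigzag triangle')
  finally have "(cnjK f \<star> (cnjE f \<star> idl A)) \<Zsemi> lu (cnj f \<odot> A) = idl (cnj f) \<star> lu A"
    by - (rule src.A.invertible_cancel_left [of "as (cnj f) (li ?I) A"], simp_all)
  then have "(idl (cnj f) \<star> vinv (lu A)) \<Zsemi> (cnjK f \<star> (cnjE f \<star> idl A)) \<Zsemi> lu (cnj f \<odot> A) =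
      (idl (cnj f) \<star> vinv (lu A)) \<Zsemi> (idl (cnj f) \<star> lu A)"
    by simp
  then show ?thesis
    by (simp add: extl_def merge)
qed

text \<open>The restriction cell is monic on cells with identity source side: composing
  \<open>cmpE f\<close> horizontally with \<open>u \<Zsemi> restl f A\<close> returns
  \<open>u\<close> up to a unitor.\<close>

lemma restl_eq:
  assumes u: "u \<in> Cell" "sd u = idt (tdom f)" "cd u = cmp f \<odot> A"
    and v: "v \<in> Cell" "sd v = idt (tdom f)" "cd v = cmp f \<odot> A"
    and f: "f \<in> Ti" "A \<in> Lo" "so A = tcod f"
    and eq: "dm u = dm v" "u \<Zsemi> restl f A = v \<Zsemi> restl f A"
  shows "u = v"
proof -
  have *: "cmpE f \<star> (u \<Zsemi> restl f A) = lu (dm u) \<Zsemi> u"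
    if "u \<in> Cell" "sd u = idt (tdom f)" "cd u = cmp f \<odot> A" for u
  proof -
    have "cmpE f \<star> (u \<Zsemi> restl f A) = (idl (li (tdom f)) \<star> u) \<Zsemi> (cmpE f \<star> restl f A)"
      using that f by (simp add: merge)
    also have "\<dots> = lu (dm u) \<Zsemi> u"
      using that f by (simp add: cmpE_restl lu_natural_globular)
    finally show ?thesis .
  qed
  have "lu (dm u) \<Zsemi> u = lu (dm u) \<Zsemi> v"
    using * [OF u] * [OF v] eq by simp
  then show ?thesis
    using u v eq(1) by - (rule src.A.invertible_cancel_left [of "lu (dm u)"], simp_all)
qed

lemma restr_eq:
  assumes u: "u \<in> Cell" "td u = idt (tdom f)" "cd u = A \<odot> cnj f"
    and v: "v \<in> Cell" "td v = idt (tdom f)" "cd v = A \<odot> cnj f"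
    and f: "f \<in> Ti" "A \<in> Lo" "to A = tcod f"
    and eq: "dm u = dm v" "u \<Zsemi> restr f A = v \<Zsemi> restr f A"
  shows "u = v"
proof -
  have *: "(u \<Zsemi> restr f A) \<star> cnjE f = ru (dm u) \<Zsemi> u"
    if "u \<in> Cell" "td u = idt (tdom f)" "cd u = A \<odot> cnj f" for u
  proof -
    have "(u \<Zsemi> restr f A) \<star> cnjE f = (u \<star> idl (li (tdom f))) \<Zsemi> (restr f A \<star> cnjE f)"
      using that f by (simp add: merge)
    also have "\<dots> = ru (dm u) \<Zsemi> u"
      using that f by (simp add: restr_cnjE ru_natural_globular)
    finally show ?thesis .
  qed
  have "ru (dm u) \<Zsemi> u = ru (dm u) \<Zsemi> v"
    using * [OF u] * [OF v] eq by simp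
  then show ?thesis
    using u v eq(1) by - (rule src.A.invertible_cancel_left [of "ru (dm u)"], simp_all)
qed

text \<open>Extension cells are epic for cells with identity target side: \<open>downr f\<close> is
  a left inverse of precomposition with \<open>extr f A\<close>.\<close>

lemma extr_eq:
  assumes u: "u \<in> Cell" "td u = idt (tcod f)" "dm u = A \<odot> cmp f"
    and v: "v \<in> Cell" "td v = idt (tcod f)" "dm v = A \<odot> cmp f"
    and f: "f \<in> Ti" "A \<in> Lo" "to A = tdom f"
    and eq: "cd u = cd v" "extr f A \<Zsemi> u = extr f A \<Zsemi> v"
  shows "u = v"
proof -
  have *: "downr f (extr f A \<Zsemi> u) = u"
    if "u \<in> Cell" "td u = idt (tcod f)" "dm u = A \<odot> cmp f" for u
  proof -
    have "downr f (extr f A \<Zsemi> u) = (extr f A \<star> cmpK f) \<Zsemi> (u \<star> idl (li (tcod f))) \<Zsemi> ru (cd u)"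
      using that f tsides(2) [OF that(1,2)] by (simp add: merge downr_def)
    also have "\<dots> = ((extr f A \<star> cmpK f) \<Zsemi> ru (A \<odot> cmp f)) \<Zsemi> u"
      using that f by (simp add: ru_natural_globular)
    also have "\<dots> = u"
      using that f by (simp add: extr_cmpK del: src.A.Comp_assoc_Arr)
    finally show ?thesis .
  qed
  show ?thesis
    using * [OF u] * [OF v] eq(2) by metis
qed

lemma extl_eq:
  assumes u: "u \<in> Cell" "sd u = idt (tcod f)" "dm u = cnj f \<odot> A"
    and v: "v \<in> Cell" "sd v = idt (tcod f)" "dm v = cnj f \<odot> A"
    and f: "f \<in> Ti" "A \<in> Lo" "so A = tdom f"
    and eq: "cd u = cd v" "extl f A \<Zsemi> u = extl f A \<Zsemi> v"
  shows "u = v"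
proof -
  have *: "downl f (extl f A \<Zsemi> u) = u"
    if "u \<in> Cell" "sd u = idt (tcod f)" "dm u = cnj f \<odot> A" for u
  proof -
    have "downl f (extl f A \<Zsemi> u) = (cnjK f \<star> extl f A) \<Zsemi> (idl (li (tcod f)) \<star> u) \<Zsemi> lu (cd u)"
      using that f tsides(1) [OF that(1,2)] by (simp add: merge downl_def)
    also have "\<dots> = ((cnjK f \<star> extl f A) \<Zsemi> lu (cnj f \<odot> A)) \<Zsemi> u"
      using that f by (simp add: lu_natural_globular)
    also have "\<dots> = u"
      using that f by (simp add: cnjK_extl del: src.A.Comp_assoc_Arr)
    finally show ?thesis .
  qed
  show ?thesis
    using * [OF u] * [OF v] eq(2) by metis
qed

text \<open>Restriction on both sides at once; the domain has the bracketing of the legs of the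
  tensor.\<close>

definition "rest f A g = (restl f A \<star> cnjK g) \<Zsemi> ru A"

lemma rest_simps [simp]:
  assumes "f \<in> Ti" "g \<in> Ti" "A \<in> Lo" "so A = tcod f" "to A = tcod g"
  shows "rest f A g \<in> Cell" "dm (rest f A g) = (cmp f \<odot> A) \<odot> cnj g" "cd (rest f A g) = A" "sd (rest f A g) = f"
    "td (rest f A g) = g"
  using assms by (simp_all add: rest_def)

lemma rest_alt:
  assumes "f \<in> Ti" "g \<in> Ti" "A \<in> Lo" "so A = tcod f" "to A = tcod g"
  shows "restr g (cmp f \<odot> A) \<Zsemi> restl f A = rest f A g"
proof -
  have "ru (cmp f \<odot> A) \<Zsemi> restl f A = (restl f A \<star> idl (li (tcod g))) \<Zsemi> ru A"
    using assms by (simp add: ru_natural_globular)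
  then show ?thesis
    using assms by (simp add: restr_def rest_def merge)
qed

lemma liftr_liftl_rest:
  assumes "f \<in> Ti" "g \<in> Ti" "c \<in> Cell" "sd c = f" "td c = g" "cd c = A"
  shows "liftr g (liftl f c) \<Zsemi> rest f A g = c"
proof -
  have "A \<in> Lo" "so A = tcod f" "to A = tcod g"
    using assms tsides [OF assms(3)] by auto
  then have "liftr g (liftl f c) \<Zsemi> rest f A g =
      (liftr g (liftl f c) \<Zsemi> restr g (cmp f \<odot> A)) \<Zsemi> restl f A"
    using assms by (simp flip: rest_alt)
  then show ?thesis
    using assms by (simp add: liftr_restr liftl_restl)
qed

lemma rest_eq:
  assumes u: "u \<in> Cell" "sd u = idt (tdom f)" "td u = idt (tdom g)" "cd u = (cmp f \<odot> A) \<odot> cnj g"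
    and v: "v \<in> Cell" "sd v = idt (tdom f)" "td v = idt (tdom g)" "cd v = (cmp f \<odot> A) \<odot> cnj g"
    and f: "f \<in> Ti" "g \<in> Ti" "A \<in> Lo" "so A = tcod f" "to A = tcod g"
    and eq: "dm u = dm v" "u \<Zsemi> rest f A g = v \<Zsemi> rest f A g"
  shows "u = v"
proof (rule restr_eq [where f = g and A = "cmp f \<odot> A"])
  show "u \<Zsemi> restr g (cmp f \<odot> A) = v \<Zsemi> restr g (cmp f \<odot> A)"
    by (rule restl_eq [where f = f and A = A]) (use assms in \<open>simp_all add: rest_alt\<close>)
qed (use assms in simp_all)

text \<open>Whiskering with a companion and a conjoint is the action of restriction on globular
  cells. This evaluates the tensor on 2-cells.\<close>

lemma rest_natural:
  assumes "f \<in> Ti" "g \<in> Ti" "a \<in> Cell" "dm a = A" "cd a = B"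
    "sd a = idt (tcod f)" "td a = idt (tcod g)"
  shows "((idl (cmp f) \<star> a) \<star> idl (cnj g)) \<Zsemi> rest f B g = rest f A g \<Zsemi> a"
proof -
  have [simp]: "A \<in> Lo" "so A = tcod f" "to A = tcod g"
     "B \<in> Lo" "so B = tcod f" "to B = tcod g"
    using assms src.B.Ident_simps [of "tcod f"] src.B.Ident_simps [of "tcod g"]
      tsides(1) [OF assms(3,6)] tsides(2) [OF assms(3,7)] by auto
  have "(idl (cmp f) \<star> a) \<Zsemi> restl f B = (cmpK f \<star> idl A) \<Zsemi> (idl (li (tcod f)) \<star> a) \<Zsemi> lu B"
    using assms by (simp add: restl_def merge)
  also have "\<dots> = restl f A \<Zsemi> a"
    using assms by (simp add: restl_def lu_natural_globular)
  finally have 1: "(idl (cmp f) \<star> a) \<Zsemi> restl f B = restl f A \<Zsemi> a" .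
  have "((idl (cmp f) \<star> a) \<star> idl (cnj g)) \<Zsemi> rest f B g =
      (restl f A \<star> cnjK g) \<Zsemi> (a \<star> idl (li (tcod g))) \<Zsemi> ru B"
    using assms 1 by (simp add: rest_def merge)
  also have "\<dots> = rest f A g \<Zsemi> a"
    using assms by (simp add: ru_natural_globular rest_def)
  finally show ?thesis .
qed

text \<open>Restriction at the source touches only the first factor, by naturality of the associator
  and \<open>as_lu\<close>.\<close>

lemma as_restl:
  assumes "f \<in> Ti" "A \<in> Lo" "B \<in> Lo" "so A = tcod f" "to A = so B"
  shows "as (cmp f) A B \<Zsemi> restl f (A \<odot> B) = restl f A \<star> idl B"
proof -
  have "as (cmp f) A B \<Zsemi> restl f (A \<odot> B) =
    as (cmp f) A B \<Zsemi> (cmpK f \<star> (idl A \<star> idl B)) \<Zsemi> lu (A \<odot> B)"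
    using assms by (simp add: restl_def)
  also have "\<dots> = ((cmpK f \<star> idl A) \<star> idl B) \<Zsemi> as (li (tcod f)) A B \<Zsemi> lu (A \<odot> B)"
    using assms by (simp add: as_natural_assoc del: ccomp_idl)
  also have "\<dots> = restl f A \<star> idl B"
    using assms by (simp add: as_lu merge restl_def)
  finally show ?thesis .
qed

text \<open>The first factor is the cell from which the lax unit of the tensor is paired, the second
  the restriction cell of a leg. In both horizontal factors the binding cells cancel vertically,
  leaving a unit cell.\<close>

lemma unit_contract:
  assumes [simp]: "f \<in> Ti"
  shows "(cunit f \<Zsemi> (vinv (ru (cmp f)) \<star> idl (cnj f))) \<Zsemi> rest f (li (tcod f)) f = un f"
proof -
  let ?J = "tcod f"
  have "restl f (li ?J) = ru (cmp f) \<Zsemi> cmpK f"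
    by (simp add: restl_def lu_li ru_natural_globular)
  then have "(cunit f \<Zsemi> (vinv (ru (cmp f)) \<star> idl (cnj f))) \<Zsemi> rest f (li ?J) f =
    vinv (lu (li (tdom f))) \<Zsemi> (un f \<star> un f) \<Zsemi> ru (li ?J)"
    by (simp add: cunit_def rest_def merge)
  also have "\<dots> = un f"
    by (simp add: ru_natural lu_li)
  finally show ?thesis .
qed

lemma lu_li_ccomp:
  assumes "A \<in> Lo" "so A = I"
  shows "lu (li I) \<star> idl A = as (li I) (li I) A \<Zsemi> (idl (li I) \<star> lu A)"
  using assms src.fobj_Obj [of A] by (simp add: triangle' lu_li)

text \<open>With this identity, the lax functor axioms of the tensor reduce to naturality of its projections.\<close>

lemma contract_rest:
  assumes [simp]: "f \<in> Ti" "g \<in> Ti" "h \<in> Ti" "A \<in> Lo" "B \<in> Lo" "so A = tcod f"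
    "to A = tcod g" "so B = tcod g" "to B = tcod h"
  shows "contract LB (ccounit g) (cmp f) A (cnj g) (cmp g) B (cnj h) \<Zsemi> rest f (A \<odot> B) h =
    rest f A g \<star> rest g B h"
proof -
  let ?J = "tcod g"
  let ?x = "cmp f \<odot> A" and ?y = "cnj g" and ?z = "cmp g"
  \<comment> \<open>\<open>E\<close> contracts \<open>cnj g \<odot> (cmp g \<odot> B)\<close> to
    \<open>B\<close> along the counit, and \<open>F\<close> below is the content of
    \<open>contract\<close> before \<open>cnj h\<close> is attached. Computing \<open>E\<close>
    first dissolves the counit into its two binding cells.\<close>
  define E where "E = vinv (as ?y ?z B) \<Zsemi> (ccounit g \<star> idl B) \<Zsemi> lu B"
  have "E = vinv (as ?y ?z B) \<Zsemi> ((cnjK g \<star> cmpK g) \<star> idl B) \<Zsemi> (lu (li ?J) \<star> idl B) \<Zsemi> lu B"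
    by (simp add: E_def ccounit_def merge)
  also have "\<dots> = (cnjK g \<star> (cmpK g \<star> idl B)) \<Zsemi> (idl (li ?J) \<star> lu B) \<Zsemi> lu B"
    by (simp add: lu_li_ccomp as_natural_assoc)
  also have "\<dots> = (cnjK g \<star> restl g B) \<Zsemi> lu B"
    by (simp add: restl_def merge)
  finally have E: "E = (cnjK g \<star> restl g B) \<Zsemi> lu B" .
  have [simp]: "E \<in> Cell" "dm E = ?y \<odot> (?z \<odot> B)" "cd E = B" "sd E = idt ?J" "td E = idt (to B)"
    by (simp_all add: E)
  define F where "F = as ?x ?y (?z \<odot> B) \<Zsemi> (idl ?x \<star> E) \<Zsemi> as (cmp f) A B"
  have [simp]: "F \<in> Cell" "dm F = (?x \<odot> ?y) \<odot> (?z \<odot> B)" "cd F = cmp f \<odot> (A \<odot> B)"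
    "sd F = idt (tdom f)" "td F = idt (to B)"
    by (simp_all add: F_def)
  have "F \<Zsemi> restl f (A \<odot> B) = as ?x ?y (?z \<odot> B) \<Zsemi> (restl f A \<star> E)"
    by (simp add: F_def as_restl merge)
  also have "\<dots> = as ?x ?y (?z \<odot> B) \<Zsemi> (restl f A \<star> (cnjK g \<star> restl g B)) \<Zsemi> (idl A \<star> lu B)"
    by (simp add: E merge)
  also have "\<dots> = ((restl f A \<star> cnjK g) \<star> restl g B) \<Zsemi> as A (li ?J) B \<Zsemi> (idl A \<star> lu B)"
    by (simp add: as_natural_assoc)
  also have "\<dots> = rest f A g \<star> restl g B"
    by (simp add: triangle' merge rest_def)
  finally have F: "F \<Zsemi> restl f (A \<odot> B) = rest f A g \<star> restl g B" .
  have "contract LB (ccounit g) (cmp f) A (cnj g) (cmp g) B (cnj h) =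
    vinv (as (?x \<odot> ?y) (?z \<odot> B) (cnj h)) \<Zsemi> (F \<star> idl (cnj h))"
    by (simp add: contract_def F_def E_def)
  then have "contract LB (ccounit g) (cmp f) A (cnj g) (cmp g) B (cnj h) \<Zsemi> rest f (A \<odot> B) h =
    vinv (as (?x \<odot> ?y) (?z \<odot> B) (cnj h)) \<Zsemi> ((rest f A g \<star> restl g B) \<star> cnjK h) \<Zsemi> ru (A \<odot> B)"
    by (simp add: rest_def [of f "A \<odot> B"] merge F)
  also have "\<dots> = vinv (as (?x \<odot> ?y) (?z \<odot> B) (cnj h)) \<Zsemi> ((rest f A g \<star> restl g B) \<star> cnjK h) \<Zsemi>
      as A B (li (to B)) \<Zsemi> (idl A \<star> ru B)"
    by (simp add: as_ru)
  also have "\<dots> = (rest f A g \<star> (restl g B \<star> cnjK h)) \<Zsemi> (idl A \<star> ru B)"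
    by (simp add: as_natural_assoc)
  also have "\<dots> = rest f A g \<star> rest g B h"
    by (simp add: merge rest_def [of g])
  finally show ?thesis .
qed

text \<open>Up to a right unitor, \<open>cmpK f\<close> is the restriction cell of the unit loose
  arrow, so \<open>restl_eq\<close> makes it monic too.\<close>

lemma cmpK_eq:
  assumes u: "u \<in> Cell" "sd u = idt (tdom f)" "cd u = cmp f"
    and v: "v \<in> Cell" "sd v = idt (tdom f)" "cd v = cmp f"
    and f [simp]: "f \<in> Ti"
    and eq: "dm u = dm v" "td u = td v" "u \<Zsemi> cmpK f = v \<Zsemi> cmpK f"
  shows "u = v"
proof -
  let ?J = "tcod f"
  have r: "restl f (li ?J) = ru (cmp f) \<Zsemi> cmpK f"
    by (simp add: restl_def lu_li ru_natural_globular)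
  have "u \<Zsemi> vinv (ru (cmp f)) = v \<Zsemi> vinv (ru (cmp f))"
    by (rule restl_eq [where f = f and A = "li ?J"]) (use u v eq in \<open>simp_all add: r\<close>)
  then show ?thesis
    using u v by - (rule src.A.invertible_cancel_right [of "vinv (ru (cmp f))"], simp_all)
qed

section \<open>Adjunctions between loose arrows\<close>

text \<open>The triangle composites without their leading inverse unitors. In this form a triangle
  identity compares the composite with a unitor, and both behave naturally with respect to cells
  having non-identity tight sides.\<close>

definition "tri f g \<eta> \<epsilon> = (\<eta> \<star> idl f) \<Zsemi> as f g f \<Zsemi> (idl f \<star> \<epsilon>) \<Zsemi> ru f"
definition "tri' f g \<eta> \<epsilon> = (idl g \<star> \<eta>) \<Zsemi> vinv (as g f g) \<Zsemi> (\<epsilon> \<star> idl g) \<Zsemi> lu g"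

definition adj_data :: "'c \<Rightarrow> 'c \<Rightarrow> 'd \<Rightarrow> 'd \<Rightarrow> bool" where
  "adj_data f g \<eta> \<epsilon> \<longleftrightarrow> f \<in> Lo \<and> g \<in> Lo \<and> so g = to f \<and> to g = so f \<and>
    \<eta> \<in> Cell \<and> dm \<eta> = li (so f) \<and> cd \<eta> = f \<odot> g \<and> sd \<eta> = idt (so f) \<and> td \<eta> = idt (so f) \<and>
    \<epsilon> \<in> Cell \<and> dm \<epsilon> = g \<odot> f \<and> cd \<epsilon> = li (to f) \<and> sd \<epsilon> = idt (to f) \<and> td \<epsilon> = idt (to f)"

lemma adj_dataD:
  assumes "adj_data f g \<eta> \<epsilon>"
  shows "f \<in> Lo" "g \<in> Lo" "so g = to f" "to g = so f"
    "\<eta> \<in> Cell" "dm \<eta> = li (so f)" "cd \<eta> = f \<odot> g" "sd \<eta> = idt (so f)" "td \<eta> = idt (so f)"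
    "\<epsilon> \<in> Cell" "dm \<epsilon> = g \<odot> f" "cd \<epsilon> = li (to f)" "sd \<epsilon> = idt (to f)" "td \<epsilon> = idt (to f)"
  using assms by (auto simp: adj_data_def)

lemma tri_simps:
  assumes "adj_data f g \<eta> \<epsilon>"
  shows "tri f g \<eta> \<epsilon> \<in> Cell" "dm (tri f g \<eta> \<epsilon>) = li (so f) \<odot> f" "cd (tri f g \<eta> \<epsilon>) = f"
    "sd (tri f g \<eta> \<epsilon>) = idt (so f)" "td (tri f g \<eta> \<epsilon>) = idt (to f)"
    "tri' f g \<eta> \<epsilon> \<in> Cell" "dm (tri' f g \<eta> \<epsilon>) = g \<odot> li (so f)" "cd (tri' f g \<eta> \<epsilon>) = g"
    "sd (tri' f g \<eta> \<epsilon>) = idt (to f)" "td (tri' f g \<eta> \<epsilon>) = idt (so f)"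
  using adj_dataD [OF assms] by (simp_all add: tri_def tri'_def)

lemma adjunction_LB_iff:
  "adjunction LB f g \<eta> \<epsilon> \<longleftrightarrow> adj_data f g \<eta> \<epsilon> \<and> tri f g \<eta> \<epsilon> = lu f \<and> tri' f g \<eta> \<epsilon> = ru g"
proof -
  have *: "vinv (lu f) \<Zsemi> tri f g \<eta> \<epsilon> = idl f \<longleftrightarrow> tri f g \<eta> \<epsilon> = lu f"
    "vinv (ru g) \<Zsemi> tri' f g \<eta> \<epsilon> = idl g \<longleftrightarrow> tri' f g \<eta> \<epsilon> = ru g" if "adj_data f g \<eta> \<epsilon>"
  proof -
    note [simp] = adj_dataD [OF that] tri_simps [OF that]
    show "vinv (lu f) \<Zsemi> tri f g \<eta> \<epsilon> = idl f \<longleftrightarrow> tri f g \<eta> \<epsilon> = lu f"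
      using src.A.invertible_cancel_left [of "vinv (lu f)" "tri f g \<eta> \<epsilon>" "lu f"] by fastforce
    show "vinv (ru g) \<Zsemi> tri' f g \<eta> \<epsilon> = idl g \<longleftrightarrow> tri' f g \<eta> \<epsilon> = ru g"
      using src.A.invertible_cancel_left [of "vinv (ru g)" "tri' f g \<eta> \<epsilon>" "ru g"] by fastforce
  qed
  have "adjunction LB f g \<eta> \<epsilon> \<longleftrightarrow> adj_data f g \<eta> \<epsilon> \<and> vinv (lu f) \<Zsemi> tri f g \<eta> \<epsilon> = idl f \<and>
      vinv (ru g) \<Zsemi> tri' f g \<eta> \<epsilon> = idl g"
  proof (cases "adj_data f g \<eta> \<epsilon>")
    case True
    note [simp] = adj_dataD [OF True]
    show ?thesis
      using True by (simp add: adjunction_def hom_cells_LB tri_def tri'_def)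
  next
    case False
    moreover have "\<not> adjunction LB f g \<eta> \<epsilon>"
      using False by (auto simp: adjunction_def hom_cells_LB adj_data_def)
    ultimately show ?thesis by simp
  qed
  then show ?thesis using * by auto
qed

text \<open>The triangle composites are natural along such squares, so the triangle identities transfer
  along jointly monic families of them, and along epic ones.\<close>

definition adj_mor :: "'b \<Rightarrow> 'b \<Rightarrow> 'c \<Rightarrow> 'c \<Rightarrow> 'd \<Rightarrow> 'd \<Rightarrow> 'c \<Rightarrow> 'c \<Rightarrow> 'd \<Rightarrow> 'd \<Rightarrow> 'd \<Rightarrow> 'd \<Rightarrow> bool" where
  "adj_mor s t h h' \<eta>' \<epsilon>' f g \<eta> \<epsilon> q q' \<longleftrightarrow>
    adj_data h h' \<eta>' \<epsilon>' \<and> adj_data f g \<eta> \<epsilon> \<and> s \<in> Ti \<and> t \<in> Ti \<and>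
    q \<in> Cell \<and> dm q = h \<and> cd q = f \<and> sd q = s \<and> td q = t \<and>
    q' \<in> Cell \<and> dm q' = h' \<and> cd q' = g \<and> sd q' = t \<and> td q' = s \<and>
    \<eta>' \<Zsemi> (q \<star> q') = un s \<Zsemi> \<eta> \<and> (q' \<star> q) \<Zsemi> \<epsilon> = \<epsilon>' \<Zsemi> un t"

lemma adj_morD:
  assumes "adj_mor s t h h' \<eta>' \<epsilon>' f g \<eta> \<epsilon> q q'"
  shows "adj_data h h' \<eta>' \<epsilon>'" "adj_data f g \<eta> \<epsilon>" "s \<in> Ti" "t \<in> Ti"
    "q \<in> Cell" "dm q = h" "cd q = f" "sd q = s" "td q = t"
    "q' \<in> Cell" "dm q' = h'" "cd q' = g" "sd q' = t" "td q' = s"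
    "tdom s = so h" "tcod s = so f" "tdom t = to h" "tcod t = to f"
    "\<eta>' \<Zsemi> (q \<star> q') = un s \<Zsemi> \<eta>" "(q' \<star> q) \<Zsemi> \<epsilon> = \<epsilon>' \<Zsemi> un t"
  using assms tsides [of q] unfolding adj_mor_def by auto

text \<open>The cells \<open>q\<close> and \<open>q'\<close> slide through the composite from right
  to left: past unitor and associator by naturality, past the counit and the unit by the two squares
  of \<open>adj_mor\<close>.\<close>

lemma tri_natural:
  assumes "adj_mor s t h h' \<eta>' \<epsilon>' f g \<eta> \<epsilon> q q'"
  shows "tri h h' \<eta>' \<epsilon>' \<Zsemi> q = (un s \<star> q) \<Zsemi> tri f g \<eta> \<epsilon>"
    "tri' h h' \<eta>' \<epsilon>' \<Zsemi> q' = (q' \<star> un s) \<Zsemi> tri' f g \<eta> \<epsilon>"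
proof -
  note m = adj_morD [OF assms]
  note [simp] = m(1-18) adj_dataD [OF m(1)] adj_dataD [OF m(2)]
  have "tri h h' \<eta>' \<epsilon>' \<Zsemi> q = (\<eta>' \<star> idl h) \<Zsemi> as h h' h \<Zsemi> (idl h \<star> \<epsilon>') \<Zsemi> (q \<star> un t) \<Zsemi> ru f"
    by (simp add: tri_def ru_natural)
  also have "\<dots> = (\<eta>' \<star> idl h) \<Zsemi> as h h' h \<Zsemi> (q \<star> (q' \<star> q)) \<Zsemi> (idl f \<star> \<epsilon>) \<Zsemi> ru f"
    by (simp add: merge m(20))
  also have "\<dots> = (\<eta>' \<star> idl h) \<Zsemi> ((q \<star> q') \<star> q) \<Zsemi> as f g f \<Zsemi> (idl f \<star> \<epsilon>) \<Zsemi> ru f"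
    by (simp add: as_natural_assoc)
  also have "\<dots> = (un s \<star> q) \<Zsemi> (\<eta> \<star> idl f) \<Zsemi> as f g f \<Zsemi> (idl f \<star> \<epsilon>) \<Zsemi> ru f"
    by (simp add: merge m(19))
  finally show "tri h h' \<eta>' \<epsilon>' \<Zsemi> q = (un s \<star> q) \<Zsemi> tri f g \<eta> \<epsilon>"
    by (simp add: tri_def)
  have "tri' h h' \<eta>' \<epsilon>' \<Zsemi> q' =
      (idl h' \<star> \<eta>') \<Zsemi> vinv (as h' h h') \<Zsemi> (\<epsilon>' \<star> idl h') \<Zsemi> (un t \<star> q') \<Zsemi> lu g"
    by (simp add: tri'_def lu_natural)
  also have "\<dots> = (idl h' \<star> \<eta>') \<Zsemi> vinv (as h' h h') \<Zsemi> ((q' \<star> q) \<star> q') \<Zsemi> (\<epsilon> \<star> idl g) \<Zsemi> lu g"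
    by (simp add: merge m(20))
  also have "\<dots> = (idl h' \<star> \<eta>') \<Zsemi> (q' \<star> (q \<star> q')) \<Zsemi> vinv (as g f g) \<Zsemi> (\<epsilon> \<star> idl g) \<Zsemi> lu g"
    by (simp add: inv_as_natural_assoc)
  also have "\<dots> = (q' \<star> un s) \<Zsemi> (idl g \<star> \<eta>) \<Zsemi> vinv (as g f g) \<Zsemi> (\<epsilon> \<star> idl g) \<Zsemi> lu g"
    by (simp add: merge m(19))
  finally show "tri' h h' \<eta>' \<epsilon>' \<Zsemi> q' = (q' \<star> un s) \<Zsemi> tri' f g \<eta> \<epsilon>"
    by (simp add: tri'_def)
qed

text \<open>A morphism of adjunctions with identity source side exhibits \<open>f\<close> as the
  extension of \<open>h\<close> along \<open>t\<close>. The inverse of \<open>downr t q\<close>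
  comes from transposition: the unit \<eta>' inserts \<open>h \<odot> h'\<close>, and
  \<open>h' \<odot> f\<close> is then sent to the companion of \<open>t\<close>. Applied to the
  pairing of two maps, this says that its components are the given maps.\<close>

lemma adj_mor_iso:
  assumes "adj_mor (idt I) t h h' \<eta>' \<epsilon>' f g \<eta> \<epsilon> q q'" and I [simp]: "I \<in> Tob"
    and "adjunction LB h h' \<eta>' \<epsilon>'" "adjunction LB f g \<eta> \<epsilon>"
  shows "Iso (downr t q)"
proof -
  note m = adj_morD [OF assms(1)]
  note [simp] = m(1-14) adj_dataD [OF m(1)] adj_dataD [OF m(2)]
  have s [simp]: "so h = I" "so f = I" "tdom t = to h" "tcod t = to f"
    using m(15-18) by simp_all
  have t: "tri h h' \<eta>' \<epsilon>' = lu h" "tri f g \<eta> \<epsilon> = lu f"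
    using assms(3,4) by (simp_all add: adjunction_LB_iff)
  have e: "\<eta>' \<Zsemi> (q \<star> q') = \<eta>" "(q' \<star> q) \<Zsemi> \<epsilon> = \<epsilon>' \<Zsemi> un t"
    using m(19,20) by simp_all
  \<comment> \<open>A cell into a unit with source side \<open>t\<close> factors through the
    companion of \<open>t\<close>; \<open>X\<close> is this factorization for \<open>q'\<close>
    followed by the counit of \<open>f\<close>.\<close>
  define X where "X = liftl t ((q' \<star> idl f) \<Zsemi> \<epsilon>) \<Zsemi> ru (cmp t)"
  have X [simp]: "X \<in> Cell" "dm X = h' \<odot> f" "cd X = cmp t" "sd X = idt (to h)" "td X = idt (to f)"
    by (simp_all add: X_def)
  have "restl t (li (to f)) = ru (cmp t) \<Zsemi> cmpK t"
    by (simp add: restl_def lu_li ru_natural_globular)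
  then have XK: "X \<Zsemi> cmpK t = (q' \<star> idl f) \<Zsemi> \<epsilon>"
    using liftl_restl [of t "(q' \<star> idl f) \<Zsemi> \<epsilon>" "li (to f)"] by (simp add: X_def)
  \<comment> \<open>After composition with \<open>cmpK t\<close> both sides become \<epsilon>'
    followed by \<open>un t\<close>, by the counit square of the morphism.\<close>
  have qX: "(idl h' \<star> q) \<Zsemi> X = \<epsilon>' \<Zsemi> cmpE t"
    by (rule cmpK_eq [where f = t]) (simp_all add: XK merge e)
  define \<psi> where "\<psi> = vinv (lu f) \<Zsemi> (\<eta>' \<star> idl f) \<Zsemi> as h h' f \<Zsemi> (idl h \<star> X)"
  have \<psi> [simp]: "\<psi> \<in> Cell" "dm \<psi> = f" "cd \<psi> = h \<odot> cmp t" "sd \<psi> = idt I" "td \<psi> = idt (to f)"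
    by (simp_all add: \<psi>_def)
  have "\<psi> \<Zsemi> downr t q = vinv (lu f) \<Zsemi> (\<eta>' \<star> idl f) \<Zsemi> as h h' f \<Zsemi> (q \<star> (q' \<star> idl f)) \<Zsemi> (idl f \<star> \<epsilon>) \<Zsemi> ru f"
    by (simp add: \<psi>_def downr_def merge XK)
  also have "\<dots> = vinv (lu f) \<Zsemi> (\<eta>' \<star> idl f) \<Zsemi> ((q \<star> q') \<star> idl f) \<Zsemi> as f g f \<Zsemi> (idl f \<star> \<epsilon>) \<Zsemi> ru f"
    by (simp add: as_natural_assoc)
  also have "\<dots> = vinv (lu f) \<Zsemi> tri f g \<eta> \<epsilon>"
    by (simp add: merge e tri_def)
  finally have 1: "\<psi> \<Zsemi> downr t q = idl f"
    by (simp add: t)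
  have "downr t q \<Zsemi> \<psi> = idl (h \<odot> cmp t)"
  \<comment> \<open>Cells out of \<open>h \<odot> cmp t\<close> are tested on the extension cell.
    The claim becomes \<open>q \<Zsemi> \<psi> = extr t h\<close>, where the triangle identity of
    \<open>h\<close> applies.\<close>
  proof (rule extr_eq [where f = t and A = h])
    have "q \<Zsemi> \<psi> = vinv (lu h) \<Zsemi> (idl (li I) \<star> q) \<Zsemi> (\<eta>' \<star> idl f) \<Zsemi> as h h' f \<Zsemi> (idl h \<star> X)"
      using arg_cong [OF inv_lu_natural [of q], of "\<lambda>x. x \<Zsemi> (\<eta>' \<star> idl f) \<Zsemi> as h h' f \<Zsemi> (idl h \<star> X)"]
      by (simp add: \<psi>_def)
    also have "\<dots> = vinv (lu h) \<Zsemi> (\<eta>' \<star> idl h) \<Zsemi> ((idl h \<star> idl h') \<star> q) \<Zsemi> as h h' f \<Zsemi> (idl h \<star> X)"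
      by (simp add: merge)
    also have "\<dots> = vinv (lu h) \<Zsemi> (\<eta>' \<star> idl h) \<Zsemi> as h h' h \<Zsemi> (idl h \<star> ((idl h' \<star> q) \<Zsemi> X))"
      by (simp add: as_natural_assoc merge del: ccomp_idl)
    also have "\<dots> = vinv (lu h) \<Zsemi> (\<eta>' \<star> idl h) \<Zsemi> as h h' h \<Zsemi> (idl h \<star> \<epsilon>') \<Zsemi> (idl h \<star> cmpE t)"
      by (simp add: merge qX)
    also have "\<dots> = vinv (lu h) \<Zsemi> tri h h' \<eta>' \<epsilon>' \<Zsemi> vinv (ru h) \<Zsemi> (idl h \<star> cmpE t)"
      by (simp add: tri_def)
    also have "\<dots> = extr t h"
      by (simp add: t extr_def)
    finally have "q \<Zsemi> \<psi> = extr t h" .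
    moreover have "extr t h \<Zsemi> downr t q \<Zsemi> \<psi> = (extr t h \<Zsemi> downr t q) \<Zsemi> \<psi>"
      by simp
    ultimately show "extr t h \<Zsemi> downr t q \<Zsemi> \<psi> = extr t h \<Zsemi> idl (h \<odot> cmp t)"
      by (simp add: extr_downr del: src.A.Comp_assoc_Arr)
  qed simp_all
  with 1 show ?thesis
    by (intro src.A.invertibleI [where g = \<psi>]) simp_all
qed

section \<open>Extending a map along a tight arrow\<close>

lemma extl_natural:
  assumes "t \<in> Ti" "a \<in> Cell" "sd a = idt (tdom t)"
  shows "a \<Zsemi> extl t (cd a) = extl t (dm a) \<Zsemi> (idl (cnj t) \<star> a)"
proof -
  have "so (cd a) = tdom t" "so (dm a) = tdom t"
    using assms tsides(1) [OF assms(2,3)] by simp_all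
  then show ?thesis
    using assms arg_cong [OF inv_lu_natural [of a], of "\<lambda>x. x \<Zsemi> (cnjE t \<star> idl (cd a))"]
    by (simp add: extl_def merge)
qed

lemma extr_as:
  assumes "t \<in> Ti" "A \<in> Lo" "B \<in> Lo" "to A = so B" "to B = tdom t"
  shows "extr t (A \<odot> B) \<Zsemi> as A B (cmp t) = idl A \<star> extr t B"
proof -
  have "extr t (A \<odot> B) \<Zsemi> as A B (cmp t) =
    vinv (ru (A \<odot> B)) \<Zsemi> ((idl A \<star> idl B) \<star> cmpE t) \<Zsemi> as A B (cmp t)"
    using assms by (simp add: extr_def)
  also have "\<dots> = vinv (ru (A \<odot> B)) \<Zsemi> as A B (li (to B)) \<Zsemi> (idl A \<star> ru B) \<Zsemi> (idl A \<star> extr t B)"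
    using assms by (simp add: as_natural extr_def merge del: ccomp_idl)
  also have "\<dots> = vinv (ru (A \<odot> B)) \<Zsemi> (as A B (li (to B)) \<Zsemi> (idl A \<star> ru B)) \<Zsemi> (idl A \<star> extr t B)"
    using assms by simp
  also have "\<dots> = idl A \<star> extr t B"
    using assms by (simp add: as_ru del: src.A.Comp_assoc_Arr)
  finally show ?thesis .
qed

lemma extl_as:
  assumes "t \<in> Ti" "A \<in> Lo" "B \<in> Lo" "to A = so B" "so A = tdom t"
  shows "(extl t A \<star> idl B) \<Zsemi> as (cnj t) A B = extl t (A \<odot> B)"
proof -
  have "(extl t A \<star> idl B) \<Zsemi> as (cnj t) A B =
    (vinv (lu A) \<star> idl B) \<Zsemi> ((cnjE t \<star> idl A) \<star> idl B) \<Zsemi> as (cnj t) A B"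
    using assms by (simp add: extl_def merge)
  also have "\<dots> = (vinv (lu A) \<star> idl B) \<Zsemi> (as (li (so A)) A B \<Zsemi> lu (A \<odot> B)) \<Zsemi> extl t (A \<odot> B)"
    using assms by (simp add: as_natural extl_def)
  also have "\<dots> = extl t (A \<odot> B)"
    using assms by (simp add: as_lu merge del: src.A.Comp_assoc_Arr)
  finally show ?thesis .
qed

text \<open>Instead of pasting two adjunctions, unit and counit are chosen so that the extension
  cells form a morphism from the adjunction of \<open>f\<close> to the new data. The triangle
  identities then transfer along these cells, which are epic by \<open>extr_eq\<close> and
  \<open>extl_eq\<close>.\<close>

lemma adjunction_extend:
  assumes adj: "adjunction LB f g \<eta> \<epsilon>" and t [simp]: "t \<in> Ti" "tdom t = to f"
  shows "is_map LB (f \<odot> cmp t)"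
proof -
  have d: "adj_data f g \<eta> \<epsilon>" and tri: "tri f g \<eta> \<epsilon> = lu f" "tri' f g \<eta> \<epsilon> = ru g"
    using adj by (simp_all add: adjunction_LB_iff)
  note [simp] = adj_dataD [OF d]
  let ?J = "tcod t" and ?h = "f \<odot> cmp t" and ?k = "cnj t \<odot> g"
  define \<eta>' where "\<eta>' = \<eta> \<Zsemi> (extr t f \<star> extl t g)"
  \<comment> \<open>The factorization of \<open>\<epsilon> \<Zsemi> un t\<close> through the
    extensions on both sides, preceded by the associators that its domain requires.\<close>
  define \<epsilon>' where "\<epsilon>' = as (cnj t) g ?h \<Zsemi> (idl (cnj t) \<star> vinv (as g f (cmp t))) \<Zsemi> downl t (downr t (\<epsilon> \<Zsemi> un t))"
  have d': "adj_data ?h ?k \<eta>' \<epsilon>'"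
    by (simp add: adj_data_def \<eta>'_def \<epsilon>'_def)
  note [simp] = adj_dataD [OF d'] and [simp] = tri_simps [OF d']
  have N: "extl t (g \<odot> ?h) \<Zsemi> (idl (cnj t) \<star> vinv (as g f (cmp t))) =
      vinv (as g f (cmp t)) \<Zsemi> extl t ((g \<odot> f) \<odot> cmp t)"
    using extl_natural [of t "vinv (as g f (cmp t))"] by simp
  have "(extl t g \<star> extr t f) \<Zsemi> \<epsilon>' = (idl g \<star> extr t f) \<Zsemi> ((extl t g \<star> idl ?h) \<Zsemi> as (cnj t) g ?h) \<Zsemi>
      (idl (cnj t) \<star> vinv (as g f (cmp t))) \<Zsemi> downl t (downr t (\<epsilon> \<Zsemi> un t))"
    by (simp add: \<epsilon>'_def merge)
  also have "\<dots> = (idl g \<star> extr t f) \<Zsemi> (extl t (g \<odot> ?h) \<Zsemi> (idl (cnj t) \<star> vinv (as g f (cmp t)))) \<Zsemi>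
      downl t (downr t (\<epsilon> \<Zsemi> un t))"
    unfolding extl_as [of t g ?h, simplified] by simp
  also have "\<dots> = (idl g \<star> extr t f) \<Zsemi> vinv (as g f (cmp t)) \<Zsemi> extl t ((g \<odot> f) \<odot> cmp t) \<Zsemi>
      downl t (downr t (\<epsilon> \<Zsemi> un t))"
    unfolding N by simp
  also have "\<dots> = (extr t (g \<odot> f) \<Zsemi> as g f (cmp t)) \<Zsemi> vinv (as g f (cmp t)) \<Zsemi> downr t (\<epsilon> \<Zsemi> un t)"
    by (subst extr_as) (simp_all add: extl_downl)
  also have "\<dots> = \<epsilon> \<Zsemi> un t"
    by (simp add: extr_downr)
  finally have e: "(extl t g \<star> extr t f) \<Zsemi> \<epsilon>' = \<epsilon> \<Zsemi> un t" .
  have mor: "adj_mor (idt (so f)) t f g \<eta> \<epsilon> ?h ?k \<eta>' \<epsilon>' (extr t f) (extl t g)"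
    using d d' e by (simp add: adj_mor_def) (simp add: \<eta>'_def)
  have "vinv (lu ?h) \<Zsemi> tri ?h ?k \<eta>' \<epsilon>' = idl ?h"
  proof (rule extr_eq [where f = t and A = f])
    have "extr t f \<Zsemi> vinv (lu ?h) = vinv (lu f) \<Zsemi> (idl (li (so f)) \<star> extr t f)"
      using inv_lu_natural [of "extr t f"] by simp
    then have "extr t f \<Zsemi> vinv (lu ?h) \<Zsemi> tri ?h ?k \<eta>' \<epsilon>' =
        vinv (lu f) \<Zsemi> (idl (li (so f)) \<star> extr t f) \<Zsemi> tri ?h ?k \<eta>' \<epsilon>'"
      by (simp flip: src.A.Comp_assoc_Arr)
    also have "\<dots> = vinv (lu f) \<Zsemi> tri f g \<eta> \<epsilon> \<Zsemi> extr t f"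
      using tri_natural(1) [OF mor] by simp
    finally show "extr t f \<Zsemi> vinv (lu ?h) \<Zsemi> tri ?h ?k \<eta>' \<epsilon>' = extr t f \<Zsemi> idl ?h"
      by (simp add: tri)
  qed simp_all
  then have 1: "tri ?h ?k \<eta>' \<epsilon>' = lu ?h"
    by - (rule src.A.invertible_cancel_left [of "vinv (lu ?h)"], simp_all)
  have "vinv (ru ?k) \<Zsemi> tri' ?h ?k \<eta>' \<epsilon>' = idl ?k"
  proof (rule extl_eq [where f = t and A = g])
    have "extl t g \<Zsemi> vinv (ru ?k) = vinv (ru g) \<Zsemi> (extl t g \<star> idl (li (so f)))"
      using inv_ru_natural [of "extl t g"] by simp
    then have "extl t g \<Zsemi> vinv (ru ?k) \<Zsemi> tri' ?h ?k \<eta>' \<epsilon>' =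
        vinv (ru g) \<Zsemi> (extl t g \<star> idl (li (so f))) \<Zsemi> tri' ?h ?k \<eta>' \<epsilon>'"
      by (simp flip: src.A.Comp_assoc_Arr)
    also have "\<dots> = vinv (ru g) \<Zsemi> tri' f g \<eta> \<epsilon> \<Zsemi> extl t g"
      using tri_natural(2) [OF mor] by simp
    finally show "extl t g \<Zsemi> vinv (ru ?k) \<Zsemi> tri' ?h ?k \<eta>' \<epsilon>' = extl t g \<Zsemi> idl ?k"
      by (simp add: tri)
  qed simp_all
  then have 2: "tri' ?h ?k \<eta>' \<epsilon>' = ru ?k"
    by - (rule src.A.invertible_cancel_left [of "vinv (ru ?k)"], simp_all)
  show ?thesis
    using d' 1 2 unfolding is_map_def adjunction_LB_iff by blast
qed

subsection \<open>Transposition\<close>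

text \<open>Transposition sends \<open>u\<close> to a cell from \<open>g \<odot> A\<close> to a
  unit, and \<eta> brings it back. Sliding \<open>u\<close> through the associator and past the unit
  reduces the round trip to the triangle identity for \<open>f\<close>.\<close>

lemma flat_sharp:
  assumes "adjunction LB f g \<eta> \<epsilon>" and u: "u \<in> Cell" "dm u = A" "cd u = f" "sd u = idt (so f)"
  shows "vinv (lu A) \<Zsemi> (\<eta> \<star> idl A) \<Zsemi> as f g A \<Zsemi> (idl f \<star> ((idl g \<star> u) \<Zsemi> \<epsilon>)) \<Zsemi> ru f = u"
proof -
  have d: "adj_data f g \<eta> \<epsilon>" and t: "tri f g \<eta> \<epsilon> = lu f"
    using assms(1) by (simp_all add: adjunction_LB_iff)
  note [simp] = adj_dataD [OF d] u
  have [simp]: "so A = so f" "A \<in> Lo"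
    using tsides(1) [OF u(1,4)] src.A.Dom_Obj [OF u(1)] by simp_all
  have "(\<eta> \<star> idl A) \<Zsemi> as f g A \<Zsemi> (idl f \<star> ((idl g \<star> u) \<Zsemi> \<epsilon>)) \<Zsemi> ru f =
      (\<eta> \<star> idl A) \<Zsemi> as f g A \<Zsemi> (idl f \<star> (idl g \<star> u)) \<Zsemi> (idl f \<star> \<epsilon>) \<Zsemi> ru f"
    by (simp add: merge)
  also have "\<dots> = (\<eta> \<star> idl A) \<Zsemi> ((idl f \<star> idl g) \<star> u) \<Zsemi> as f g f \<Zsemi> (idl f \<star> \<epsilon>) \<Zsemi> ru f"
    by (simp add: as_natural_assoc del: ccomp_idl)
  also have "\<dots> = (idl (li (so f)) \<star> u) \<Zsemi> tri f g \<eta> \<epsilon>"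
    by (simp add: merge tri_def)
  also have "\<dots> = lu A \<Zsemi> u"
    by (simp add: t lu_natural_globular)
  finally show ?thesis by simp
qed

text \<open>The other round trip of the transposition rests on the triangle identity for
  \<open>g\<close>. The pentagon brings the associators into the order in which \<open>tri'\<close>,
  whiskered with \<open>A\<close>, contains them.\<close>

lemma sharp_flat:
  assumes "adjunction LB f g \<eta> \<epsilon>" and b: "b \<in> Cell" "dm b = g \<odot> A" "cd b = li (to f)" "sd b = idt (to f)"
    and A: "A \<in> Lo" "so A = so f"
  shows "(idl g \<star> (vinv (lu A) \<Zsemi> (\<eta> \<star> idl A) \<Zsemi> as f g A \<Zsemi> (idl f \<star> b) \<Zsemi> ru f)) \<Zsemi> \<epsilon> = b"
proof -
  have d: "adj_data f g \<eta> \<epsilon>" and t: "tri' f g \<eta> \<epsilon> = ru g"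
    using assms(1) by (simp_all add: adjunction_LB_iff)
  note [simp] = adj_dataD [OF d] b A
  let ?J = "to f" and ?I = "so f"
  have "as g f (li ?J) \<Zsemi> (idl g \<star> ru f) \<Zsemi> \<epsilon> = ru (g \<odot> f) \<Zsemi> \<epsilon>"
    by (simp add: as_ru flip: src.A.Comp_assoc_Arr)
  also have "\<dots> = (\<epsilon> \<star> idl (li ?J)) \<Zsemi> ru (li ?J)"
    by (simp add: ru_natural_globular)
  finally have 1: "(idl g \<star> ru f) \<Zsemi> \<epsilon> = vinv (as g f (li ?J)) \<Zsemi> (\<epsilon> \<star> idl (li ?J)) \<Zsemi> ru (li ?J)"
    by - (rule src.A.invertible_cancel_left [of "as g f (li ?J)"], simp_all)
  have "(idl g \<star> (idl f \<star> b)) \<Zsemi> (idl g \<star> ru f) \<Zsemi> \<epsilon> =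
      vinv (as g f (g \<odot> A)) \<Zsemi> ((idl g \<star> idl f) \<star> b) \<Zsemi> (\<epsilon> \<star> idl (li ?J)) \<Zsemi> ru (li ?J)"
    unfolding 1 by (simp add: inv_as_natural_assoc del: ccomp_idl)
  also have "\<dots> = vinv (as g f (g \<odot> A)) \<Zsemi> (\<epsilon> \<star> idl (g \<odot> A)) \<Zsemi> (idl (li ?J) \<star> b) \<Zsemi> lu (li ?J)"
    by (simp add: merge lu_li)
  also have "\<dots> = vinv (as g f (g \<odot> A)) \<Zsemi> (\<epsilon> \<star> idl (g \<odot> A)) \<Zsemi> lu (g \<odot> A) \<Zsemi> b"
    by (simp add: lu_natural_globular)
  finally have 2: "(idl g \<star> (idl f \<star> b)) \<Zsemi> (idl g \<star> ru f) \<Zsemi> \<epsilon> =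
      vinv (as g f (g \<odot> A)) \<Zsemi> (\<epsilon> \<star> idl (g \<odot> A)) \<Zsemi> lu (g \<odot> A) \<Zsemi> b" .
  have "as g (f \<odot> g) A \<Zsemi> (idl g \<star> as f g A) \<Zsemi> vinv (as g f (g \<odot> A)) =
      (vinv (as g f g) \<star> idl A) \<Zsemi> ((as g f g \<star> idl A) \<Zsemi> as g (f \<odot> g) A \<Zsemi> (idl g \<star> as f g A)) \<Zsemi>
        vinv (as g f (g \<odot> A))"
    by (simp add: merge)
  also have "\<dots> = (vinv (as g f g) \<star> idl A) \<Zsemi> as (g \<odot> f) g A"
    by (subst pentagon' [symmetric]) simp_all
  finally have 3: "as g (f \<odot> g) A \<Zsemi> (idl g \<star> as f g A) \<Zsemi> vinv (as g f (g \<odot> A)) =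
      (vinv (as g f g) \<star> idl A) \<Zsemi> as (g \<odot> f) g A" .
  let ?z = "(\<epsilon> \<star> idl (g \<odot> A)) \<Zsemi> lu (g \<odot> A)"
  have "as g (li ?I) A \<Zsemi> (idl g \<star> (\<eta> \<star> idl A)) \<Zsemi> (idl g \<star> as f g A) \<Zsemi> vinv (as g f (g \<odot> A)) \<Zsemi> ?z =
      ((idl g \<star> \<eta>) \<star> idl A) \<Zsemi> (as g (f \<odot> g) A \<Zsemi> (idl g \<star> as f g A) \<Zsemi> vinv (as g f (g \<odot> A))) \<Zsemi> ?z"
    by (simp add: as_natural_assoc)
  also have "\<dots> = ((idl g \<star> \<eta>) \<star> idl A) \<Zsemi> (vinv (as g f g) \<star> idl A) \<Zsemi>
      as (g \<odot> f) g A \<Zsemi> (\<epsilon> \<star> (idl g \<star> idl A)) \<Zsemi> lu (g \<odot> A)"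
    unfolding 3 by simp
  also have "\<dots> = ((idl g \<star> \<eta>) \<star> idl A) \<Zsemi> (vinv (as g f g) \<star> idl A) \<Zsemi>
      ((\<epsilon> \<star> idl g) \<star> idl A) \<Zsemi> as (li ?J) g A \<Zsemi> lu (g \<odot> A)"
    by (simp add: as_natural_assoc del: ccomp_idl)
  also have "\<dots> = tri' f g \<eta> \<epsilon> \<star> idl A"
    by (simp add: as_lu merge tri'_def)
  also have "\<dots> = as g (li ?I) A \<Zsemi> (idl g \<star> lu A)"
    by (simp add: t triangle')
  finally have 4: "(idl g \<star> (\<eta> \<star> idl A)) \<Zsemi> (idl g \<star> as f g A) \<Zsemi> vinv (as g f (g \<odot> A)) \<Zsemi> ?z = idl g \<star> lu A"
    by - (rule src.A.invertible_cancel_left [of "as g (li ?I) A"], simp_all)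
  have "(idl g \<star> (vinv (lu A) \<Zsemi> (\<eta> \<star> idl A) \<Zsemi> as f g A \<Zsemi> (idl f \<star> b) \<Zsemi> ru f)) \<Zsemi> \<epsilon> =
      (idl g \<star> vinv (lu A)) \<Zsemi> (idl g \<star> (\<eta> \<star> idl A)) \<Zsemi> (idl g \<star> as f g A) \<Zsemi>
        (idl g \<star> (idl f \<star> b)) \<Zsemi> (idl g \<star> ru f) \<Zsemi> \<epsilon>"
    by (simp add: merge)
  also have "\<dots> = (idl g \<star> vinv (lu A)) \<Zsemi>
      ((idl g \<star> (\<eta> \<star> idl A)) \<Zsemi> (idl g \<star> as f g A) \<Zsemi> vinv (as g f (g \<odot> A)) \<Zsemi> ?z) \<Zsemi> b"
    unfolding 2 by simp
  also have "\<dots> = b"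
    unfolding 4 by (simp add: merge flip: src.A.Comp_assoc_Arr)
  finally show ?thesis .
qed

text \<open>The transpose of a globular cell \<open>A \<odot> cmp t \<rightarrow> f \<odot> cmp t\<close>, as a cell from \<open>g \<odot> A\<close> to a
  unit with both sides \<open>t\<close>.\<close>

definition "mate t f g \<epsilon> A a = extr t (g \<odot> A) \<Zsemi> as g A (cmp t) \<Zsemi> (idl g \<star> a) \<Zsemi> vinv (as g f (cmp t)) \<Zsemi>
  (\<epsilon> \<star> idl (cmp t)) \<Zsemi> lu (cmp t) \<Zsemi> cmpK t"

lemma mate_simps:
  assumes "adj_data f g \<eta> \<epsilon>" "t \<in> Ti" "tdom t = to f" "A \<in> Lo" "so A = so f" "to A = to f"
    "a \<in> Cell" "dm a = A \<odot> cmp t" "cd a = f \<odot> cmp t" "sd a = idt (so f)" "td a = idt (tcod t)"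
  shows "mate t f g \<epsilon> A a \<in> Cell" "dm (mate t f g \<epsilon> A a) = g \<odot> A"
    "cd (mate t f g \<epsilon> A a) = li (tcod t)" "sd (mate t f g \<epsilon> A a) = t" "td (mate t f g \<epsilon> A a) = t"
  using adj_dataD [OF assms(1)] assms(2-) by (simp_all add: mate_def)

text \<open>The companion is absorbed, and the mate becomes the transpose of \<open>u\<close>
  followed by \<open>un t\<close>. When \<open>t\<close> is a projection, \<open>un t\<close> is a
  product projection of units; this is how composites with the companions of \<open>op1\<close> and
  \<open>op2\<close> meet \<open>li_product\<close>.\<close>

lemma mate_whisker:
  assumes d: "adj_data f g \<eta> \<epsilon>" and t: "t \<in> Ti" "tdom t = to f"
    and u: "u \<in> Cell" "dm u = A" "cd u = f" "sd u = idt (so f)" "td u = idt (to f)"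
  shows "mate t f g \<epsilon> A (u \<star> idl (cmp t)) = (idl g \<star> u) \<Zsemi> \<epsilon> \<Zsemi> un t"
proof -
  note [simp] = adj_dataD [OF d] u t
  have [simp]: "so A = so f" "to A = to f" "A \<in> Lo"
    using tsides(1) [OF u(1,4)] tsides(2) [OF u(1,5)] src.A.Dom_Obj [OF u(1)] by simp_all
  have "mate t f g \<epsilon> A (u \<star> idl (cmp t)) = extr t (g \<odot> A) \<Zsemi> ((idl g \<star> u) \<star> idl (cmp t)) \<Zsemi>
      (\<epsilon> \<star> idl (cmp t)) \<Zsemi> lu (cmp t) \<Zsemi> cmpK t"
    using inv_as_natural_assoc [of "idl g" u "idl (cmp t)" g f "cmp t" "(\<epsilon> \<star> idl (cmp t)) \<Zsemi> lu (cmp t) \<Zsemi> cmpK t"]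
    by (simp add: mate_def)
  also have "\<dots> = extr t (g \<odot> A) \<Zsemi> (((idl g \<star> u) \<Zsemi> \<epsilon>) \<star> idl (cmp t)) \<Zsemi> (un t \<star> cmpK t) \<Zsemi> lu (li (tcod t))"
    by (simp add: merge lu_natural)
  also have "\<dots> = vinv (ru (g \<odot> A)) \<Zsemi> (((idl g \<star> u) \<Zsemi> \<epsilon> \<Zsemi> un t) \<star> un t) \<Zsemi> ru (li (tcod t))"
    by (simp add: extr_def merge lu_li)
  also have "\<dots> = (idl g \<star> u) \<Zsemi> \<epsilon> \<Zsemi> un t"
    by (simp add: ru_natural)
  finally show ?thesis .
qed

text \<open>Each layer of the mate is reversible: precomposition with \<open>extr\<close> and
  postcomposition with \<open>cmpK\<close> by their cancellation laws, the transposition by the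
  triangle identity for \<open>f\<close> whiskered with \<open>cmp t\<close>.\<close>

lemma mate_eq:
  assumes adj: "adjunction LB f g \<eta> \<epsilon>" and t: "t \<in> Ti" "tdom t = to f"
    and A: "A \<in> Lo" "so A = so f" "to A = to f"
    and a: "a \<in> Cell" "dm a = A \<odot> cmp t" "cd a = f \<odot> cmp t" "sd a = idt (so f)" "td a = idt (tcod t)"
    and b: "b \<in> Cell" "dm b = A \<odot> cmp t" "cd b = f \<odot> cmp t" "sd b = idt (so f)" "td b = idt (tcod t)"
    and eq: "mate t f g \<epsilon> A a = mate t f g \<epsilon> A b"
  shows "a = b"
proof -
  have d: "adj_data f g \<eta> \<epsilon>" and tri: "tri f g \<eta> \<epsilon> = lu f"
    using adj by (simp_all add: adjunction_LB_iff)
  note [simp] = adj_dataD [OF d] t A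
  let ?c = "cmp t" and ?I = "so f" and ?J = "to f"
  \<comment> \<open>The counit whiskered with the companion;
    \<open>(idl g \<star> a) \<Zsemi> k\<close> is the transpose of \<open>a\<close>, with values in
    \<open>cmp t\<close> in place of a unit.\<close>
  define k where "k = vinv (as g f ?c) \<Zsemi> (\<epsilon> \<star> idl ?c) \<Zsemi> lu ?c"
  have k [simp]: "k \<in> Cell" "dm k = g \<odot> (f \<odot> ?c)" "cd k = ?c" "sd k = idt ?J" "td k = idt (tcod t)"
    by (simp_all add: k_def)
  have sharp: "(idl g \<star> a) \<Zsemi> k = (idl g \<star> b) \<Zsemi> k"
  proof -
    note [simp] = a b
    have "as g A ?c \<Zsemi> (idl g \<star> a) \<Zsemi> k = as g A ?c \<Zsemi> (idl g \<star> b) \<Zsemi> k"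
    proof (rule extr_eq [where f = t and A = "g \<odot> A"])
      show "extr t (g \<odot> A) \<Zsemi> as g A ?c \<Zsemi> (idl g \<star> a) \<Zsemi> k = extr t (g \<odot> A) \<Zsemi> as g A ?c \<Zsemi> (idl g \<star> b) \<Zsemi> k"
        by (rule cmpK_eq [where f = t]) (use eq in \<open>simp_all add: mate_def k_def\<close>)
    qed simp_all
    then show ?thesis
      by - (rule src.A.invertible_cancel_left [of "as g A ?c"], simp_all)
  qed
  have "as (f \<odot> g) f ?c \<Zsemi> as f g (f \<odot> ?c) \<Zsemi> (idl f \<star> vinv (as g f ?c)) =
      ((as f g f \<star> idl ?c) \<Zsemi> as f (g \<odot> f) ?c \<Zsemi> (idl f \<star> as g f ?c)) \<Zsemi> (idl f \<star> vinv (as g f ?c))"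
    by (subst pentagon' [symmetric]) simp_all
  also have "\<dots> = (as f g f \<star> idl ?c) \<Zsemi> as f (g \<odot> f) ?c"
    by (simp add: merge)
  finally have 1: "as (f \<odot> g) f ?c \<Zsemi> as f g (f \<odot> ?c) \<Zsemi> (idl f \<star> vinv (as g f ?c)) =
      (as f g f \<star> idl ?c) \<Zsemi> as f (g \<odot> f) ?c" .
  have "as (li ?I) f ?c \<Zsemi> (\<eta> \<star> (idl f \<star> idl ?c)) \<Zsemi> as f g (f \<odot> ?c) \<Zsemi> (idl f \<star> k) =
    ((\<eta> \<star> idl f) \<star> idl ?c) \<Zsemi> (as (f \<odot> g) f ?c \<Zsemi> as f g (f \<odot> ?c) \<Zsemi> (idl f \<star> vinv (as g f ?c))) \<Zsemi>
      (idl f \<star> (\<epsilon> \<star> idl ?c)) \<Zsemi> (idl f \<star> lu ?c)"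
    by (simp add: k_def as_natural_assoc interchange del: ccomp_idl)
  also have "\<dots> = ((\<eta> \<star> idl f) \<star> idl ?c) \<Zsemi> (as f g f \<star> idl ?c) \<Zsemi> ((idl f \<star> \<epsilon>) \<star> idl ?c) \<Zsemi>
      as f (li ?J) ?c \<Zsemi> (idl f \<star> lu ?c)"
    unfolding 1 by (simp add: as_natural_assoc)
  also have "\<dots> = tri f g \<eta> \<epsilon> \<star> idl ?c"
    by (simp add: triangle' merge tri_def)
  also have "\<dots> = as (li ?I) f ?c \<Zsemi> lu (f \<odot> ?c)"
    by (simp add: tri as_lu)
  finally have 2: "(\<eta> \<star> idl (f \<odot> ?c)) \<Zsemi> as f g (f \<odot> ?c) \<Zsemi> (idl f \<star> k) = lu (f \<odot> ?c)"
    by - (rule src.A.invertible_cancel_left [of "as (li ?I) f ?c"], simp_all)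
  have flat: "(\<eta> \<star> idl (A \<odot> ?c)) \<Zsemi> as f g (A \<odot> ?c) \<Zsemi> (idl f \<star> ((idl g \<star> a) \<Zsemi> k)) = lu (A \<odot> ?c) \<Zsemi> a"
    if [simp]: "a \<in> Cell" "dm a = A \<odot> cmp t" "cd a = f \<odot> cmp t" "sd a = idt (so f)" "td a = idt (tcod t)" for a
  proof -
    have "(\<eta> \<star> idl (A \<odot> ?c)) \<Zsemi> as f g (A \<odot> ?c) \<Zsemi> (idl f \<star> ((idl g \<star> a) \<Zsemi> k)) =
      (\<eta> \<star> idl (A \<odot> ?c)) \<Zsemi> as f g (A \<odot> ?c) \<Zsemi> (idl f \<star> (idl g \<star> a)) \<Zsemi> (idl f \<star> k)"
      by (simp add: merge)
    also have "\<dots> = (\<eta> \<star> idl (A \<odot> ?c)) \<Zsemi> ((idl f \<star> idl g) \<star> a) \<Zsemi> as f g (f \<odot> ?c) \<Zsemi> (idl f \<star> k)"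
      by (simp add: as_natural_assoc del: ccomp_idl)
    also have "\<dots> = (idl (li ?I) \<star> a) \<Zsemi> (\<eta> \<star> idl (f \<odot> ?c)) \<Zsemi> as f g (f \<odot> ?c) \<Zsemi> (idl f \<star> k)"
      by (simp add: merge)
    also have "\<dots> = lu (A \<odot> ?c) \<Zsemi> a"
      unfolding 2 by (simp add: lu_natural_globular)
    finally show ?thesis .
  qed
  have "lu (A \<odot> ?c) \<Zsemi> a = lu (A \<odot> ?c) \<Zsemi> b"
    using flat [OF a] flat [OF b] sharp by simp
  then show ?thesis
    using a b by - (rule src.A.invertible_cancel_left [of "lu (A \<odot> ?c)"], simp_all)
qed

end

section \<open>Products in a cartesian equipment\<close>

text \<open>Stated on bare components so that it serves the tight category and the category of cells
  alike. The pairing of \<open>f\<close> and \<open>g\<close> is \<eta> followed by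
  \<open>farr G (f, g)\<close>; uniqueness comes from naturality of \<eta> and the second triangle
  identity.\<close>

lemma (in category) product_from_adjunction:
  assumes G: "is_functor (cat_prod C C) C G"
    and \<eta>: "\<And>x. x \<in> Obj C \<Longrightarrow> \<eta> x \<in> hom C x (fobj G (x, x))"
    and \<eta>_natural: "\<And>f. f \<in> Arr C \<Longrightarrow> f \<cdot> \<eta> (Cod C f) = \<eta> (Dom C f) \<cdot> farr G (f, f)"
    and \<epsilon>: "\<And>x y. x \<in> Obj C \<Longrightarrow> y \<in> Obj C \<Longrightarrow>
      \<epsilon> (x, y) \<in> hom (cat_prod C C) (fobj G (x, y), fobj G (x, y)) (x, y)"
    and \<epsilon>_natural: "\<And>f g. f \<in> Arr C \<Longrightarrow> g \<in> Arr C \<Longrightarrow>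
      (farr G (f, g), farr G (f, g)) \<cdot>\<^bsub>cat_prod C C\<^esub> \<epsilon> (Cod C f, Cod C g) =
      \<epsilon> (Dom C f, Dom C g) \<cdot>\<^bsub>cat_prod C C\<^esub> (f, g)"
    and triangle1: "\<And>x. x \<in> Obj C \<Longrightarrow>
      (\<eta> x, \<eta> x) \<cdot>\<^bsub>cat_prod C C\<^esub> \<epsilon> (x, x) = (Ident C x, Ident C x)"
    and triangle2: "\<And>x y. x \<in> Obj C \<Longrightarrow> y \<in> Obj C \<Longrightarrow>
      \<eta> (fobj G (x, y)) \<cdot> farr G (\<epsilon> (x, y)) = Ident C (fobj G (x, y))"
    and xy: "x \<in> Obj C" "y \<in> Obj C"
  shows "is_product C x y (fobj G (x, y)) (fst (\<epsilon> (x, y))) (snd (\<epsilon> (x, y)))"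
proof -
  interpret G: is_functor "cat_prod C C" C G by (rule G)
  define \<pi> \<rho> where "\<pi> = (\<lambda>x y. fst (\<epsilon> (x, y)))" and "\<rho> = (\<lambda>x y. snd (\<epsilon> (x, y)))"
  have \<epsilon>_eq: "\<epsilon> (x, y) = (\<pi> x y, \<rho> x y)" for x y
    by (simp add: \<pi>_def \<rho>_def)
  have p [simp]: "\<pi> x y \<in> Arr C" "Dom C (\<pi> x y) = fobj G (x, y)" "Cod C (\<pi> x y) = x"
    "\<rho> x y \<in> Arr C" "Dom C (\<rho> x y) = fobj G (x, y)" "Cod C (\<rho> x y) = y"
    if "x \<in> Obj C" "y \<in> Obj C" for x y
    using \<epsilon> [OF that] unfolding \<epsilon>_eq by (auto simp: hom_def)
  have e [simp]: "\<eta> x \<in> Arr C" "Dom C (\<eta> x) = x" "Cod C (\<eta> x) = fobj G (x, x)" if "x \<in> Obj C" for x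
    using \<eta> [OF that] by (auto simp: hom_def)
  have g [simp]: "farr G (f, h) \<in> Arr C" "Dom C (farr G (f, h)) = fobj G (Dom C f, Dom C h)"
    "Cod C (farr G (f, h)) = fobj G (Cod C f, Cod C h)" if "f \<in> Arr C" "h \<in> Arr C" for f h
    using G.farr_simps [of "(f, h)"] that by simp_all
  have gx [simp]: "fobj G (x, y) \<in> Obj C" if "x \<in> Obj C" "y \<in> Obj C" for x y
    using G.fobj_Obj_simp [of "(x, y)"] that by simp
  have nat: "farr G (f, g) \<cdot> \<pi> (Cod C f) (Cod C g) = \<pi> (Dom C f) (Dom C g) \<cdot> f"
    "farr G (f, g) \<cdot> \<rho> (Cod C f) (Cod C g) = \<rho> (Dom C f) (Dom C g) \<cdot> g" if "f \<in> Arr C" "g \<in> Arr C" for f g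
    using \<epsilon>_natural [OF that] by (simp_all add: \<epsilon>_eq)
  have tri [simp]: "\<eta> x \<cdot> \<pi> x x = Ident C x" "\<eta> x \<cdot> \<rho> x x = Ident C x" if "x \<in> Obj C" for x
    using triangle1 [OF that] by (simp_all add: \<epsilon>_eq)
  have pair: "h = \<eta> (Dom C h) \<cdot> farr G (h \<cdot> \<pi> x y, h \<cdot> \<rho> x y)"
    if h: "h \<in> Arr C" "Cod C h = fobj G (x, y)" for h
  proof -
    have "farr G (h, h) \<cdot> farr G (\<pi> x y, \<rho> x y) = farr G (h \<cdot> \<pi> x y, h \<cdot> \<rho> x y)"
      using G.farr_Comp_Arr [of "(h, h)" "(\<pi> x y, \<rho> x y)"] h xy by simp
    then have "\<eta> (Dom C h) \<cdot> farr G (h \<cdot> \<pi> x y, h \<cdot> \<rho> x y) =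
        (\<eta> (Dom C h) \<cdot> farr G (h, h)) \<cdot> farr G (\<pi> x y, \<rho> x y)"
      using h xy by simp
    also have "\<dots> = (h \<cdot> \<eta> (fobj G (x, y))) \<cdot> farr G (\<pi> x y, \<rho> x y)"
      using \<eta>_natural [OF h(1)] h by simp
    also have "\<dots> = h \<cdot> (\<eta> (fobj G (x, y)) \<cdot> farr G (\<pi> x y, \<rho> x y))"
      using h xy by simp
    also have "\<dots> = h"
      using triangle2 [OF xy] h xy by (simp add: \<epsilon>_eq)
    finally show ?thesis by simp
  qed
  have "is_product C x y (fobj G (x, y)) (\<pi> x y) (\<rho> x y)"
  proof (rule is_productI)
    fix f g assume *: "f \<in> Arr C" "g \<in> Arr C" "Dom C f = Dom C g" "Cod C f = x" "Cod C g = y"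
    have "(\<eta> (Dom C f) \<cdot> farr G (f, g)) \<cdot> \<pi> x y = (\<eta> (Dom C f) \<cdot> \<pi> (Dom C f) (Dom C f)) \<cdot> f"
      using * nat(1) [OF *(1,2)] xy by (simp del: tri)
    moreover have "(\<eta> (Dom C f) \<cdot> farr G (f, g)) \<cdot> \<rho> x y = (\<eta> (Dom C f) \<cdot> \<rho> (Dom C f) (Dom C f)) \<cdot> g"
      using * nat(2) [OF *(1,2)] xy by (simp del: tri)
    ultimately show "\<exists>k\<in>Arr C. Dom C k = Dom C f \<and> Cod C k = fobj G (x, y) \<and> k \<cdot> \<pi> x y = f \<and> k \<cdot> \<rho> x y = g"
      using * xy by (intro bexI [of _ "\<eta> (Dom C f) \<cdot> farr G (f, g)"]) (simp_all del: Comp_assoc_Arr)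
  next
    fix f g assume "f \<in> Arr C" "g \<in> Arr C" "Dom C f = Dom C g" "Cod C f = fobj G (x, y)"
      "Cod C g = fobj G (x, y)" "f \<cdot> \<pi> x y = g \<cdot> \<pi> x y" "f \<cdot> \<rho> x y = g \<cdot> \<rho> x y"
    then show "f = g"
      using pair [of f] pair [of g] by metis
  qed (use xy in simp_all)
  then show ?thesis by (simp add: \<pi>_def \<rho>_def)
qed

lemma (in category) terminal_from_adjunction:
  assumes "is_functor cat_one C G" "\<And>x. x \<in> Obj C \<Longrightarrow> \<eta> x \<in> hom C x (fobj G ())"
    and natural: "\<And>f. f \<in> Arr C \<Longrightarrow> f \<cdot> \<eta> (Cod C f) = \<eta> (Dom C f) \<cdot> farr G ()"
    and triangle: "\<eta> (fobj G ()) \<cdot> farr G () = Ident C (fobj G ())"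
  shows "is_terminal C (fobj G ())"
proof -
  interpret G: is_functor cat_one C G by (rule assms)
  let ?t = "fobj G ()"
  have t [simp]: "?t \<in> Obj C" "farr G () = Ident C ?t"
    using G.fobj_Obj_simp [of "()"] G.farr_Ident_simp [of "()"] by simp_all
  have e [simp]: "\<eta> x \<in> Arr C" "Dom C (\<eta> x) = x" "Cod C (\<eta> x) = ?t" if "x \<in> Obj C" for x
    using assms(2) [OF that] by (auto simp: hom_def)
  have "\<eta> ?t = Ident C ?t"
    using triangle by simp
  then have uniq: "f = \<eta> (Dom C f)" if "f \<in> Arr C" "Cod C f = ?t" for f
    using natural [of f] that by simp
  show ?thesis
    unfolding is_terminal_def
  proof (intro conjI ballI)
    fix x assume x: "x \<in> Obj C"
    show "\<exists>!f. f \<in> hom C x ?t"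
      by (rule ex1I [of _ "\<eta> x"]) (use x uniq in \<open>auto simp: hom_def\<close>)
  qed simp
qed

lemma (in category) terminal_iso:
  assumes t: "is_terminal C t" and i: "invertible C i" "Cod C i = t"
  shows "is_terminal C (Dom C i)"
  unfolding is_terminal_def
proof (intro conjI ballI)
  note [simp] = invertible_Arr [OF i(1)]
  show "Dom C i \<in> Obj C" by simp
  fix x assume x: "x \<in> Obj C"
  obtain f where f [simp]: "f \<in> Arr C" "Dom C f = x" "Cod C f = t"
    using terminal_ex [OF t x] by metis
  show "\<exists>!f. f \<in> hom C x (Dom C i)"
  proof (rule ex1I [of _ "f \<cdot> Inv C i"])
    show "f \<cdot> Inv C i \<in> hom C x (Dom C i)"
      using i by (simp add: hom_def)
    fix g assume "g \<in> hom C x (Dom C i)"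
    then have [simp]: "g \<in> Arr C" "Dom C g = x" "Cod C g = Dom C i"
      by (auto simp: hom_def)
    have "g \<cdot> i = f"
      using i by (intro terminal_eq [OF t]) simp_all
    then show "g = f \<cdot> Inv C i"
      using i by auto
  qed
qed

lemma dbl_prod_simps [simp]:
  "tight (dbl_prod D E) = cat_prod (tight D) (tight E)" "loose (dbl_prod D E) = cat_prod (loose D) (loose E)"
  "src (dbl_prod D E) = func_prod (src D) (src E)" "tgt (dbl_prod D E) = func_prod (tgt D) (tgt E)"
  "units (dbl_prod D E) = func_prod (units D) (units E)"
  "lcomp (dbl_prod D E) (A, A') (B, B') = (lcomp D A B, lcomp E A' B')"
  "ccomp (dbl_prod D E) (a, a') (b, b') = (ccomp D a b, ccomp E a' b')"
  by (simp_all add: dbl_prod_def)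

lemma func_prod_simps [simp]:
  "fobj (func_prod F G) = map_prod (fobj F) (fobj G)" "farr (func_prod F G) = map_prod (farr F) (farr G)"
  by (simp_all add: func_prod_def)

lemma dbl_one_simps [simp]:
  "tight dbl_one = cat_one" "loose dbl_one = cat_one"
  by (simp_all add: dbl_one_def)

text \<open>What is used of a cartesian equipment from here on, with the two right adjoints replaced
  by chosen products. Their comparison cells are absorbed: \<open>lcomp_product\<close>,
  \<open>li_product\<close> and \<open>li_unit_terminal\<close> say that composites and units of
  such products are again products or terminal. \<open>lp_sides\<close> records that the products of
  loose arrows lie over those of their ends.\<close>

locale cart_equip = equip +
  fixes unit :: 'a and oprod :: "'a \<Rightarrow> 'a \<Rightarrow> 'a" and lprod :: "'c \<Rightarrow> 'c \<Rightarrow> 'c"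
    and op1 op2 :: "'a \<Rightarrow> 'a \<Rightarrow> 'b" and lp1 lp2 :: "'c \<Rightarrow> 'c \<Rightarrow> 'd"
  assumes unit_terminal: "is_terminal (tight D) unit"
    and li_unit_terminal: "is_terminal (loose D) (li unit)"
    and oprod_product: "I \<in> Tob \<Longrightarrow> J \<in> Tob \<Longrightarrow> is_product (tight D) I J (oprod I J) (op1 I J) (op2 I J)"
    and lprod_product: "A \<in> Lo \<Longrightarrow> B \<in> Lo \<Longrightarrow> is_product (loose D) A B (lprod A B) (lp1 A B) (lp2 A B)"
    and lp_sides: "A \<in> Lo \<Longrightarrow> B \<in> Lo \<Longrightarrow> sd (lp1 A B) = op1 (so A) (so B)"
      "A \<in> Lo \<Longrightarrow> B \<in> Lo \<Longrightarrow> sd (lp2 A B) = op2 (so A) (so B)"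
      "A \<in> Lo \<Longrightarrow> B \<in> Lo \<Longrightarrow> td (lp1 A B) = op1 (to A) (to B)"
      "A \<in> Lo \<Longrightarrow> B \<in> Lo \<Longrightarrow> td (lp2 A B) = op2 (to A) (to B)"
    and lcomp_product: "A \<in> Lo \<Longrightarrow> B \<in> Lo \<Longrightarrow> A' \<in> Lo \<Longrightarrow> B' \<in> Lo \<Longrightarrow> to A = so A' \<Longrightarrow> to B = so B' \<Longrightarrow>
      is_product (loose D) (A \<odot> A') (B \<odot> B') (lprod A B \<odot> lprod A' B')
        (lp1 A B \<star> lp1 A' B') (lp2 A B \<star> lp2 A' B')"
    and li_product: "I \<in> Tob \<Longrightarrow> J \<in> Tob \<Longrightarrow>
      is_product (loose D) (li I) (li J) (li (oprod I J)) (un (op1 I J)) (un (op2 I J))"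

text \<open>The components of the two adjunctions give terminal objects and products among tight
  arrows and among cells. Compatibility of the counit with the comparison cells of the right adjoint
  says that such a cell followed by a projection is a composite, or a unit cell, of projections;
  invertibility then transports the universal property.\<close>

lemma cart_equip_exists:
  fixes D :: "('o, 't, 'l, 'c) dblcat" (structure)
  assumes "cartesian_equipment D"
  shows "\<exists>u op lp p1 p2 l1 l2. cart_equip D u op lp p1 p2 l1 l2"
proof -
  interpret equip D
    using assms by (simp add: cartesian_equipment_def equipment_def equip_def equip_axioms_def)
  obtain G1 \<eta>1 \<epsilon>1 where A1: "double_adjunction D dbl_one dfunc_bang G1 \<eta>1 \<epsilon>1"
    using assms by (auto simp: cartesian_equipment_def has_right_adjoint_def)
  obtain G \<eta> \<epsilon> where A: "double_adjunction D (dbl_prod D D) (dfunc_diag D) G \<eta> \<epsilon>"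
    using assms by (auto simp: cartesian_equipment_def has_right_adjoint_def)

  have G1: "double_functor dbl_one D G1"
    and t1: "tight_transformation D D (dfunc_id D) (dfunc_comp D dfunc_bang G1) \<eta>1"
    using A1 by (simp_all add: double_adjunction_def)
  interpret T1: is_functor cat_one "tight D" "dftight G1"
    using double_functor.tight_functor [OF G1] by simp
  interpret L1: is_functor cat_one "loose D" "dfloose G1"
    using double_functor.loose_functor [OF G1] by simp
  let ?u = "fobj (dftight G1) ()"
  have u: "is_terminal (tight D) ?u"
  proof (rule src.B.terminal_from_adjunction)
    show "tight_at \<eta>1 x \<in> hom (tight D) x ?u" if "x \<in> Tob" for x
      using tight_transformation.tight_at_hom [OF t1 that]
      by (simp add: dfunc_id_def dfunc_comp_def func_id_def func_comp_def dfunc_bang_def)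
    show "f \<Zcomp> tight_at \<eta>1 (tcod f) = tight_at \<eta>1 (tdom f) \<Zcomp> farr (dftight G1) ()"
      if "f \<in> Ti" for f
      using tight_transformation.tight_natural [OF t1, of f "tdom f" "tcod f"] that
      by (simp add: dfunc_id_def dfunc_comp_def func_id_def func_comp_def dfunc_bang_def hom_def)
    show "tight_at \<eta>1 ?u \<Zcomp> farr (dftight G1) () = idt ?u"
      using A1 by (simp add: double_adjunction_def)
  qed (rule T1.is_functor_axioms)
  have "is_terminal (loose D) (fobj (dfloose G1) ())"
  proof (rule src.A.terminal_from_adjunction)
    show "loose_at \<eta>1 x \<in> hom (loose D) x (fobj (dfloose G1) ())" if "x \<in> Lo" for x
      using tight_transformation.loose_at_hom [OF t1 that]
      by (simp add: dfunc_id_def dfunc_comp_def func_id_def func_comp_def dfunc_bang_def)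
    show "f \<Zsemi> loose_at \<eta>1 (cd f) = loose_at \<eta>1 (dm f) \<Zsemi> farr (dfloose G1) ()"
      if "f \<in> Cell" for f
      using tight_transformation.loose_natural [OF t1, of f "dm f" "cd f"] that
      by (simp add: dfunc_id_def dfunc_comp_def func_id_def func_comp_def dfunc_bang_def hom_def)
    show "loose_at \<eta>1 (fobj (dfloose G1) ()) \<Zsemi> farr (dfloose G1) () = idl (fobj (dfloose G1) ())"
      using A1 by (simp add: double_adjunction_def)
  qed (rule L1.is_functor_axioms)
  \<comment> \<open>The right adjoint preserves units up to isomorphism, so terminality is moved
    along \<open>dfunit\<close> to the unit on the terminal object.\<close>
  moreover have "globular_iso D (dfunit G1 ()) (li ?u) (fobj (dfloose G1) ())"
    using double_functor.dfunit_iso [OF G1, of "()"] by (simp add: dbl_one_def func_id_def)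
  ultimately have lu: "is_terminal (loose D) (li ?u)"
    using src.A.terminal_iso [of "fobj (dfloose G1) ()" "dfunit G1 ()"] globularD by metis

  let ?E = "dbl_prod D D"
  have GG: "double_functor ?E D G" and E: "double_category ?E"
    and te: "tight_transformation D D (dfunc_id D) (dfunc_comp D (dfunc_diag D) G) \<eta>"
    and tc: "tight_transformation ?E ?E (dfunc_comp ?E G (dfunc_diag D)) (dfunc_id ?E) \<epsilon>"
    using A by (simp_all add: double_adjunction_def equipment_def)
  interpret T: is_functor "cat_prod (tight D) (tight D)" "tight D" "dftight G"
    using double_functor.tight_functor [OF GG] by simp
  interpret L: is_functor "cat_prod (loose D) (loose D)" "loose D" "dfloose G"
    using double_functor.loose_functor [OF GG] by simp
  let ?op = "\<lambda>I J. fobj (dftight G) (I, J)" and ?lp = "\<lambda>A B. fobj (dfloose G) (A, B)"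
  let ?p1 = "\<lambda>I J. fst (tight_at \<epsilon> (I, J))" and ?p2 = "\<lambda>I J. snd (tight_at \<epsilon> (I, J))"
  let ?l1 = "\<lambda>A B. fst (loose_at \<epsilon> (A, B))" and ?l2 = "\<lambda>A B. snd (loose_at \<epsilon> (A, B))"
  note defs = dfunc_id_def dfunc_comp_def func_id_def func_comp_def dfunc_diag_def func_pair_def

  have oprod: "is_product (tight D) I J (?op I J) (?p1 I J) (?p2 I J)" if "I \<in> Tob" "J \<in> Tob" for I J
  proof (rule src.B.product_from_adjunction [where \<eta> = "tight_at \<eta>"])
    show "tight_at \<eta> x \<in> hom (tight D) x (?op x x)" if "x \<in> Tob" for x
      using tight_transformation.tight_at_hom [OF te that] by (simp add: defs)
    show "f \<Zcomp> tight_at \<eta> (tcod f) = tight_at \<eta> (tdom f) \<Zcomp> farr (dftight G) (f, f)"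
      if "f \<in> Ti" for f
      using tight_transformation.tight_natural [OF te, of f "tdom f" "tcod f"] that
      by (simp add: defs hom_def)
    show "tight_at \<epsilon> (x, y) \<in> hom (cat_prod (tight D) (tight D)) (?op x y, ?op x y) (x, y)"
      if "x \<in> Tob" "y \<in> Tob" for x y
      using tight_transformation.tight_at_hom [OF tc, of "(x, y)"] that by (simp add: defs)
    show "(farr (dftight G) (f, g), farr (dftight G) (f, g)) \<cdot>\<^bsub>cat_prod (tight D) (tight D)\<^esub>
        tight_at \<epsilon> (tcod f, tcod g) =
      tight_at \<epsilon> (tdom f, tdom g) \<cdot>\<^bsub>cat_prod (tight D) (tight D)\<^esub> (f, g)"
      if "f \<in> Ti" "g \<in> Ti" for f g
      using tight_transformation.tight_natural [OF tc, of "(f, g)" "(tdom f, tdom g)"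
          "(tcod f, tcod g)"] that by (simp add: defs hom_def)
    show "(tight_at \<eta> x, tight_at \<eta> x) \<cdot>\<^bsub>cat_prod (tight D) (tight D)\<^esub> tight_at \<epsilon> (x, x) = (idt x, idt x)"
      if "x \<in> Tob" for x
      using A that by (simp add: double_adjunction_def dfunc_diag_def func_pair_def func_id_def)
    show "tight_at \<eta> (?op x y) \<Zcomp> farr (dftight G) (tight_at \<epsilon> (x, y)) = idt (?op x y)"
      if "x \<in> Tob" "y \<in> Tob" for x y
      using A that by (simp add: double_adjunction_def)
  qed (use that T.is_functor_axioms in simp_all)
  have lprod: "is_product (loose D) A B (?lp A B) (?l1 A B) (?l2 A B)" if "A \<in> Lo" "B \<in> Lo" for A B
  proof (rule src.A.product_from_adjunction [where \<eta> = "loose_at \<eta>"])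
    show "loose_at \<eta> x \<in> hom (loose D) x (?lp x x)" if "x \<in> Lo" for x
      using tight_transformation.loose_at_hom [OF te that] by (simp add: defs)
    show "f \<Zsemi> loose_at \<eta> (cd f) = loose_at \<eta> (dm f) \<Zsemi> farr (dfloose G) (f, f)"
      if "f \<in> Cell" for f
      using tight_transformation.loose_natural [OF te, of f "dm f" "cd f"] that
      by (simp add: defs hom_def)
    show "loose_at \<epsilon> (x, y) \<in> hom (cat_prod (loose D) (loose D)) (?lp x y, ?lp x y) (x, y)"
      if "x \<in> Lo" "y \<in> Lo" for x y
      using tight_transformation.loose_at_hom [OF tc, of "(x, y)"] that by (simp add: defs)
    show "(farr (dfloose G) (f, g), farr (dfloose G) (f, g)) \<cdot>\<^bsub>cat_prod (loose D) (loose D)\<^esub>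
        loose_at \<epsilon> (cd f, cd g) = loose_at \<epsilon> (dm f, dm g) \<cdot>\<^bsub>cat_prod (loose D) (loose D)\<^esub> (f, g)"
      if "f \<in> Cell" "g \<in> Cell" for f g
      using tight_transformation.loose_natural [OF tc, of "(f, g)" "(dm f, dm g)" "(cd f, cd g)"] that
      by (simp add: defs hom_def)
    show "(loose_at \<eta> x, loose_at \<eta> x) \<cdot>\<^bsub>cat_prod (loose D) (loose D)\<^esub> loose_at \<epsilon> (x, x) = (idl x, idl x)"
      if "x \<in> Lo" for x
      using A that by (simp add: double_adjunction_def dfunc_diag_def func_pair_def func_id_def)
    show "loose_at \<eta> (?lp x y) \<Zsemi> farr (dfloose G) (loose_at \<epsilon> (x, y)) = idl (?lp x y)"
      if "x \<in> Lo" "y \<in> Lo" for x y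
      using A that by (simp add: double_adjunction_def)
  qed (use that L.is_functor_axioms in simp_all)
  have sides: "sd (?l1 A B) = ?p1 (so A) (so B)" "sd (?l2 A B) = ?p2 (so A) (so B)"
    "td (?l1 A B) = ?p1 (to A) (to B)" "td (?l2 A B) = ?p2 (to A) (to B)"
    if "A \<in> Lo" "B \<in> Lo" for A B
    using arg_cong [OF tight_transformation.src_loose_at [OF tc, of "(A, B)"], of fst]
      arg_cong [OF tight_transformation.src_loose_at [OF tc, of "(A, B)"], of snd]
      arg_cong [OF tight_transformation.tgt_loose_at [OF tc, of "(A, B)"], of fst]
      arg_cong [OF tight_transformation.tgt_loose_at [OF tc, of "(A, B)"], of snd] that
    by simp_all
  have lcomp: "is_product (loose D) (A \<odot> A') (B \<odot> B') (?lp A B \<odot> ?lp A' B')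
        (?l1 A B \<star> ?l1 A' B') (?l2 A B \<star> ?l2 A' B')"
    if [simp]: "A \<in> Lo" "B \<in> Lo" "A' \<in> Lo" "B' \<in> Lo" "to A = so A'" "to B = so B'" for A B A' B'
  proof -
    let ?i = "dfcomp G (A, B) (A', B')"
    have c: "composable2 ?E (A, B) (A', B')"
      by (simp add: double_category.composable2_iff [OF E])
    have "globular_iso D ?i (?lp A B \<odot> ?lp A' B') (?lp (A \<odot> A') (B \<odot> B'))"
      using double_functor.dfcomp_iso [OF GG c] by simp
    note i = globularD [OF this]
    note [simp] = i(1-3)
    have lo [simp]: "?lp A B \<in> Lo" "?lp A' B' \<in> Lo" "to (?lp A B) = so (?lp A' B')"
      using L.fobj_Obj_simp [of "(A, B)"] L.fobj_Obj_simp [of "(A', B')"]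
        double_functor.tgt_loose [OF GG, of "(A, B)"] double_functor.src_loose [OF GG, of "(A', B')"]
      by simp_all
    \<comment> \<open>Composition in \<open>cat_prod\<close> is computed by the simplifier on
      explicit pairs, so the components of the counit are split first.\<close>
    obtain a1 a2 b1 b2 c1 c2 where e: "loose_at \<epsilon> (A, B) = (a1, a2)" "loose_at \<epsilon> (A', B') = (b1, b2)"
      "loose_at \<epsilon> (A \<odot> A', B \<odot> B') = (c1, c2)"
      by (meson surj_pair)
    have ma: "td (?l1 A B) = sd (?l1 A' B')" "td (?l2 A B) = sd (?l2 A' B')"
      by (simp_all add: sides)
    have "?i \<Zsemi> ?l1 (A \<odot> A') (B \<odot> B') = ?l1 A B \<star> ?l1 A' B' \<and>
        ?i \<Zsemi> ?l2 (A \<odot> A') (B \<odot> B') = ?l2 A B \<star> ?l2 A' B'"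
      using tight_transformation.dfcomp_compat [OF tc c] ma src.A.product_simps [OF lprod [of A B]]
        src.A.product_simps [OF lprod [of A' B']] src.A.product_simps [OF lprod [of "A \<odot> A'" "B \<odot> B'"]]
      by (simp add: defs e)
    then show ?thesis
      using src.A.product_precomp_iso [OF lprod [of "A \<odot> A'" "B \<odot> B'"] i(1)] by simp
  qed
  have li: "is_product (loose D) (li I) (li J) (li (?op I J)) (un (?p1 I J)) (un (?p2 I J))"
    if [simp]: "I \<in> Tob" "J \<in> Tob" for I J
  proof -
    let ?i = "dfunit G (I, J)"
    have "globular_iso D ?i (li (?op I J)) (?lp (li I) (li J))"
      using double_functor.dfunit_iso [OF GG, of "(I, J)"] by simp
    note i = globularD [OF this]
    note [simp] = i(1-3)
    obtain a1 a2 f1 f2 where e: "loose_at \<epsilon> (li I, li J) = (a1, a2)" "tight_at \<epsilon> (I, J) = (f1, f2)"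
      by (meson surj_pair)
    have "?i \<Zsemi> ?l1 (li I) (li J) = un (?p1 I J) \<and> ?i \<Zsemi> ?l2 (li I) (li J) = un (?p2 I J)"
      using tight_transformation.dfunit_compat [OF tc, of "(I, J)"]
        src.A.product_simps [OF lprod [of "li I" "li J"]] src.B.product_simps [OF oprod [of I J]]
      by (simp add: defs e)
    then show ?thesis
      using src.A.product_precomp_iso [OF lprod [of "li I" "li J"] i(1)] by simp
  qed
  have "cart_equip D ?u ?op ?lp ?p1 ?p2 ?l1 ?l2"
    by unfold_locales (use u lu oprod lprod sides lcomp li in simp_all)
  then show ?thesis by blast
qed

section \<open>Hom-categories of loose arrows and of maps\<close>

context double_category
begin

lemma bhom_LB_simps [simp]:
  "Obj (bhom LB I J) = {A \<in> Lo. so A = I \<and> to A = J}" "Dom (bhom LB I J) = dm" "Cod (bhom LB I J) = cd"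
  "Ident (bhom LB I J) = idl" "Comp (bhom LB I J) = Comp (loose D)"
  by (auto simp: bhom_def)

lemma hom_bhom_LB:
  "a \<in> hom (bhom LB I J) A B \<longleftrightarrow> a \<in> Cell \<and> dm a = A \<and> cd a = B \<and> sd a = idt I \<and> td a = idt J \<and>
    so A = I \<and> to A = J \<and> so B = I \<and> to B = J"
  unfolding bhom_def hom_full_subcat by (auto simp: hom_cells_LB)

lemma category_bhom_LB: "category (bhom LB I J)"
  unfolding bhom_def by (intro category_full_subcat category_cells_LB)

abbreviation "MB \<equiv> map_bicat LB"

lemma MB_simps [simp]:
  "Ob MB = Tob" "bsrc MB = so" "btgt MB = to" "bid MB = li" "bcomp MB = lcomp D" "hcomp MB = ccomp D"
  "cell_id MB = idl"
  "A \<in> one_cells MB I J \<longleftrightarrow> A \<in> Lo \<and> so A = I \<and> to A = J \<and> is_map LB A"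
  by (auto simp: map_bicat_def one_cells_def)

lemma bhom_MB_simps [simp]:
  "Obj (bhom MB I J) = {A \<in> Lo. so A = I \<and> to A = J \<and> is_map LB A}" "Dom (bhom MB I J) = dm"
  "Cod (bhom MB I J) = cd" "Ident (bhom MB I J) = idl" "Comp (bhom MB I J) = Comp (loose D)"
  by (auto simp: bhom_def map_bicat_def one_cells_def)

lemma hom_bhom_MB:
  "a \<in> hom (bhom MB I J) A B \<longleftrightarrow> is_map LB A \<and> is_map LB B \<and> a \<in> Cell \<and> dm a = A \<and> cd a = B \<and>
    sd a = idt I \<and> td a = idt J \<and> so A = I \<and> to A = J \<and> so B = I \<and> to B = J"
proof -
  have "a \<in> hom (bhom MB I J) A B \<longleftrightarrow> is_map LB A \<and> is_map LB B \<and> a \<in> hom (bhom LB I J) A B"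
    by (auto simp: bhom_def map_bicat_def hom_full_subcat one_cells_def hom_cells_LB)
  then show ?thesis by (simp add: hom_bhom_LB)
qed

lemma category_bhom_MB: "category (bhom MB I J)"
  unfolding bhom_def map_bicat_def by (simp add: category_full_subcat category_cells_LB)

lemma invertible_bhom_MB:
  assumes "Iso a" "a \<in> hom (bhom MB I J) A B"
  shows "invertible (bhom MB I J) a"
proof -
  interpret M: category "bhom MB I J" by (rule category_bhom_MB)
  have *: "is_map LB A" "is_map LB B" "a \<in> Cell" "dm a = A" "cd a = B"
    "sd a = idt I" "td a = idt J" "so A = I" "to A = J" "so B = I" "to B = J"
    using assms(2) by (simp_all add: hom_bhom_MB)
  then have "I \<in> Tob" "J \<in> Tob"
    using src.fobj_Obj [of A] tgt.fobj_Obj [of A] src.A.Dom_Obj [of a] by auto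
  then have "vinv a \<in> hom (bhom MB I J) B A"
    using * assms(1) by (simp add: hom_bhom_MB)
  then show ?thesis
    using assms * by (intro M.invertibleI [where g = "vinv a"]) (simp_all add: hom_def)
qed

end

lemma equivalent_cat_oneI:
  assumes C: "category C" and x: "x \<in> Obj C"
    and uniq: "\<And>y z. y \<in> Obj C \<Longrightarrow> z \<in> Obj C \<Longrightarrow> \<exists>!f. f \<in> hom C y z"
  shows "equivalent_cats C cat_one"
proof -
  let ?F = "\<lparr>fobj = \<lambda>_. (), farr = \<lambda>_. ()\<rparr>"
  interpret C: category C by (rule C)
  interpret O: category cat_one by (rule category_cat_one)
  interpret F: is_functor C cat_one ?F
    by unfold_locales (simp_all add: hom_def)
  have "is_equivalence C cat_one ?F"
  proof (rule F.is_equivalenceI)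
    show "\<exists>x\<in>Obj C. \<exists>i\<in>hom cat_one (fobj ?F x) b. invertible cat_one i" for b
      using x O.invertible_Ident [of b] by (auto simp: hom_def)
  qed (use uniq in auto)
  then show ?thesis by (auto simp: equivalent_cats_def)
qed

context cart_equip
begin

lemma oprod_simps [simp]:
  assumes "I \<in> Tob" "J \<in> Tob"
  shows "oprod I J \<in> Tob" "op1 I J \<in> Ti" "op2 I J \<in> Ti" "tdom (op1 I J) = oprod I J"
    "tdom (op2 I J) = oprod I J" "tcod (op1 I J) = I" "tcod (op2 I J) = J"
  using src.B.product_simps [OF oprod_product [OF assms]] by simp_all

lemma lprod_simps [simp]:
  assumes "A \<in> Lo" "B \<in> Lo"
  shows "lprod A B \<in> Lo" "so (lprod A B) = oprod (so A) (so B)" "to (lprod A B) = oprod (to A) (to B)"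
    "lp1 A B \<in> Cell" "lp2 A B \<in> Cell" "dm (lp1 A B) = lprod A B" "dm (lp2 A B) = lprod A B"
    "cd (lp1 A B) = A" "cd (lp2 A B) = B"
    "sd (lp1 A B) = op1 (so A) (so B)" "sd (lp2 A B) = op2 (so A) (so B)"
    "td (lp1 A B) = op1 (to A) (to B)" "td (lp2 A B) = op2 (to A) (to B)"
proof -
  note p = src.A.product_simps [OF lprod_product [OF assms]]
  show "lprod A B \<in> Lo" "lp1 A B \<in> Cell" "lp2 A B \<in> Cell" "dm (lp1 A B) = lprod A B"
    "dm (lp2 A B) = lprod A B" "cd (lp1 A B) = A" "cd (lp2 A B) = B"
    using p by simp_all
  show s: "sd (lp1 A B) = op1 (so A) (so B)" "sd (lp2 A B) = op2 (so A) (so B)"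
    "td (lp1 A B) = op1 (to A) (to B)" "td (lp2 A B) = op2 (to A) (to B)"
    using lp_sides assms by simp_all
  show "so (lprod A B) = oprod (so A) (so B)" "to (lprod A B) = oprod (to A) (to B)"
    using tsides(1) [OF p(2) s(1)] tsides(2) [OF p(2) s(3)] assms by (simp_all add: p(4))
qed

lemma unit_Tob [simp]: "unit \<in> Tob"
  using unit_terminal by (simp add: is_terminal_def)

text \<open>Used to recognise that a cell obtained from a product of loose arrows is globular: its
  sides fix both tight projections.\<close>

lemma oprod_eq_idt:
  assumes "I \<in> Tob" "J \<in> Tob" "f \<in> Ti" "tdom f = oprod I J" "tcod f = oprod I J"
    "f \<Zcomp> op1 I J = op1 I J" "f \<Zcomp> op2 I J = op2 I J"
  shows "f = idt (oprod I J)"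
  by (rule src.B.product_eq [OF oprod_product [OF assms(1,2)]]) (use assms in simp_all)

subsection \<open>Products in the hom-categories\<close>

text \<open>The terminal loose arrow \<open>li unit\<close> has the wrong ends in general; its
  restriction along the unique tight arrows to \<open>unit\<close> has the right ones.\<close>

lemma bhom_terminal:
  assumes [simp]: "I \<in> Tob" "J \<in> Tob"
  shows "\<exists>t. is_terminal (bhom LB I J) t"
proof -
  obtain f where f [simp]: "f \<in> Ti" "tdom f = I" "tcod f = unit"
    using src.B.terminal_ex [OF unit_terminal assms(1)] by metis
  obtain g where g [simp]: "g \<in> Ti" "tdom g = J" "tcod g = unit"
    using src.B.terminal_ex [OF unit_terminal assms(2)] by metis
  obtain \<phi> where ca: "cartesian \<phi>" and \<phi> [simp]: "\<phi> \<in> Cell" "cd \<phi> = li unit" "sd \<phi> = f" "td \<phi> = g"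
    by (rule cartesian_lift [of "li unit" f g]) simp_all
  have [simp]: "so (dm \<phi>) = I" "to (dm \<phi>) = J"
    using tsides [of \<phi>] by simp_all
  have "\<exists>!k. k \<in> hom (bhom LB I J) x (dm \<phi>)" if x [simp]: "x \<in> Lo" "so x = I" "to x = J" for x
  proof -
    obtain c where c [simp]: "c \<in> Cell" "dm c = x" "cd c = li unit"
      by (rule src.A.terminal_ex [OF li_unit_terminal x(1)])
    \<comment> \<open>The sides of any cell into \<open>li unit\<close> are forced,
      \<open>unit\<close> being terminal in the tight category.\<close>
    have [simp]: "sd c = f" "td c = g"
      by (rule src.B.terminal_eq [OF unit_terminal]; simp)+
    obtain k where k: "k \<in> Cell" "dm k = dm c" "cd k = dm \<phi>" "sd k = idt I" "td k = idt J" "k \<Zsemi> \<phi> = c"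
      by (rule cartesian_factor [OF ca, of c "idt I" "idt J"]) simp_all
    show ?thesis
    proof (rule ex1I [of _ k])
      show "k \<in> hom (bhom LB I J) x (dm \<phi>)"
        using k by (simp add: hom_bhom_LB)
      fix k' assume "k' \<in> hom (bhom LB I J) x (dm \<phi>)"
      then have k' [simp]: "k' \<in> Cell" "dm k' = x" "cd k' = dm \<phi>" "sd k' = idt I" "td k' = idt J"
        by (simp_all add: hom_bhom_LB)
      show "k' = k"
      proof (rule cartesian_eq [OF ca])
        show "k' \<Zsemi> \<phi> = k \<Zsemi> \<phi>"
          using k by (intro src.A.terminal_eq [OF li_unit_terminal]) simp_all
      qed (use k in simp_all)
    qed
  qed
  then have "is_terminal (bhom LB I J) (dm \<phi>)"
    by (simp add: is_terminal_def)
  then show ?thesis by blast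
qed

text \<open>The meet is the restriction of \<open>lprod A B\<close> along the two diagonals. Two
  globular cells pair to a cell whose sides compose with the tight projections to identities; the
  sides are therefore the diagonals, and the cell factors through the restriction.\<close>

lemma bhom_product:
  assumes [simp]: "I \<in> Tob" "J \<in> Tob" "A \<in> Lo" "B \<in> Lo" "so A = I" "to A = J" "so B = I" "to B = J"
  shows "\<exists>m \<pi> \<rho>. is_product (bhom LB I J) A B m \<pi> \<rho>"
proof -
  obtain f where f [simp]: "f \<in> Ti" "tdom f = I" "tcod f = oprod I I"
      "f \<Zcomp> op1 I I = idt I" "f \<Zcomp> op2 I I = idt I"
    by (rule src.B.product_ex [OF oprod_product [of I I], of "idt I" "idt I" I]) simp_all
  obtain g where g [simp]: "g \<in> Ti" "tdom g = J" "tcod g = oprod J J"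
      "g \<Zcomp> op1 J J = idt J" "g \<Zcomp> op2 J J = idt J"
    by (rule src.B.product_ex [OF oprod_product [of J J], of "idt J" "idt J" J]) simp_all
  obtain \<phi> where ca: "cartesian \<phi>" and \<phi> [simp]: "\<phi> \<in> Cell" "cd \<phi> = lprod A B" "sd \<phi> = f" "td \<phi> = g"
    by (rule cartesian_lift [of "lprod A B" f g]) simp_all
  have [simp]: "so (dm \<phi>) = I" "to (dm \<phi>) = J"
    using tsides [of \<phi>] by simp_all
  interpret B: category "bhom LB I J" by (rule category_bhom_LB)
  have "is_product (bhom LB I J) A B (dm \<phi>) (\<phi> \<Zsemi> lp1 A B) (\<phi> \<Zsemi> lp2 A B)"
    unfolding is_product_def
  proof (intro conjI ballI)
    fix x a b assume "a \<in> hom (bhom LB I J) x A" "b \<in> hom (bhom LB I J) x B"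
    then have ab [simp]: "a \<in> Cell" "dm a = x" "cd a = A" "sd a = idt I" "td a = idt J"
      "b \<in> Cell" "dm b = x" "cd b = B" "sd b = idt I" "td b = idt J" "so x = I" "to x = J"
      by (simp_all add: hom_bhom_LB)
    have [simp]: "x \<in> Lo"
      using src.A.Dom_Obj [OF ab(1)] by simp
    obtain c where c [simp]: "c \<in> Cell" "dm c = x" "cd c = lprod A B" "c \<Zsemi> lp1 A B = a" "c \<Zsemi> lp2 A B = b"
      by (rule src.A.product_ex [OF lprod_product [of A B], of a b x]) simp_all
    have "sd c \<Zcomp> op1 I I = sd (c \<Zsemi> lp1 A B)" "sd c \<Zcomp> op2 I I = sd (c \<Zsemi> lp2 A B)"
      "td c \<Zcomp> op1 J J = td (c \<Zsemi> lp1 A B)" "td c \<Zcomp> op2 J J = td (c \<Zsemi> lp2 A B)"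
      using src.farr_Comp_Arr [of c "lp1 A B"] src.farr_Comp_Arr [of c "lp2 A B"]
        tgt.farr_Comp_Arr [of c "lp1 A B"] tgt.farr_Comp_Arr [of c "lp2 A B"] by simp_all
    then have [simp]: "sd c = f" "td c = g"
      by - (rule src.B.product_eq [OF oprod_product [of I I]], simp_all,
        rule src.B.product_eq [OF oprod_product [of J J]], simp_all)
    obtain k where k: "k \<in> Cell" "dm k = dm c" "cd k = dm \<phi>" "sd k = idt I" "td k = idt J" "k \<Zsemi> \<phi> = c"
      by (rule cartesian_factor [OF ca, of c "idt I" "idt J"]) simp_all
    have kl: "k \<Zsemi> \<phi> \<Zsemi> lp1 A B = a" "k \<Zsemi> \<phi> \<Zsemi> lp2 A B = b"
      using k(1-5) arg_cong [OF k(6), of "\<lambda>x. x \<Zsemi> lp1 A B"] arg_cong [OF k(6), of "\<lambda>x. x \<Zsemi> lp2 A B"]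
      by simp_all
    have "h = k" if "h \<in> hom (bhom LB I J) x (dm \<phi>) \<and> h \<Zsemi> \<phi> \<Zsemi> lp1 A B = a \<and> h \<Zsemi> \<phi> \<Zsemi> lp2 A B = b" for h
    proof (rule cartesian_eq [OF ca])
      have h: "h \<in> Cell" "dm h = x" "cd h = dm \<phi>" "sd h = idt I" "td h = idt J"
        "h \<Zsemi> \<phi> \<Zsemi> lp1 A B = a" "h \<Zsemi> \<phi> \<Zsemi> lp2 A B = b"
        using that by (simp_all add: hom_bhom_LB)
      show "h \<Zsemi> \<phi> = k \<Zsemi> \<phi>"
        by (rule src.A.product_eq [OF lprod_product [of A B]]) (use h k kl in simp_all)
      show "h \<in> Cell" "dm h = dm k" "cd h = dm \<phi>" "sd h = sd k" "td h = td k"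
        using h k by simp_all
    qed (use k in simp_all)
    then show "\<exists>!h. h \<in> hom (bhom LB I J) x (dm \<phi>) \<and> h \<cdot>\<^bsub>bhom LB I J\<^esub> (\<phi> \<Zsemi> lp1 A B) = a \<and>
        h \<cdot>\<^bsub>bhom LB I J\<^esub> (\<phi> \<Zsemi> lp2 A B) = b"
      by (rule ex1I [of _ k, rotated]) (use k kl in \<open>simp_all add: hom_bhom_LB\<close>)
  qed (simp_all add: hom_bhom_LB)
  then show ?thesis by blast
qed

lemma bhom_finite_products:
  "I \<in> Tob \<Longrightarrow> J \<in> Tob \<Longrightarrow> has_finite_products (bhom LB I J)"
  using bhom_terminal bhom_product by (auto simp: has_finite_products_def)

subsection \<open>Products of maps\<close>

lemma is_map_Lo: "is_map LB f \<Longrightarrow> f \<in> Lo"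
  by (auto simp: is_map_def adjunction_LB_iff adj_data_def)

lemma is_map_cmp: "f \<in> Ti \<Longrightarrow> is_map LB (cmp f)"
  using adjunction_cmp_cnj by (auto simp: is_map_def)

text \<open>Transposition turns globular cells \<open>x \<rightarrow> f\<close> between maps into
  \<open>unit\<close> into cells from \<open>g \<odot> x\<close> to the terminal
  \<open>li unit\<close>, so there is exactly one. The hom-category is thus indiscrete, and the
  companion of the unique tight arrow to \<open>unit\<close> inhabits it.\<close>

lemma MB_terminal: "bicat_terminal MB unit"
  unfolding bicat_terminal_def
proof (intro conjI ballI)
  fix K assume "K \<in> Ob MB"
  then have [simp]: "K \<in> Tob" by simp
  obtain t where t [simp]: "t \<in> Ti" "tdom t = K" "tcod t = unit"
    using src.B.terminal_ex [OF unit_terminal, of K] by auto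
  show "equivalent_cats (bhom MB K unit) cat_one"
  proof (rule equivalent_cat_oneI [OF category_bhom_MB, of "cmp t"])
    show "cmp t \<in> Obj (bhom MB K unit)"
      by (simp add: is_map_cmp)
    fix x f assume "x \<in> Obj (bhom MB K unit)" "f \<in> Obj (bhom MB K unit)"
    then have xf [simp]: "x \<in> Lo" "so x = K" "to x = unit" "f \<in> Lo" "so f = K" "to f = unit"
      and m: "is_map LB x" "is_map LB f" by simp_all
    obtain g \<eta> \<epsilon> where adj: "adjunction LB f g \<eta> \<epsilon>"
      using m(2) by (auto simp: is_map_def)
    then have d: "adj_data f g \<eta> \<epsilon>" by (simp add: adjunction_LB_iff)
    note [simp] = adj_dataD [OF d]
    obtain b where b [simp]: "b \<in> Cell" "dm b = g \<odot> x" "cd b = li unit"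
      using src.A.terminal_ex [OF li_unit_terminal, of "g \<odot> x"] by auto
    have [simp]: "sd b = idt unit" "td b = idt unit"
      by (rule src.B.terminal_eq [OF unit_terminal]; simp)+
    show "\<exists>!u. u \<in> hom (bhom MB K unit) x f"
    proof (rule ex1I)
      show "vinv (lu x) \<Zsemi> (\<eta> \<star> idl x) \<Zsemi> as f g x \<Zsemi> (idl f \<star> b) \<Zsemi> ru f \<in> hom (bhom MB K unit) x f"
        using m by (simp add: hom_bhom_MB)
      fix u assume "u \<in> hom (bhom MB K unit) x f"
      then have u [simp]: "u \<in> Cell" "dm u = x" "cd u = f" "sd u = idt K" "td u = idt unit"
        by (simp_all add: hom_bhom_MB)
      have "(idl g \<star> u) \<Zsemi> \<epsilon> = b"
        by (rule src.A.terminal_eq [OF li_unit_terminal]) simp_all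
      then show "u = vinv (lu x) \<Zsemi> (\<eta> \<star> idl x) \<Zsemi> as f g x \<Zsemi> (idl f \<star> b) \<Zsemi> ru f"
        using flat_sharp [OF adj, of u x] by simp
    qed
  qed
qed simp

text \<open>The mates of \<open>a\<close> and \<open>b\<close> are cells from
  \<open>g \<odot> x\<close> to \<open>li I\<close> and \<open>li J\<close>, a cone over the product
  of units. Its pairing \<open>w\<close> is the transpose of the required \<open>u\<close>:
  \<open>mate_whisker\<close> computes the mates of the whiskerings of \<open>u\<close>, and
  \<open>mate_eq\<close> cancels the mates.\<close>

lemma maps_full_faithful:
  assumes IJ [simp]: "I \<in> Tob" "J \<in> Tob" and adj: "adjunction LB f g \<eta> \<epsilon>"
    and f [simp]: "to f = oprod I J" and x [simp]: "x \<in> Lo" "so x = so f" "to x = oprod I J"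
    and a [simp]: "a \<in> Cell" "dm a = x \<odot> cmp (op1 I J)" "cd a = f \<odot> cmp (op1 I J)" "sd a = idt (so f)" "td a = idt I"
    and b [simp]: "b \<in> Cell" "dm b = x \<odot> cmp (op2 I J)" "cd b = f \<odot> cmp (op2 I J)" "sd b = idt (so f)" "td b = idt J"
  shows "\<exists>!u. (u \<in> Cell \<and> dm u = x \<and> cd u = f \<and> sd u = idt (so f) \<and> td u = idt (to f)) \<and>
    u \<star> idl (cmp (op1 I J)) = a \<and> u \<star> idl (cmp (op2 I J)) = b"
proof -
  have d: "adj_data f g \<eta> \<epsilon>" using adj by (simp add: adjunction_LB_iff)
  note [simp] = adj_dataD [OF d]
  let ?p = "op1 I J" and ?r = "op2 I J" and ?P = "oprod I J"
  have c: "mate ?p f g \<epsilon> x a \<in> Cell" "dm (mate ?p f g \<epsilon> x a) = g \<odot> x" "cd (mate ?p f g \<epsilon> x a) = li I"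
    "sd (mate ?p f g \<epsilon> x a) = ?p" "td (mate ?p f g \<epsilon> x a) = ?p"
    using mate_simps [OF d, of ?p x a] by simp_all
  have c': "mate ?r f g \<epsilon> x b \<in> Cell" "dm (mate ?r f g \<epsilon> x b) = g \<odot> x" "cd (mate ?r f g \<epsilon> x b) = li J"
    "sd (mate ?r f g \<epsilon> x b) = ?r" "td (mate ?r f g \<epsilon> x b) = ?r"
    using mate_simps [OF d, of ?r x b] by simp_all
  obtain w where w [simp]: "w \<in> Cell" "dm w = g \<odot> x" "cd w = li ?P"
    and wc: "w \<Zsemi> un ?p = mate ?p f g \<epsilon> x a" "w \<Zsemi> un ?r = mate ?r f g \<epsilon> x b"
    by (rule src.A.product_ex [OF li_product [of I J] c(1) c'(1) c(2) c'(2)]) (simp_all add: c c')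
  have "sd w \<Zcomp> ?p = sd (w \<Zsemi> un ?p)" "sd w \<Zcomp> ?r = sd (w \<Zsemi> un ?r)"
    "td w \<Zcomp> ?p = td (w \<Zsemi> un ?p)" "td w \<Zcomp> ?r = td (w \<Zsemi> un ?r)"
    by simp_all
  \<comment> \<open>Both sides of \<open>w\<close> fix the tight projections, so \<open>w\<close> is
    globular and its transpose is a 2-cell.\<close>
  then have sw [simp]: "sd w = idt ?P" "td w = idt ?P"
    unfolding wc c c' by - (rule oprod_eq_idt; simp)+
  define u where "u = vinv (lu x) \<Zsemi> (\<eta> \<star> idl x) \<Zsemi> as f g x \<Zsemi> (idl f \<star> w) \<Zsemi> ru f"
  have u [simp]: "u \<in> Cell" "dm u = x" "cd u = f" "sd u = idt (so f)" "td u = idt ?P"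
    by (simp_all add: u_def)
  have uw: "(idl g \<star> u) \<Zsemi> \<epsilon> = w"
    unfolding u_def by (rule sharp_flat [OF adj]) simp_all
  have "mate ?p f g \<epsilon> x (u \<star> idl (cmp ?p)) = mate ?p f g \<epsilon> x a"
    using mate_whisker [OF d, of ?p u x] by (simp add: wc uw flip: src.A.Comp_assoc_Arr)
  then have 1: "u \<star> idl (cmp ?p) = a"
    by - (rule mate_eq [OF adj, of ?p x], simp_all)
  have "mate ?r f g \<epsilon> x (u \<star> idl (cmp ?r)) = mate ?r f g \<epsilon> x b"
    using mate_whisker [OF d, of ?r u x] by (simp add: wc uw flip: src.A.Comp_assoc_Arr)
  then have 2: "u \<star> idl (cmp ?r) = b"
    by - (rule mate_eq [OF adj, of ?r x], simp_all)
  have "v = u" if v: "v \<in> Cell" "dm v = x" "cd v = f" "sd v = idt (so f)" "td v = idt (to f)"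
    "v \<star> idl (cmp ?p) = a" "v \<star> idl (cmp ?r) = b" for v
  proof -
    have "(idl g \<star> v) \<Zsemi> \<epsilon> = w"
    proof (rule src.A.product_eq [OF li_product [of I J]])
      show "((idl g \<star> v) \<Zsemi> \<epsilon>) \<Zsemi> un ?p = w \<Zsemi> un ?p"
        using mate_whisker [OF d, of ?p v x] v by (simp add: wc)
      show "((idl g \<star> v) \<Zsemi> \<epsilon>) \<Zsemi> un ?r = w \<Zsemi> un ?r"
        using mate_whisker [OF d, of ?r v x] v by (simp add: wc)
    qed (use v in simp_all)
    then show ?thesis
      using flat_sharp [OF adj, of v x] v by (simp add: u_def)
  qed
  then show ?thesis
    using 1 2 by (intro ex1I [of _ u]) auto
qed

text \<open>Unit and counit of the paired adjunction are themselves obtained by pairing, in such a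
  way that both components become morphisms of adjunctions. \<open>tri_natural\<close> then yields
  the triangle identities, and \<open>adj_mor_iso\<close> the isomorphisms with \<open>f\<close> and
  \<open>g\<close>.\<close>

lemma maps_pairing:
  assumes adj: "adjunction LB f f' \<eta> \<epsilon>" "adjunction LB g g' \<theta> \<kappa>"
    and fg: "so f = K" "so g = K" "to f = I" "to g = J"
  shows "\<exists>h a b. is_map LB h \<and> so h = K \<and> to h = oprod I J \<and>
    Iso a \<and> dm a = h \<odot> cmp (op1 I J) \<and> cd a = f \<and> sd a = idt K \<and> td a = idt I \<and>
    Iso b \<and> dm b = h \<odot> cmp (op2 I J) \<and> cd b = g \<and> sd b = idt K \<and> td b = idt J"
proof -
  have ad: "adj_data f f' \<eta> \<epsilon>" "adj_data g g' \<theta> \<kappa>"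
    and t: "tri f f' \<eta> \<epsilon> = lu f" "tri' f f' \<eta> \<epsilon> = ru f'" "tri g g' \<theta> \<kappa> = lu g" "tri' g g' \<theta> \<kappa> = ru g'"
    using adj by (simp_all add: adjunction_LB_iff)
  note [simp] = adj_dataD [OF ad(1)] adj_dataD [OF ad(2)] fg
  have [simp]: "I \<in> Tob" "J \<in> Tob" "K \<in> Tob"
    using src.fobj_Obj [of f] tgt.fobj_Obj [of f] tgt.fobj_Obj [of g] by simp_all
  let ?P = "oprod I J" and ?p = "op1 I J" and ?r = "op2 I J"
  obtain d where d [simp]: "d \<in> Ti" "tdom d = K" "tcod d = oprod K K"
      "d \<Zcomp> op1 K K = idt K" "d \<Zcomp> op2 K K = idt K"
    by (rule src.B.product_ex [OF oprod_product [of K K], of "idt K" "idt K" K]) simp_all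
  define F F' where FF: "F = lprod f g" "F' = lprod f' g'"
  define h h' where "h = cmp d \<odot> F" and "h' = F' \<odot> cnj d"
  have F [simp]: "F \<in> Lo" "so F = oprod K K" "to F = ?P" "F' \<in> Lo" "so F' = ?P" "to F' = oprod K K"
    by (simp_all add: FF)
  have l [simp]: "lp1 f g \<in> Cell" "dm (lp1 f g) = F" "lp2 f g \<in> Cell" "dm (lp2 f g) = F"
    "lp1 f' g' \<in> Cell" "dm (lp1 f' g') = F'" "lp2 f' g' \<in> Cell" "dm (lp2 f' g') = F'"
    by (simp_all add: FF)
  have h [simp]: "h \<in> Lo" "so h = K" "to h = ?P" "h' \<in> Lo" "so h' = ?P" "to h' = K"
    by (simp_all add: h_def h'_def)
  define x x' where "x = restl d F" and "x' = restr d F'"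
  have x [simp]: "x \<in> Cell" "dm x = h" "cd x = F" "sd x = d" "td x = idt ?P"
    "x' \<in> Cell" "dm x' = h'" "cd x' = F'" "sd x' = idt ?P" "td x' = d"
    by (simp_all add: x_def x'_def h_def h'_def)
  \<comment> \<open>The components of the restricted products. The side at \<open>K\<close> is an
    identity because the diagonal followed by a projection is one; the other side is
    \<open>op1 I J\<close> or \<open>op2 I J\<close>.\<close>
  define q1 q1' q2 q2' where q_def: "q1 = x \<Zsemi> lp1 f g" "q1' = x' \<Zsemi> lp1 f' g'"
    "q2 = x \<Zsemi> lp2 f g" "q2' = x' \<Zsemi> lp2 f' g'"
  have q [simp]: "q1 \<in> Cell" "dm q1 = h" "cd q1 = f" "sd q1 = idt K" "td q1 = ?p"
    "q1' \<in> Cell" "dm q1' = h'" "cd q1' = f'" "sd q1' = ?p" "td q1' = idt K"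
    "q2 \<in> Cell" "dm q2 = h" "cd q2 = g" "sd q2 = idt K" "td q2 = ?r"
    "q2' \<in> Cell" "dm q2' = h'" "cd q2' = g'" "sd q2' = ?r" "td q2' = idt K"
    by (simp_all add: q_def)
  \<comment> \<open>The counit: the given counits, precomposed with the components, are paired at
    the unit of \<open>oprod I J\<close>.\<close>
  obtain e where e [simp]: "e \<in> Cell" "dm e = h' \<odot> h" "cd e = li ?P"
    and ep: "e \<Zsemi> un ?p = (q1' \<star> q1) \<Zsemi> \<epsilon>" "e \<Zsemi> un ?r = (q2' \<star> q2) \<Zsemi> \<kappa>"
    by (rule src.A.product_ex [OF li_product [of I J], of "(q1' \<star> q1) \<Zsemi> \<epsilon>" "(q2' \<star> q2) \<Zsemi> \<kappa>" "h' \<odot> h"]) simp_all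
  have "sd e \<Zcomp> ?p = sd (e \<Zsemi> un ?p)" "sd e \<Zcomp> ?r = sd (e \<Zsemi> un ?r)"
    "td e \<Zcomp> ?p = td (e \<Zsemi> un ?p)" "td e \<Zcomp> ?r = td (e \<Zsemi> un ?r)"
    by simp_all
  then have [simp]: "sd e = idt ?P" "td e = idt ?P"
    unfolding ep by - (rule oprod_eq_idt; simp)+
  \<comment> \<open>The unit before restriction: \<eta> and \<theta> are paired into
    \<open>F \<odot> F'\<close>, a product by \<open>lcomp_product\<close>. The sides of
    \<open>w\<close> come out as the diagonal.\<close>
  obtain w where w [simp]: "w \<in> Cell" "dm w = li K" "cd w = F \<odot> F'"
    and wp: "w \<Zsemi> (lp1 f g \<star> lp1 f' g') = \<eta>" "w \<Zsemi> (lp2 f g \<star> lp2 f' g') = \<theta>"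
    unfolding FF
    by (rule src.A.product_ex [OF lcomp_product [of f g f' g'], of \<eta> \<theta> "li K"]) simp_all
  have "sd w \<Zcomp> op1 K K = sd (w \<Zsemi> (lp1 f g \<star> lp1 f' g'))" "sd w \<Zcomp> op2 K K = sd (w \<Zsemi> (lp2 f g \<star> lp2 f' g'))"
    "td w \<Zcomp> op1 K K = td (w \<Zsemi> (lp1 f g \<star> lp1 f' g'))" "td w \<Zcomp> op2 K K = td (w \<Zsemi> (lp2 f g \<star> lp2 f' g'))"
    by simp_all
  then have [simp]: "sd w = d" "td w = d"
    unfolding wp by - (rule src.B.product_eq [OF oprod_product [of K K]]; simp)+
  \<comment> \<open>Lifting \<open>w\<close> through the restriction on both sides makes it
    globular; the associators rearrange \<open>(cmp d \<odot> (F \<odot> F')) \<odot> cnj d\<close>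
    into \<open>h \<odot> h'\<close>.\<close>
  define n where "n = liftr d (liftl d w) \<Zsemi> (vinv (as (cmp d) F F') \<star> idl (cnj d)) \<Zsemi> as (cmp d \<odot> F) F' (cnj d)"
  have n [simp]: "n \<in> Cell" "dm n = li K" "cd n = h \<odot> h'" "sd n = idt K" "td n = idt K"
    by (simp_all add: n_def h_def h'_def)
  have "(vinv (as (cmp d) F F') \<star> idl (cnj d)) \<Zsemi> as (cmp d \<odot> F) F' (cnj d) \<Zsemi> (x \<star> x') =
     (vinv (as (cmp d) F F') \<star> idl (cnj d)) \<Zsemi> ((restl d F \<star> idl F') \<star> cnjK d) \<Zsemi>
       as F F' (li (oprod K K)) \<Zsemi> (idl F \<star> ru F')"
    by (simp add: x_def x'_def restr_def as_natural_assoc merge)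
  also have "\<dots> = rest d (F \<odot> F') d"
    by (simp add: as_ru rest_def merge flip: as_restl)
  finally have nx: "n \<Zsemi> (x \<star> x') = w"
    using liftr_liftl_rest [of d d w "F \<odot> F'"] by (simp add: n_def h_def h'_def)
  have d': "adj_data h h' n e"
    by (simp add: adj_data_def)
  have nq: "n \<Zsemi> (q1 \<star> q1') = \<eta>" "n \<Zsemi> (q2 \<star> q2') = \<theta>"
    using arg_cong [OF nx, of "\<lambda>y. y \<Zsemi> (lp1 f g \<star> lp1 f' g')"] arg_cong [OF nx, of "\<lambda>y. y \<Zsemi> (lp2 f g \<star> lp2 f' g')"]
    by (simp_all add: wp q_def merge)
  have mor: "adj_mor (idt K) ?p h h' n e f f' \<eta> \<epsilon> q1 q1'" "adj_mor (idt K) ?r h h' n e g g' \<theta> \<kappa> q2 q2'"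
    using d' ad by (simp_all add: adj_mor_def nq ep)
  note [simp] = tri_simps [OF d', simplified]
  \<comment> \<open>Tested on the projections of \<open>F\<close>, the triangle identity reduces to
    those of \<open>f\<close> and \<open>g\<close>; the restriction cell \<open>x\<close> is
    cancelled afterwards by \<open>restl_eq\<close>.\<close>
  have x1: "tri h h' n e \<Zsemi> x = lu h \<Zsemi> x"
  proof (rule src.A.product_eq [OF lprod_product [of f g]])
    show "(tri h h' n e \<Zsemi> x) \<Zsemi> lp1 f g = (lu h \<Zsemi> x) \<Zsemi> lp1 f g"
      using tri_natural(1) [OF mor(1)] by (simp add: t lu_natural_globular) (simp add: q_def)
    show "(tri h h' n e \<Zsemi> x) \<Zsemi> lp2 f g = (lu h \<Zsemi> x) \<Zsemi> lp2 f g"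
      using tri_natural(1) [OF mor(2)] by (simp add: t lu_natural_globular) (simp add: q_def)
  qed (simp_all flip: FF)
  have x2: "tri' h h' n e \<Zsemi> x' = ru h' \<Zsemi> x'"
  proof (rule src.A.product_eq [OF lprod_product [of f' g']])
    show "(tri' h h' n e \<Zsemi> x') \<Zsemi> lp1 f' g' = (ru h' \<Zsemi> x') \<Zsemi> lp1 f' g'"
      using tri_natural(2) [OF mor(1)] by (simp add: t ru_natural_globular) (simp add: q_def)
    show "(tri' h h' n e \<Zsemi> x') \<Zsemi> lp2 f' g' = (ru h' \<Zsemi> x') \<Zsemi> lp2 f' g'"
      using tri_natural(2) [OF mor(2)] by (simp add: t ru_natural_globular) (simp add: q_def)
  qed (simp_all flip: FF)
  have "tri h h' n e = lu h"
    by (rule restl_eq [where f = d and A = F]) (use x1 in \<open>simp_all add: x_def flip: h_def\<close>)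
  moreover have "tri' h h' n e = ru h'"
    by (rule restr_eq [where f = d and A = F']) (use x2 in \<open>simp_all add: x'_def flip: h'_def\<close>)
  ultimately have adj': "adjunction LB h h' n e"
    using d' by (simp add: adjunction_LB_iff)
  have "Iso (downr ?p q1)" "Iso (downr ?r q2)"
    using adj_mor_iso [OF mor(1) _ adj' adj(1)] adj_mor_iso [OF mor(2) _ adj' adj(2)] by simp_all
  moreover have "is_map LB h"
    using adj' by (auto simp: is_map_def)
  ultimately show ?thesis
    by (intro exI [of _ h] exI [of _ "downr ?p q1"] exI [of _ "downr ?r q2"]) simp
qed

lemma MB_product:
  assumes IJ [simp]: "I \<in> Tob" "J \<in> Tob"
  shows "bicat_product MB I J (oprod I J) (cmp (op1 I J)) (cmp (op2 I J))"
  unfolding bicat_product_def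
proof (intro conjI ballI)
  let ?P = "oprod I J" and ?p = "op1 I J" and ?r = "op2 I J"
  show "?P \<in> Ob MB" "cmp ?p \<in> one_cells MB ?P I" "cmp ?r \<in> one_cells MB ?P J"
    by (simp_all add: is_map_cmp)
  fix K assume "K \<in> Ob MB"
  then have [simp]: "K \<in> Tob" by simp
  let ?F = "post_pair MB (cmp ?p) (cmp ?r)"
  let ?A = "bhom MB K ?P" and ?B = "cat_prod (bhom MB K I) (bhom MB K J)"
  \<comment> \<open>Well-definedness of the functor: a map followed by the companion of a projection
    is again a map, by \<open>adjunction_extend\<close>.\<close>
  have map: "is_map LB (f \<odot> cmp ?p)" "is_map LB (f \<odot> cmp ?r)" if "is_map LB f" "to f = ?P" for f
    using that adjunction_extend by (auto simp: is_map_def [of LB f])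
  have F: "is_functor ?A ?B ?F"
  proof (intro is_functor.intro is_functor_axioms.intro category_cat_prod category_bhom_MB)
    show "fobj ?F x \<in> Obj ?B" if "x \<in> Obj ?A" for x
      using that map [of x] by (simp add: post_pair_def)
    show "farr ?F a \<in> hom ?B (fobj ?F x) (fobj ?F y)" if "a \<in> hom ?A x y" for a x y
      using that map [of x] map [of y] is_map_Lo [of x] is_map_Lo [of y] by (simp add: post_pair_def hom_cat_prod hom_bhom_MB)
    show "farr ?F (Ident ?A x) = Ident ?B (fobj ?F x)" if "x \<in> Obj ?A" for x
      using that by (simp add: post_pair_def)
    show "farr ?F (a \<cdot>\<^bsub>?A\<^esub> b) = farr ?F a \<cdot>\<^bsub>?B\<^esub> farr ?F b"
      if "a \<in> hom ?A x y" "b \<in> hom ?A y z" for a b x y z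
      using that is_map_Lo [of x] is_map_Lo [of y] is_map_Lo [of z] by (simp add: post_pair_def hom_bhom_MB merge)
  qed
  show "is_equivalence ?A ?B ?F"
  proof (rule is_functor.is_equivalenceI [OF F])
    fix x f c assume xf: "x \<in> Obj ?A" "f \<in> Obj ?A" and c: "c \<in> hom ?B (fobj ?F x) (fobj ?F f)"
    obtain a b where ab: "c = (a, b)" by (cases c)
    obtain g \<eta> \<epsilon> where adj: "adjunction LB f g \<eta> \<epsilon>"
      using xf(2) by (auto simp: is_map_def)
    have "\<exists>!u. (u \<in> Cell \<and> dm u = x \<and> cd u = f \<and> sd u = idt (so f) \<and> td u = idt (to f)) \<and>
        u \<star> idl (cmp ?p) = a \<and> u \<star> idl (cmp ?r) = b"
      using xf c by (intro maps_full_faithful [OF _ _ adj]) (simp_all add: ab post_pair_def hom_cat_prod hom_bhom_MB)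
    moreover have "u \<in> hom ?A x f \<and> farr ?F u = c \<longleftrightarrow>
        (u \<in> Cell \<and> dm u = x \<and> cd u = f \<and> sd u = idt (so f) \<and> td u = idt (to f)) \<and>
        u \<star> idl (cmp ?p) = a \<and> u \<star> idl (cmp ?r) = b" for u
      using xf by (auto simp: hom_bhom_MB post_pair_def ab)
    ultimately show "\<exists>!u. u \<in> hom ?A x f \<and> farr ?F u = c" by simp
  next
    fix c assume c: "c \<in> Obj ?B"
    obtain f g where fg: "c = (f, g)" by (cases c)
    obtain f' \<eta> \<epsilon> where adj: "adjunction LB f f' \<eta> \<epsilon>"
      using c by (auto simp: is_map_def fg)
    obtain g' \<theta> \<kappa> where adj': "adjunction LB g g' \<theta> \<kappa>"
      using c by (auto simp: is_map_def fg)
    obtain h a b where h: "is_map LB h" "so h = K" "to h = ?P"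
      "Iso a" "dm a = h \<odot> cmp ?p" "cd a = f" "sd a = idt K" "td a = idt I"
      "Iso b" "dm b = h \<odot> cmp ?r" "cd b = g" "sd b = idt K" "td b = idt J"
      using maps_pairing [OF adj adj', of K I J] c fg by auto
    have "a \<in> hom (bhom MB K I) (h \<odot> cmp ?p) f" "b \<in> hom (bhom MB K J) (h \<odot> cmp ?r) g"
      using h c map [of h] is_map_Lo [of h] by (auto simp: hom_bhom_MB fg)
    then have "(a, b) \<in> hom ?B (fobj ?F h) c" "invertible ?B (a, b)"
      using h invertible_bhom_MB by (auto simp: hom_cat_prod post_pair_def fg intro!: invertible_cat_prod)
    moreover have "h \<in> Obj ?A"
      using h is_map_Lo by simp
    ultimately show "\<exists>x\<in>Obj ?A. \<exists>i\<in>hom ?B (fobj ?F x) c. invertible ?B i" by blast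
  qed
qed

end

section \<open>The canonical lax functors\<close>

lemma bicategory_bicat_one: "bicategory bicat_one"
proof -
  have "invertible cat_one ()"
    by (auto simp: invertible_def inverse_arrows_def hom_def)
  then show ?thesis
    by unfold_locales (auto simp: bicat_one_def one_cells_def hom_def)
qed

lemma bicat_prod_simps [simp]:
  "Ob (bicat_prod B C) = Ob B \<times> Ob C" "cells (bicat_prod B C) = cat_prod (cells B) (cells C)"
  "bsrc (bicat_prod B C) = map_prod (bsrc B) (bsrc C)" "btgt (bicat_prod B C) = map_prod (btgt B) (btgt C)"
  "bid (bicat_prod B C) = map_prod (bid B) (bid C)"
  "bcomp (bicat_prod B C) (f, f') (g, g') = (bcomp B f g, bcomp C f' g')"
  "hcomp (bicat_prod B C) (a, a') (b, b') = (hcomp B a b, hcomp C a' b')"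
  "bassoc (bicat_prod B C) (f, f') (g, g') (h, h') = (bassoc B f g h, bassoc C f' g' h')"
  "blunit (bicat_prod B C) = map_prod (blunit B) (blunit C)"
  "brunit (bicat_prod B C) = map_prod (brunit B) (brunit C)"
  by (simp_all add: bicat_prod_def)

lemma one_cells_bicat_prod [simp]:
  "(f, f') \<in> one_cells (bicat_prod B C) (I, I') (J, J') \<longleftrightarrow> f \<in> one_cells B I J \<and> f' \<in> one_cells C I' J'"
  by (auto simp: one_cells_def)

lemma bicategory_bicat_prod:
  assumes "bicategory B" "bicategory C"
  shows "bicategory (bicat_prod B C)"
proof -
  interpret B: bicategory B by (rule assms)
  interpret C: bicategory C by (rule assms)
  show ?thesis
  proof (rule bicategory.intro, simp_all only: split_paired_all bicat_prod_simps one_cells_bicat_prod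
      hom_cat_prod mem_Times_iff fst_conv snd_conv map_prod_simp cat_prod_simps prod.inject, goal_cases)
    case 1 show ?case by (simp add: category_cat_prod B.cells_category C.cells_category)
  next
    case 2 then show ?case by - (elim conjE, intro conjI; (rule B.bsrc_Ob C.bsrc_Ob; assumption))
  next
    case 3 then show ?case by - (elim conjE, intro conjI; (rule B.btgt_Ob C.btgt_Ob; assumption))
  next
    case 4 then show ?case by - (elim conjE, intro conjI; (rule B.bsrc_cell C.bsrc_cell; assumption))
  next
    case 5 then show ?case by - (elim conjE, intro conjI; (rule B.btgt_cell C.btgt_cell; assumption))
  next
    case 6 then show ?case by - (elim conjE, intro conjI; (rule B.bid_one_cell C.bid_one_cell; assumption))
  next
    case 7 then show ?case by - (elim conjE, intro conjI; (rule B.bcomp_one_cell C.bcomp_one_cell; assumption))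
  next
    case 8 then show ?case by - (elim conjE, intro conjI; (rule B.hcomp_hom C.hcomp_hom; assumption))
  next
    case 9 then show ?case by - (elim conjE, intro conjI; (rule B.hcomp_id C.hcomp_id; assumption))
  next
    case 10 then show ?case by - (elim conjE, intro conjI; (rule B.interchange C.interchange; assumption))
  next
    case 11 then show ?case by - (elim conjE, intro conjI invertible_cat_prod; (rule conjunct1 [OF B.bassoc_iso] conjunct1 [OF C.bassoc_iso] conjunct2 [OF B.bassoc_iso] conjunct2 [OF C.bassoc_iso]; assumption))
  next
    case 12 then show ?case by - (elim conjE, intro conjI invertible_cat_prod; (rule conjunct1 [OF B.blunit_iso] conjunct1 [OF C.blunit_iso] conjunct2 [OF B.blunit_iso] conjunct2 [OF C.blunit_iso]; assumption))
  next
    case 13 then show ?case by - (elim conjE, intro conjI invertible_cat_prod; (rule conjunct1 [OF B.brunit_iso] conjunct1 [OF C.brunit_iso] conjunct2 [OF B.brunit_iso] conjunct2 [OF C.brunit_iso]; assumption))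
  next
    case 14 then show ?case by - (elim conjE, intro conjI; (rule B.bassoc_natural C.bassoc_natural; assumption))
  next
    case 15 then show ?case by - (elim conjE, intro conjI; (rule B.blunit_natural C.blunit_natural; assumption))
  next
    case 16 then show ?case by - (elim conjE, intro conjI; (rule B.brunit_natural C.brunit_natural; assumption))
  next
    case 17 then show ?case by - (elim conjE, intro conjI; (rule B.bpentagon C.bpentagon; assumption))
  next
    case 18 then show ?case by - (elim conjE, intro conjI; (rule B.btriangle C.btriangle; assumption))
  qed
qed


section \<open>Chosen product data and the unit pseudofunctor\<close>

context cart_equip
begin

text \<open>Meets enter only through their universal property, so an arbitrary choice suffices.
  Object and projections are chosen as one triple so that they belong to the same product
  cone.\<close>

definition "meet_choice A B = (SOME (m, \<pi>, \<rho>). is_product (bhom LB (so A) (to A)) A B m \<pi> \<rho>)"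

text \<open>The bicategorical projections are companions and their right adjoints conjoints, so that
  the cells defining the tensor can be evaluated by the calculus of restrictions.\<close>

definition PD :: "('a, 'c, 'd) product_data" where
  "PD = \<lparr>one = unit, prd = oprod, pl = \<lambda>I J. cmp (op1 I J), pr = \<lambda>I J. cmp (op2 I J),
    pl_adj = \<lambda>I J. cnj (op1 I J), pr_adj = \<lambda>I J. cnj (op2 I J),
    pl_unit = \<lambda>I J. cunit (op1 I J), pr_unit = \<lambda>I J. cunit (op2 I J),
    pl_counit = \<lambda>I J. ccounit (op1 I J), pr_counit = \<lambda>I J. ccounit (op2 I J),
    top_one = li unit, meet = \<lambda>A B. fst (meet_choice A B),
    meet_l = \<lambda>A B. fst (snd (meet_choice A B)), meet_r = \<lambda>A B. snd (snd (meet_choice A B))\<rparr>"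

lemma PD_simps [simp]:
  "one PD = unit" "prd PD = oprod" "pl PD I J = cmp (op1 I J)" "pr PD I J = cmp (op2 I J)"
  "pl_adj PD I J = cnj (op1 I J)" "pr_adj PD I J = cnj (op2 I J)"
  "pl_unit PD I J = cunit (op1 I J)" "pr_unit PD I J = cunit (op2 I J)"
  "pl_counit PD I J = ccounit (op1 I J)" "pr_counit PD I J = ccounit (op2 I J)" "top_one PD = li unit"
  by (simp_all add: PD_def)

lemma meet_product:
  assumes "A \<in> Lo" "B \<in> Lo" "so A = I" "to A = J" "so B = I" "to B = J"
  shows "is_product (bhom LB I J) A B (meet PD A B) (meet_l PD A B) (meet_r PD A B)"
proof -
  have "I \<in> Tob" "J \<in> Tob"
    using src.fobj_Obj [of A] tgt.fobj_Obj [of A] assms by simp_all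
  then have "\<exists>x. case x of (m, \<pi>, \<rho>) \<Rightarrow> is_product (bhom LB (so A) (to A)) A B m \<pi> \<rho>"
    using bhom_product [of I J A B] assms by auto
  then have "case meet_choice A B of (m, \<pi>, \<rho>) \<Rightarrow> is_product (bhom LB (so A) (to A)) A B m \<pi> \<rho>"
    unfolding meet_choice_def by (rule someI_ex)
  then show ?thesis
    using assms by (simp add: PD_def case_prod_beta)
qed

lemma unit_bhom_terminal: "is_terminal (bhom LB unit unit) (li unit)"
  unfolding is_terminal_def
proof (intro conjI ballI)
  fix x assume "x \<in> Obj (bhom LB unit unit)"
  then have x [simp]: "x \<in> Lo" "so x = unit" "to x = unit" by simp_all
  obtain c where c [simp]: "c \<in> Cell" "dm c = x" "cd c = li unit"
    by (rule src.A.terminal_ex [OF li_unit_terminal x(1)])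
  have [simp]: "sd c = idt unit" "td c = idt unit"
    by (rule src.B.terminal_eq [OF unit_terminal]; simp)+
  show "\<exists>!f. f \<in> hom (bhom LB unit unit) x (li unit)"
    by (rule ex1I [of _ c]) (auto simp: hom_bhom_LB intro: src.A.terminal_eq [OF li_unit_terminal])
qed simp

lemma is_product_data_PD: "is_product_data LB PD"
  unfolding is_product_data_def
  using MB_terminal MB_product unit_bhom_terminal meet_product
  by (auto simp: adjunction_cmp_cnj simp flip: oprod_simps(6,7))

text \<open>Every coherence equation compares parallel cells into the terminal loose arrow
  \<open>li unit\<close> and so is automatic. The laxity cells are a unitor and an identity, hence
  invertible.\<close>

lemma unit_pseudofunctor: "pseudofunctor bicat_one LB (unit_lax_functor LB PD)"
proof -
  let ?u = "li unit" and ?F = "unit_lax_functor LB PD"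
  have eq: "a = b" if "a \<in> Cell" "b \<in> Cell" "dm a = dm b" "cd a = ?u" "cd b = ?u" for a b
    using that by (rule src.A.terminal_eq [OF li_unit_terminal])
  have "(THE a. a \<in> hom (cells LB) (?u \<odot> ?u) ?u) = lu ?u"
    by (rule the_equality) (auto simp: hom_cells_LB intro: eq)
  moreover have "(THE a. a \<in> hom (cells LB) ?u ?u) = idl ?u"
    by (rule the_equality) (auto simp: hom_cells_LB intro: eq)
  ultimately have F [simp]: "lfob ?F x = unit" "fobj (lfcells ?F) y = ?u" "farr (lfcells ?F) z = idl ?u"
    "lfcomp ?F y y' = lu ?u" "lfunit ?F x = idl ?u" for x y y' z
    by (simp_all add: unit_lax_functor_def)
  show ?thesis
  proof (intro pseudofunctor.intro pseudofunctor_axioms.intro lax_functor.intro lax_functor_axioms.intro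
      bicategory_bicat_one bicategory_LB)
    show "is_functor (cells bicat_one) (cells LB) (lfcells ?F)"
      by (intro is_functor.intro is_functor_axioms.intro category_cells_LB)
        (simp_all add: bicat_one_def category_cat_one hom_cells_LB)
  qed (auto simp: hom_cells_LB intro: eq)
qed

subsection \<open>The tensor of loose arrows\<close>

abbreviation "tens \<equiv> tensor LB PD"
abbreviation "legl \<equiv> left_leg LB PD"
abbreviation "legr \<equiv> right_leg LB PD"
abbreviation "tenl \<equiv> tensor_l LB PD"
abbreviation "tenr \<equiv> tensor_r LB PD"
abbreviation "tcell \<equiv> tensor_cell LB PD"
abbreviation "tmul \<equiv> tensor_comp LB PD"
abbreviation "tunit \<equiv> tensor_unit LB PD"

lemma leg_simps:
  assumes "A \<in> Lo" "B \<in> Lo"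
  shows "legl A B = (cmp (op1 (so A) (so B)) \<odot> A) \<odot> cnj (op1 (to A) (to B))"
    "legr A B = (cmp (op2 (so A) (so B)) \<odot> B) \<odot> cnj (op2 (to A) (to B))"
  by (simp_all add: left_leg_def right_leg_def)

lemma tensor_product_bhom:
  assumes "A \<in> Lo" "B \<in> Lo"
  shows "is_product (bhom LB (oprod (so A) (so B)) (oprod (to A) (to B))) (legl A B) (legr A B)
    (tens A B) (tenl A B) (tenr A B)"
  unfolding tensor_def tensor_l_def tensor_r_def
  by (rule meet_product) (use assms in \<open>simp_all add: leg_simps\<close>)

lemma tens_simps [simp]:
  assumes "A \<in> Lo" "B \<in> Lo"
  shows "tens A B \<in> Lo" "so (tens A B) = oprod (so A) (so B)" "to (tens A B) = oprod (to A) (to B)"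
    "tenl A B \<in> Cell" "dm (tenl A B) = tens A B" "cd (tenl A B) = legl A B"
    "sd (tenl A B) = idt (oprod (so A) (so B))" "td (tenl A B) = idt (oprod (to A) (to B))"
    "tenr A B \<in> Cell" "dm (tenr A B) = tens A B" "cd (tenr A B) = legr A B"
    "sd (tenr A B) = idt (oprod (so A) (so B))" "td (tenr A B) = idt (oprod (to A) (to B))"
  using tensor_product_bhom [OF assms] by (simp_all add: is_product_def hom_bhom_LB)

text \<open>Restriction cells of the two legs. They are not globular: their sides are the tight
  projections.\<close>

definition "rl A B = rest (op1 (so A) (so B)) A (op1 (to A) (to B))"
definition "rr A B = rest (op2 (so A) (so B)) B (op2 (to A) (to B))"

lemma leg_rest_simps [simp]:
  assumes "A \<in> Lo" "B \<in> Lo"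
  shows "rl A B \<in> Cell" "dm (rl A B) = legl A B" "cd (rl A B) = A" "sd (rl A B) = op1 (so A) (so B)"
    "td (rl A B) = op1 (to A) (to B)"
    "rr A B \<in> Cell" "dm (rr A B) = legr A B" "cd (rr A B) = B" "sd (rr A B) = op2 (so A) (so B)"
    "td (rr A B) = op2 (to A) (to B)"
  using assms by (simp_all add: rl_def rr_def leg_simps)

text \<open>Non-globular projections, which exhibit the tensor as a product in the category of loose arrows.\<close>

definition "tprl A B = tenl A B \<Zsemi> rl A B"
definition "tprr A B = tenr A B \<Zsemi> rr A B"

lemma tpr_simps [simp]:
  assumes "A \<in> Lo" "B \<in> Lo"
  shows "tprl A B \<in> Cell" "dm (tprl A B) = tens A B" "cd (tprl A B) = A" "sd (tprl A B) = op1 (so A) (so B)"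
    "td (tprl A B) = op1 (to A) (to B)"
    "tprr A B \<in> Cell" "dm (tprr A B) = tens A B" "cd (tprr A B) = B" "sd (tprr A B) = op2 (so A) (so B)"
    "td (tprr A B) = op2 (to A) (to B)"
  using assms by (simp_all add: tprl_def tprr_def)

text \<open>Two universal properties meet here: \<open>tens A B\<close> is a product of its legs
  among globular cells, \<open>lprod A B\<close> a product of \<open>A\<close> and \<open>B\<close>
  among all cells. Restriction passes between cells to a leg and cells over a projection, so each
  object maps to the other, and each round trip is checked at its endpoint.\<close>

lemma tensor_lprod_iso:
  assumes [simp]: "A \<in> Lo" "B \<in> Lo"
  obtains i where "Iso i" "dm i = tens A B" "cd i = lprod A B" "sd i = idt (oprod (so A) (so B))"
    "td i = idt (oprod (to A) (to B))" "i \<Zsemi> lp1 A B = tprl A B" "i \<Zsemi> lp2 A B = tprr A B"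
proof -
  let ?I = "so A" and ?J = "so B" and ?K = "to A" and ?L = "to B"
  let ?P = "oprod ?I ?J" and ?Q = "oprod ?K ?L"
  interpret B: category "bhom LB ?P ?Q" by (rule category_bhom_LB)
  have hom: "a \<in> Arr (bhom LB ?P ?Q) \<and> dm a = x \<and> cd a = y \<longleftrightarrow> a \<in> hom (bhom LB ?P ?Q) x y" for a x y
    by (simp add: hom_def)
  obtain i where i [simp]: "i \<in> Cell" "dm i = tens A B" "cd i = lprod A B" "i \<Zsemi> lp1 A B = tprl A B"
      "i \<Zsemi> lp2 A B = tprr A B"
    by (rule src.A.product_ex [OF lprod_product [of A B], of "tprl A B" "tprr A B" "tens A B"]) simp_all
  have si [simp]: "sd i = idt ?P" "td i = idt ?Q"
    using src.farr_Comp_Arr [of i "lp1 A B"] src.farr_Comp_Arr [of i "lp2 A B"]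
      tgt.farr_Comp_Arr [of i "lp1 A B"] tgt.farr_Comp_Arr [of i "lp2 A B"]
    by (auto intro!: oprod_eq_idt)
  \<comment> \<open>The projections of \<open>lprod\<close>, lifted to globular cells into the legs,
    so that the universal property of the meet applies to them.\<close>
  define a where "a = liftr (op1 ?K ?L) (liftl (op1 ?I ?J) (lp1 A B))"
  define b where "b = liftr (op2 ?K ?L) (liftl (op2 ?I ?J) (lp2 A B))"
  have a [simp]: "a \<in> Cell" "dm a = lprod A B" "cd a = legl A B" "sd a = idt ?P" "td a = idt ?Q"
    and b [simp]: "b \<in> Cell" "dm b = lprod A B" "cd b = legr A B" "sd b = idt ?P" "td b = idt ?Q"
    by (simp_all add: a_def b_def leg_simps)
  have ab: "a \<Zsemi> rl A B = lp1 A B" "b \<Zsemi> rr A B = lp2 A B"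
    unfolding a_def b_def rl_def rr_def by (rule liftr_liftl_rest; simp)+
  have "a \<in> hom (bhom LB ?P ?Q) (lprod A B) (legl A B)" "b \<in> hom (bhom LB ?P ?Q) (lprod A B) (legr A B)"
    by (simp_all add: hom_bhom_LB leg_simps)
  then obtain j where j: "j \<in> hom (bhom LB ?P ?Q) (lprod A B) (tens A B)" "j \<Zsemi> tenl A B = a" "j \<Zsemi> tenr A B = b"
    using B.product_ex [OF tensor_product_bhom [of A B], of a b "lprod A B"] by (auto simp: hom_def)
  then have j' [simp]: "j \<in> Cell" "dm j = lprod A B" "cd j = tens A B" "sd j = idt ?P" "td j = idt ?Q"
    by (simp_all add: hom_bhom_LB)
  have jt: "j \<Zsemi> tprl A B = lp1 A B" "j \<Zsemi> tprr A B = lp2 A B"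
    using arg_cong [OF j(2), of "\<lambda>x. x \<Zsemi> rl A B"] arg_cong [OF j(3), of "\<lambda>x. x \<Zsemi> rr A B"]
    by (simp_all add: ab tprl_def tprr_def)
  have ij: "i \<Zsemi> j = idl (tens A B)"
  proof (rule B.product_eq [OF tensor_product_bhom [of A B]])
    have m: "i \<Zsemi> j \<in> hom (bhom LB ?P ?Q) (tens A B) (tens A B)"
      "idl (tens A B) \<in> hom (bhom LB ?P ?Q) (tens A B) (tens A B)"
      by (simp_all add: hom_bhom_LB)
    then show "i \<Zsemi> j \<in> Arr (bhom LB ?P ?Q)" "idl (tens A B) \<in> Arr (bhom LB ?P ?Q)"
      by (simp_all add: hom_def)
    \<comment> \<open>Both cells end in a leg with identity sides; \<open>rest_eq\<close> tests them
      after the restriction cell, where each gives \<open>tprl A B\<close>.\<close>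
    have "i \<Zsemi> a = tenl A B"
      by (rule rest_eq [where f = "op1 ?I ?J" and g = "op1 ?K ?L" and A = A])
        (use ab in \<open>simp_all add: leg_simps flip: rl_def, simp add: tprl_def\<close>)
    then show "(i \<Zsemi> j) \<cdot>\<^bsub>bhom LB ?P ?Q\<^esub> tenl A B = idl (tens A B) \<cdot>\<^bsub>bhom LB ?P ?Q\<^esub> tenl A B"
      by (simp add: j)
    have "i \<Zsemi> b = tenr A B"
      by (rule rest_eq [where f = "op2 ?I ?J" and g = "op2 ?K ?L" and A = B])
        (use ab in \<open>simp_all add: leg_simps flip: rr_def, simp add: tprr_def\<close>)
    then show "(i \<Zsemi> j) \<cdot>\<^bsub>bhom LB ?P ?Q\<^esub> tenr A B = idl (tens A B) \<cdot>\<^bsub>bhom LB ?P ?Q\<^esub> tenr A B"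
      by (simp add: j)
  qed simp_all
  have ji: "j \<Zsemi> i = idl (lprod A B)"
    by (rule src.A.product_eq [OF lprod_product [of A B]]) (simp_all add: jt)
  have "Iso i"
    using ij ji by (intro src.A.invertibleI [where g = j]) simp_all
  then show ?thesis
    using that [of i] by simp
qed

lemma tensor_product:
  assumes [simp]: "A \<in> Lo" "B \<in> Lo"
  shows "is_product (loose D) A B (tens A B) (tprl A B) (tprr A B)"
  using tensor_lprod_iso [OF assms] src.A.product_precomp_iso [OF lprod_product [OF assms]] by metis

text \<open>The horizontal composite of two comparison isomorphisms transports
  \<open>lcomp_product\<close> from \<open>lprod\<close> to the tensor.\<close>

lemma tensor_lcomp_product:
  assumes [simp]: "A \<in> Lo" "B \<in> Lo" "A' \<in> Lo" "B' \<in> Lo" "to A = so A'" "to B = so B'"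
  shows "is_product (loose D) (A \<odot> A') (B \<odot> B') (tens A B \<odot> tens A' B')
    (tprl A B \<star> tprl A' B') (tprr A B \<star> tprr A' B')"
proof -
  obtain i where i: "Iso i" "dm i = tens A B" "cd i = lprod A B"
    "td i = idt (oprod (to A) (to B))" "i \<Zsemi> lp1 A B = tprl A B" "i \<Zsemi> lp2 A B = tprr A B"
    by (rule tensor_lprod_iso [of A B]) simp_all
  obtain j where j: "Iso j" "dm j = tens A' B'" "cd j = lprod A' B'"
    "sd j = idt (oprod (so A') (so B'))" "j \<Zsemi> lp1 A' B' = tprl A' B'" "j \<Zsemi> lp2 A' B' = tprr A' B'"
    by (rule tensor_lprod_iso [of A' B']) simp_all
  show ?thesis
    using src.A.product_precomp_iso [OF lcomp_product [of A B A' B'], of "i \<star> j"] i j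
    by (simp add: merge)
qed

text \<open>The test of equality behind every coherence law of the tensor: composites with the
  non-globular projections are compared.\<close>

lemma tensor_eq:
  assumes "A \<in> Lo" "B \<in> Lo" "u \<in> Cell" "v \<in> Cell" "dm u = dm v" "cd u = tens A B" "cd v = tens A B"
    "u \<Zsemi> tprl A B = v \<Zsemi> tprl A B" "u \<Zsemi> tprr A B = v \<Zsemi> tprr A B"
  shows "u = v"
  using src.A.product_eq [OF tensor_product] assms by blast

text \<open>Bridge from the definite description in \<open>meet_pair\<close>, whose uniqueness holds
  among globular cells, to equations against the non-globular projections.\<close>

lemma tensor_pair:
  assumes [simp]: "A \<in> Lo" "B \<in> Lo"
    and a: "a \<in> Cell" "dm a = x" "cd a = legl A B" "sd a = idt (oprod (so A) (so B))" "td a = idt (oprod (to A) (to B))"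
    and b: "b \<in> Cell" "dm b = x" "cd b = legr A B" "sd b = idt (oprod (so A) (so B))" "td b = idt (oprod (to A) (to B))"
  defines "k \<equiv> tensor_pair LB PD A B a b"
  shows "k \<in> Cell" "dm k = x" "cd k = tens A B" "sd k = idt (oprod (so A) (so B))"
    "td k = idt (oprod (to A) (to B))" "k \<Zsemi> tprl A B = a \<Zsemi> rl A B" "k \<Zsemi> tprr A B = b \<Zsemi> rr A B"
proof -
  let ?P = "oprod (so A) (so B)" and ?Q = "oprod (to A) (to B)"
  have x: "so x = ?P" "to x = ?Q" "x \<in> Lo"
    using tsides(1) [OF a(1,4)] tsides(2) [OF a(1,5)] src.A.Dom_Obj [OF a(1)] a(2) by simp_all
  have "a \<in> hom (bhom LB ?P ?Q) x (legl A B)" "b \<in> hom (bhom LB ?P ?Q) x (legr A B)" "x \<in> Obj (bhom LB ?P ?Q)"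
    using a b x by (simp_all add: hom_bhom_LB leg_simps)
  then have "\<exists>!h. h \<in> hom (bhom LB ?P ?Q) x (tens A B) \<and> h \<Zsemi> tenl A B = a \<and> h \<Zsemi> tenr A B = b"
    using tensor_product_bhom [of A B] by (simp add: is_product_def)
  moreover have "h \<in> hom (bhom LB ?P ?Q) x (tens A B) \<longleftrightarrow> h \<in> hom (cells LB) x (tens A B)" for h
    using x by (auto simp: hom_bhom_LB hom_cells_LB)
  ultimately have "\<exists>!h. h \<in> hom (cells LB) x (tens A B) \<and> h \<Zsemi> tenl A B = a \<and> h \<Zsemi> tenr A B = b"
    by simp
  then have "k \<in> hom (cells LB) x (tens A B) \<and> k \<Zsemi> tenl A B = a \<and> k \<Zsemi> tenr A B = b"
    unfolding k_def tensor_pair_def meet_pair_def using a(2)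
    by (simp flip: tensor_def tensor_l_def tensor_r_def) (rule theI')
  then have k: "k \<in> Cell" "dm k = x" "cd k = tens A B" "sd k = idt ?P" "td k = idt ?Q"
    "k \<Zsemi> tenl A B = a" "k \<Zsemi> tenr A B = b"
    using x by (auto simp: hom_cells_LB)
  then show "k \<in> Cell" "dm k = x" "cd k = tens A B" "sd k = idt ?P" "td k = idt ?Q"
    by simp_all
  show "k \<Zsemi> tprl A B = a \<Zsemi> rl A B" "k \<Zsemi> tprr A B = b \<Zsemi> rr A B"
    using k(1-5) arg_cong [OF k(6), of "\<lambda>y. y \<Zsemi> rl A B"] arg_cong [OF k(7), of "\<lambda>y. y \<Zsemi> rr A B"]
    by (simp_all add: tprl_def tprr_def)
qed

text \<open>By \<open>rest_natural\<close> the whiskering with companion and conjoint disappears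
  against the restriction cell of the leg, which makes the projections of the tensor
  natural.\<close>

lemma tensor_cell:
  assumes a [simp]: "a \<in> Cell" "dm a = A" "cd a = A'" "sd a = idt (so A)" "td a = idt (to A)"
    and b [simp]: "b \<in> Cell" "dm b = B" "cd b = B'" "sd b = idt (so B)" "td b = idt (to B)"
  defines "k \<equiv> tcell a b"
  shows "k \<in> Cell" "dm k = tens A B" "cd k = tens A' B'" "sd k = idt (oprod (so A) (so B))"
    "td k = idt (oprod (to A) (to B))" "k \<Zsemi> tprl A' B' = tprl A B \<Zsemi> a" "k \<Zsemi> tprr A' B' = tprr A B \<Zsemi> b"
proof -
  have [simp]: "A \<in> Lo" "A' \<in> Lo" "B \<in> Lo" "B' \<in> Lo"
    using src.A.Dom_Cod_Obj [of a] src.A.Dom_Cod_Obj [of b] by simp_all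
  have [simp]: "so A' = so A" "to A' = to A" "so B' = so B" "to B' = to B"
    using globular_ends [of a] globular_ends [of b] by simp_all
  let ?p = "op1 (so A) (so B)" and ?p' = "op1 (to A) (to B)" and ?r = "op2 (so A) (so B)" and ?r' = "op2 (to A) (to B)"
  let ?a = "tenl A B \<Zsemi> ((idl (cmp ?p) \<star> a) \<star> idl (cnj ?p'))"
  let ?b = "tenr A B \<Zsemi> ((idl (cmp ?r) \<star> b) \<star> idl (cnj ?r'))"
  have k: "k = tensor_pair LB PD A' B' ?a ?b"
    by (simp add: k_def tensor_cell_def whisker_def Let_def)
  note t = tensor_pair [of A' B' ?a "tens A B" ?b, folded k]
  show "k \<in> Cell" "dm k = tens A B" "cd k = tens A' B'" "sd k = idt (oprod (so A) (so B))"
    "td k = idt (oprod (to A) (to B))"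
    by (use t(1-5) in \<open>simp_all add: leg_simps\<close>)
  have "((idl (cmp ?p) \<star> a) \<star> idl (cnj ?p')) \<Zsemi> rl A' B' = rl A B \<Zsemi> a"
    "((idl (cmp ?r) \<star> b) \<star> idl (cnj ?r')) \<Zsemi> rr A' B' = rr A B \<Zsemi> b"
    unfolding rl_def rr_def by (simp_all add: rest_natural)
  then show "k \<Zsemi> tprl A' B' = tprl A B \<Zsemi> a" "k \<Zsemi> tprr A' B' = tprr A B \<Zsemi> b"
    using t(6,7) by (simp_all add: leg_simps) (simp_all add: tprl_def tprr_def)
qed

lemma contract_simps:
  assumes [simp]: "f \<in> Ti" "g \<in> Ti" "h \<in> Ti" "A \<in> Lo" "B \<in> Lo" "so A = tcod f"
    "to A = tcod g" "so B = tcod g" "to B = tcod h"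
  shows "contract LB (ccounit g) (cmp f) A (cnj g) (cmp g) B (cnj h) \<in> Cell"
    "dm (contract LB (ccounit g) (cmp f) A (cnj g) (cmp g) B (cnj h)) =
      ((cmp f \<odot> A) \<odot> cnj g) \<odot> ((cmp g \<odot> B) \<odot> cnj h)"
    "cd (contract LB (ccounit g) (cmp f) A (cnj g) (cmp g) B (cnj h)) = (cmp f \<odot> (A \<odot> B)) \<odot> cnj h"
    "sd (contract LB (ccounit g) (cmp f) A (cnj g) (cmp g) B (cnj h)) = idt (tdom f)"
    "td (contract LB (ccounit g) (cmp f) A (cnj g) (cmp g) B (cnj h)) = idt (tdom h)"
  by (simp_all add: contract_def)

text \<open>By \<open>contract_rest\<close> the contraction of the middle conjoint and companion
  disappears against the restriction cell, leaving a horizontal composite of projections.\<close>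

lemma tensor_comp:
  assumes [simp]: "A \<in> Lo" "B \<in> Lo" "A' \<in> Lo" "B' \<in> Lo" "to A = so A'" "to B = so B'"
  defines "k \<equiv> tmul (A, B) (A', B')"
  shows "k \<in> Cell" "dm k = tens A B \<odot> tens A' B'" "cd k = tens (A \<odot> A') (B \<odot> B')"
    "sd k = idt (oprod (so A) (so B))" "td k = idt (oprod (to A') (to B'))"
    "k \<Zsemi> tprl (A \<odot> A') (B \<odot> B') = tprl A B \<star> tprl A' B'"
    "k \<Zsemi> tprr (A \<odot> A') (B \<odot> B') = tprr A B \<star> tprr A' B'"
proof -
  let ?p = "op1 (so A) (so B)" and ?p' = "op1 (so A') (so B')" and ?p'' = "op1 (to A') (to B')"
  let ?r = "op2 (so A) (so B)" and ?r' = "op2 (so A') (so B')" and ?r'' = "op2 (to A') (to B')"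
  let ?cl = "contract LB (ccounit ?p') (cmp ?p) A (cnj ?p') (cmp ?p') A' (cnj ?p'')"
  let ?cr = "contract LB (ccounit ?r') (cmp ?r) B (cnj ?r') (cmp ?r') B' (cnj ?r'')"
  let ?a = "(tenl A B \<star> tenl A' B') \<Zsemi> ?cl" and ?b = "(tenr A B \<star> tenr A' B') \<Zsemi> ?cr"
  note [simp] = contract_simps
  have k: "k = tensor_pair LB PD (A \<odot> A') (B \<odot> B') ?a ?b"
    by (simp add: k_def tensor_comp_def Let_def)
  note t = tensor_pair [of "A \<odot> A'" "B \<odot> B'" ?a "tens A B \<odot> tens A' B'" ?b, folded k]
  show "k \<in> Cell" "dm k = tens A B \<odot> tens A' B'" "cd k = tens (A \<odot> A') (B \<odot> B')"
    "sd k = idt (oprod (so A) (so B))" "td k = idt (oprod (to A') (to B'))"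
    by (use t(1-5) in \<open>simp_all add: leg_simps\<close>)
  have c: "?cl \<Zsemi> rl (A \<odot> A') (B \<odot> B') = rl A B \<star> rl A' B'"
    "?cr \<Zsemi> rr (A \<odot> A') (B \<odot> B') = rr A B \<star> rr A' B'"
    unfolding rl_def rr_def by (simp_all add: contract_rest)
  show "k \<Zsemi> tprl (A \<odot> A') (B \<odot> B') = tprl A B \<star> tprl A' B'"
    "k \<Zsemi> tprr (A \<odot> A') (B \<odot> B') = tprr A B \<star> tprr A' B'"
    using t(6,7) c by (simp_all add: leg_simps) (simp_all add: tprl_def tprr_def leg_simps merge)
qed

text \<open>By \<open>unit_contract\<close> the units of the projection adjunctions collapse to unit
  cells of tight projections.\<close>

lemma tensor_unit:
  assumes [simp]: "I \<in> Tob" "J \<in> Tob"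
  defines "k \<equiv> tunit (I, J)"
  shows "k \<in> Cell" "dm k = li (oprod I J)" "cd k = tens (li I) (li J)"
    "sd k = idt (oprod I J)" "td k = idt (oprod I J)"
    "k \<Zsemi> tprl (li I) (li J) = un (op1 I J)" "k \<Zsemi> tprr (li I) (li J) = un (op2 I J)"
proof -
  let ?p = "op1 I J" and ?r = "op2 I J"
  let ?a = "cunit ?p \<Zsemi> (vinv (ru (cmp ?p)) \<star> idl (cnj ?p))"
  let ?b = "cunit ?r \<Zsemi> (vinv (ru (cmp ?r)) \<star> idl (cnj ?r))"
  have k: "k = tensor_pair LB PD (li I) (li J) ?a ?b"
    by (simp add: k_def tensor_unit_def)
  note t = tensor_pair [of "li I" "li J" ?a "li (oprod I J)" ?b, folded k]
  show "k \<in> Cell" "dm k = li (oprod I J)" "cd k = tens (li I) (li J)"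
    "sd k = idt (oprod I J)" "td k = idt (oprod I J)"
    by (use t(1-5) in \<open>simp_all add: leg_simps\<close>)
  show "k \<Zsemi> tprl (li I) (li J) = un ?p" "k \<Zsemi> tprr (li I) (li J) = un ?r"
    using t(6,7) unit_contract [of ?p] unit_contract [of ?r] by (simp_all add: leg_simps rl_def rr_def)
qed

text \<open>\<open>tensor_comp\<close> gives the laxity cell the same projections as the comparison
  of two product cones, so it is that comparison.\<close>

lemma tensor_comp_iso:
  assumes [simp]: "A \<in> Lo" "B \<in> Lo" "A' \<in> Lo" "B' \<in> Lo" "to A = so A'" "to B = so B'"
  shows "Iso (tmul (A, B) (A', B'))"
proof -
  note [simp] = tensor_comp [of A B A' B']
  obtain i where i: "Iso i" "dm i = tens A B \<odot> tens A' B'" "cd i = tens (A \<odot> A') (B \<odot> B')"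
    "i \<Zsemi> tprl (A \<odot> A') (B \<odot> B') = tprl A B \<star> tprl A' B'" "i \<Zsemi> tprr (A \<odot> A') (B \<odot> B') = tprr A B \<star> tprr A' B'"
    by (rule src.A.product_compare [OF tensor_lcomp_product [of A B A' B'] tensor_product [of "A \<odot> A'" "B \<odot> B'"]])
      simp_all
  have "tmul (A, B) (A', B') = i"
    by (rule tensor_eq [of "A \<odot> A'" "B \<odot> B'"]) (simp_all add: i)
  then show ?thesis using i by simp
qed

lemma tensor_unit_iso:
  assumes [simp]: "I \<in> Tob" "J \<in> Tob"
  shows "Iso (tunit (I, J))"
proof -
  note [simp] = tensor_unit [of I J]
  obtain i where i: "Iso i" "dm i = li (oprod I J)" "cd i = tens (li I) (li J)"
    "i \<Zsemi> tprl (li I) (li J) = un (op1 I J)" "i \<Zsemi> tprr (li I) (li J) = un (op2 I J)"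
    by (rule src.A.product_compare [OF li_product [of I J] tensor_product [of "li I" "li J"]]) simp_all
  have "tunit (I, J) = i"
    by (rule tensor_eq [of "li I" "li J"]) (simp_all add: i)
  then show ?thesis using i by simp
qed

section \<open>Lax functor axioms of the tensor\<close>

lemma tensor_cell_functor: "is_functor (cells (bicat_prod LB LB)) (cells LB) (lfcells (tensor_lax_functor LB PD))"
proof -
  have *: "category (cells (bicat_prod LB LB))"
    by (simp add: category_cat_prod category_cells_LB)
  show ?thesis
  proof (intro is_functor.intro is_functor_axioms.intro * category_cells_LB; clarsimp simp: tensor_lax_functor_def hom_cat_prod)
    fix a b A B A' B'
    assume ab: "a \<in> hom (cells LB) A A'" "b \<in> hom (cells LB) B B'"
    then show "tcell a b \<in> hom (cells LB) (tens A B) (tens A' B')"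
      using tensor_cell [of a A A' b B B'] by (auto simp: hom_cells_LB)
  next
    fix A B assume [simp]: "A \<in> Lo" "B \<in> Lo"
    note t = tensor_cell [of "idl A" A A "idl B" B B, simplified]
    show "tcell (idl A) (idl B) = idl (tens A B)"
      by (rule tensor_eq [of A B]) (simp_all add: t)
  next
    fix a b A B A' B' a' b' A'' B''
    assume "a \<in> hom (cells LB) A A'" "b \<in> hom (cells LB) B B'"
      "a' \<in> hom (cells LB) A' A''" "b' \<in> hom (cells LB) B' B''"
    then have [simp]: "a \<in> Cell" "dm a = A" "cd a = A'" "sd a = idt (so A)" "td a = idt (to A)"
      "b \<in> Cell" "dm b = B" "cd b = B'" "sd b = idt (so B)" "td b = idt (to B)"
      "a' \<in> Cell" "dm a' = A'" "cd a' = A''" "sd a' = idt (so A)" "td a' = idt (to A)"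
      "b' \<in> Cell" "dm b' = B'" "cd b' = B''" "sd b' = idt (so B)" "td b' = idt (to B)"
      and s [simp]: "so A' = so A" "to A' = to A" "so B' = so B" "to B' = to B"
        "so A'' = so A" "to A'' = to A" "so B'' = so B" "to B'' = to B"
      by (auto simp: hom_cells_LB)
    have [simp]: "A \<in> Lo" "A' \<in> Lo" "B \<in> Lo" "B' \<in> Lo" "A'' \<in> Lo" "B'' \<in> Lo"
      using src.A.Dom_Cod_Obj [of a] src.A.Dom_Cod_Obj [of b] src.A.Dom_Cod_Obj [of a'] src.A.Dom_Cod_Obj [of b']
      by simp_all
    note t1 = tensor_cell [of a A A' b B B', simplified]
    note t2 = tensor_cell [of a' A' A'' b' B' B'', simplified]
    note t3 = tensor_cell [of "a \<Zsemi> a'" A A'' "b \<Zsemi> b'" B B'', simplified]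
    have e: "tcell a b \<Zsemi> tprl A' B' \<Zsemi> a' = tprl A B \<Zsemi> a \<Zsemi> a'"
      "tcell a b \<Zsemi> tprr A' B' \<Zsemi> b' = tprr A B \<Zsemi> b \<Zsemi> b'"
      using t1(1-5) arg_cong [OF t1(6), of "\<lambda>x. x \<Zsemi> a'"] arg_cong [OF t1(7), of "\<lambda>x. x \<Zsemi> b'"] by simp_all
    show "tcell (a \<Zsemi> a') (b \<Zsemi> b') = tcell a b \<Zsemi> tcell a' b'"
      by (rule tensor_eq [of A'' B'']) (simp_all add: t1 t2 t3 e)
  qed
qed

text \<open>On each projection both sides reduce to a horizontal composite of two naturality
  equations from \<open>tensor_cell\<close>.\<close>

lemma tensor_comp_natural:
  assumes ab: "a \<in> hom (cells LB) A A'" "b \<in> hom (cells LB) B B'"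
    "c \<in> hom (cells LB) C C'" "d \<in> hom (cells LB) E E'"
    and [simp]: "to A = so C" "to B = so E"
  shows "(tcell a b \<star> tcell c d) \<Zsemi> tmul (A', B') (C', E') =
    tmul (A, B) (C, E) \<Zsemi> tcell (a \<star> c) (b \<star> d)"
proof -
  have [simp]: "a \<in> Cell" "dm a = A" "cd a = A'" "sd a = idt (so A)" "td a = idt (so C)"
    "b \<in> Cell" "dm b = B" "cd b = B'" "sd b = idt (so B)" "td b = idt (so E)"
    "c \<in> Cell" "dm c = C" "cd c = C'" "sd c = idt (so C)" "td c = idt (to C)"
    "d \<in> Cell" "dm d = E" "cd d = E'" "sd d = idt (so E)" "td d = idt (to E)"
    "so A' = so A" "to A' = so C" "so B' = so B" "to B' = so E"
    "so C' = so C" "to C' = to C" "so E' = so E" "to E' = to E"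
    using ab by (auto simp: hom_cells_LB)
  have [simp]: "A \<in> Lo" "A' \<in> Lo" "B \<in> Lo" "B' \<in> Lo" "C \<in> Lo" "C' \<in> Lo" "E \<in> Lo" "E' \<in> Lo"
    using src.A.Dom_Cod_Obj [of a] src.A.Dom_Cod_Obj [of b] src.A.Dom_Cod_Obj [of c] src.A.Dom_Cod_Obj [of d]
    by simp_all
  note t1 = tensor_cell [of a A A' b B B', simplified]
  note t2 = tensor_cell [of c C C' d E E', simplified]
  note t3 = tensor_cell [of "a \<star> c" "A \<odot> C" "A' \<odot> C'" "b \<star> d" "B \<odot> E" "B' \<odot> E'", simplified]
  note m1 = tensor_comp [of A B C E, simplified]
  note m2 = tensor_comp [of A' B' C' E', simplified]
  let ?m = "tmul (A, B) (C, E)"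
  have e: "?m \<Zsemi> tprl (A \<odot> C) (B \<odot> E) \<Zsemi> (a \<star> c) = (tprl A B \<star> tprl C E) \<Zsemi> (a \<star> c)"
    "?m \<Zsemi> tprr (A \<odot> C) (B \<odot> E) \<Zsemi> (b \<star> d) = (tprr A B \<star> tprr C E) \<Zsemi> (b \<star> d)"
    using m1(1-5) arg_cong [OF m1(6), of "\<lambda>x. x \<Zsemi> (a \<star> c)"] arg_cong [OF m1(7), of "\<lambda>x. x \<Zsemi> (b \<star> d)"]
    by simp_all
  show ?thesis
    by (rule tensor_eq [of "A' \<odot> C'" "B' \<odot> E'"]) (simp_all add: t1 t2 t3 m1(1-5) m2 e merge)
qed

text \<open>After projection every laxity cell is a horizontal composite of projections, and what
  remains is naturality of the associator with respect to three of them.\<close>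

lemma tensor_comp_assoc:
  assumes [simp]: "A \<in> Lo" "B \<in> Lo" "C \<in> Lo" "E \<in> Lo" "\<mu> \<in> Lo" "\<nu> \<in> Lo"
    "to A = so C" "to B = so E" "to C = so \<mu>" "to E = so \<nu>"
  shows "((tmul (A, B) (C, E) \<star> idl (tens \<mu> \<nu>)) \<Zsemi> tmul (A \<odot> C, B \<odot> E) (\<mu>, \<nu>)) \<Zsemi>
      tcell (as A C \<mu>) (as B E \<nu>) =
    (as (tens A B) (tens C E) (tens \<mu> \<nu>) \<Zsemi> (idl (tens A B) \<star> tmul (C, E) (\<mu>, \<nu>))) \<Zsemi>
      tmul (A, B) (C \<odot> \<mu>, E \<odot> \<nu>)"
proof -
  note t = tensor_cell [of "as A C \<mu>" "(A \<odot> C) \<odot> \<mu>" "A \<odot> (C \<odot> \<mu>)" "as B E \<nu>" "(B \<odot> E) \<odot> \<nu>" "B \<odot> (E \<odot> \<nu>)", simplified]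
  note m1 = tensor_comp [of A B C E, simplified]
  note m2 = tensor_comp [of "A \<odot> C" "B \<odot> E" \<mu> \<nu>, simplified]
  note m3 = tensor_comp [of C E \<mu> \<nu>, simplified]
  note m4 = tensor_comp [of A B "C \<odot> \<mu>" "E \<odot> \<nu>", simplified]
  let ?m = "tmul (A \<odot> C, B \<odot> E) (\<mu>, \<nu>)"
  \<comment> \<open>The projection equations for \<open>?m\<close> in right-nested form, with the
    trailing associator that normalization leaves behind them.\<close>
  have e: "?m \<Zsemi> tprl ((A \<odot> C) \<odot> \<mu>) ((B \<odot> E) \<odot> \<nu>) \<Zsemi> as A C \<mu> = (tprl (A \<odot> C) (B \<odot> E) \<star> tprl \<mu> \<nu>) \<Zsemi> as A C \<mu>"
    "?m \<Zsemi> tprr ((A \<odot> C) \<odot> \<mu>) ((B \<odot> E) \<odot> \<nu>) \<Zsemi> as B E \<nu> = (tprr (A \<odot> C) (B \<odot> E) \<star> tprr \<mu> \<nu>) \<Zsemi> as B E \<nu>"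
    using m2(1-5) arg_cong [OF m2(6), of "\<lambda>x. x \<Zsemi> as A C \<mu>"] arg_cong [OF m2(7), of "\<lambda>x. x \<Zsemi> as B E \<nu>"]
    by simp_all
  show ?thesis
    by (rule tensor_eq [of "A \<odot> (C \<odot> \<mu>)" "B \<odot> (E \<odot> \<nu>)"])
      (simp_all add: t m1 m2(1-5) m3 m4 e merge as_natural)
qed

text \<open>What remains after projection is naturality of the left unitor at a projection of the
  tensor; the unit cell on its source side is the one produced by
  \<open>tensor_unit\<close>.\<close>

lemma tensor_unit_left:
  assumes [simp]: "A \<in> Lo" "B \<in> Lo"
  shows "((tunit (so A, so B) \<star> idl (tens A B)) \<Zsemi>
    tmul (li (so A), li (so B)) (A, B)) \<Zsemi> tcell (lu A) (lu B) = lu (tens A B)"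
proof -
  note t = tensor_cell [of "lu A" "li (so A) \<odot> A" A "lu B" "li (so B) \<odot> B" B, simplified]
  note u = tensor_unit [of "so A" "so B", simplified]
  note m = tensor_comp [of "li (so A)" "li (so B)" A B, simplified]
  let ?m = "tmul (li (so A), li (so B)) (A, B)"
  have e: "?m \<Zsemi> tprl (li (so A) \<odot> A) (li (so B) \<odot> B) \<Zsemi> lu A = (tprl (li (so A)) (li (so B)) \<star> tprl A B) \<Zsemi> lu A"
    "?m \<Zsemi> tprr (li (so A) \<odot> A) (li (so B) \<odot> B) \<Zsemi> lu B = (tprr (li (so A)) (li (so B)) \<star> tprr A B) \<Zsemi> lu B"
    using m(1-5) arg_cong [OF m(6), of "\<lambda>x. x \<Zsemi> lu A"] arg_cong [OF m(7), of "\<lambda>x. x \<Zsemi> lu B"] by simp_all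
  show ?thesis
    by (rule tensor_eq [of A B]) (simp_all add: t u m(1-5) e merge lu_natural)
qed

lemma tensor_unit_right:
  assumes [simp]: "A \<in> Lo" "B \<in> Lo"
  shows "((idl (tens A B) \<star> tunit (to A, to B)) \<Zsemi>
    tmul (A, B) (li (to A), li (to B))) \<Zsemi> tcell (ru A) (ru B) = ru (tens A B)"
proof -
  note t = tensor_cell [of "ru A" "A \<odot> li (to A)" A "ru B" "B \<odot> li (to B)" B, simplified]
  note u = tensor_unit [of "to A" "to B", simplified]
  note m = tensor_comp [of A B "li (to A)" "li (to B)", simplified]
  let ?m = "tmul (A, B) (li (to A), li (to B))"
  have e: "?m \<Zsemi> tprl (A \<odot> li (to A)) (B \<odot> li (to B)) \<Zsemi> ru A = (tprl A B \<star> tprl (li (to A)) (li (to B))) \<Zsemi> ru A"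
    "?m \<Zsemi> tprr (A \<odot> li (to A)) (B \<odot> li (to B)) \<Zsemi> ru B = (tprr A B \<star> tprr (li (to A)) (li (to B))) \<Zsemi> ru B"
    using m(1-5) arg_cong [OF m(6), of "\<lambda>x. x \<Zsemi> ru A"] arg_cong [OF m(7), of "\<lambda>x. x \<Zsemi> ru B"] by simp_all
  show ?thesis
    by (rule tensor_eq [of A B]) (simp_all add: t u m(1-5) e merge ru_natural)
qed

lemma tensor_pseudofunctor: "pseudofunctor (bicat_prod LB LB) LB (tensor_lax_functor LB PD)"
proof -
  let ?F = "tensor_lax_functor LB PD"
  have F [simp]: "lfob ?F (I, J) = oprod I J" "fobj (lfcells ?F) (A, B) = tens A B"
    "farr (lfcells ?F) (a, b) = tcell a b" "lfcomp ?F x y = tmul x y"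
    "lfunit ?F z = tunit z" for I J A B a b x y z
    by (simp_all add: tensor_lax_functor_def)
  show ?thesis
  proof (intro pseudofunctor.intro pseudofunctor_axioms.intro lax_functor.intro lax_functor_axioms.intro
      bicategory_bicat_prod bicategory_LB tensor_cell_functor,
      simp_all only: split_paired_all bicat_prod_simps one_cells_bicat_prod hom_cat_prod mem_Times_iff fst_conv snd_conv
        map_prod_simp cat_prod_simps prod.inject F one_cells_LB, goal_cases)
    case (1 I J)
    then show ?case by simp
  next
    case (2 f f' I I' J J')
    then show ?case by auto
  next
    case (3 f f' I I' J J' g g' K K')
    then show ?case
      using tensor_comp [of f f' g g'] by (auto simp: hom_cells_LB)
  next
    case (4 I J)
    then show ?case
      using tensor_unit [of I J] by (auto simp: hom_cells_LB)
  next
    case (5 f f' I I' J J' g g' K K' a a' h h' b b' k k')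
    then show ?case
      using tensor_comp_natural [of a f h a' f' h' b g k b' g' k'] by simp
  next
    case (6 f f' I I' J J' g g' K K' h h' L L')
    then show ?case
      using tensor_comp_assoc [of f f' g g' h h'] by simp
  next
    case (7 f f' I I' J J')
    then show ?case
      using tensor_unit_left [of f f'] by simp
  next
    case (8 f f' I I' J J')
    then show ?case
      using tensor_unit_right [of f f'] by simp
  next
    case (9 f f' I I' J J' g g' K K')
    then show ?case
      using tensor_comp_iso [of f f' g g'] tensor_comp [of f f' g g'] by auto
  next
    case (10 I J)
    then show ?case
      using tensor_unit_iso [of I J] tensor_unit [of I J] by auto
  qed
qed

lemma cartesian_bicategory_LB: "cartesian_bicategory LB"
  unfolding cartesian_bicategory_def
proof (intro conjI)
  show "has_bicat_finite_products MB"
    unfolding has_bicat_finite_products_def using MB_terminal MB_product by (metis MB_simps(1))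
  show "\<exists>S. is_product_data LB S \<and> pseudofunctor bicat_one LB (unit_lax_functor LB S) \<and>
      pseudofunctor (bicat_prod LB LB) LB (tensor_lax_functor LB S)"
    using is_product_data_PD unit_pseudofunctor tensor_pseudofunctor by blast
qed (simp_all add: bicategory_LB bhom_finite_products)

end

theorem mainTheorem5:
  fixes D :: "('o, 't, 'l, 'c) dblcat"
  assumes "cartesian_equipment D"
  shows "cartesian_bicategory (loose_bicategory D)"
  using cart_equip_exists [OF assms] cart_equip.cartesian_bicategory_LB by metis

end
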